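(* Let $T$ be a stationary random transport on $\mathbb R^d$ such that $\Phi:=T(\cdot\times\mathbb R^d)$ is purely discrete and has a finite intensity. Let $L$ be a probability kernel from $\Omega\times\mathbb R^d$ to $\mathbb R^d$ satisfying $T(\mathrm d(x,y))=L(x,\mathrm dy)\,\Phi(\mathrm dx)$. Let $F\colon\mathbf M^1(\mathbb R^d)\to\Pi_d$ be a measurable mapping such that $$\int\pi'(\cdot)\,F(\pi)(\mathrm d\pi')=\pi(\cdot),\qquad F(\theta_x\pi)=\int\mathbf 1\{\theta_x\pi'\in\cdot\}\,F(\pi)(\mathrm d\pi'),\qquad x\in\mathbb R^d,\ \pi\in\mathbf M^1(\mathbb R^d).$$ Let $K$ be another probability kernel from $\Omega\times\mathbb R^d$ to $\mathbb R^d$ such that the family $\{K_x:x\in\Phi\}$ is conditionally independent given $T$, and $$\mathbb P(K_x\in\cdot\mid T)=F(L_x),\quad x\in\Phi,\ \mathbb P\text{-a.s.}$$ Finally, assume that $\mathbb E^\Phi_0\Phi\{0\}<\infty$. Then $K\Phi$ is locally square-integrable if and only if $L\Phi$ is locally square-integrable. In this case, for every $W\in\mathcal K_0$, $$\lim_{r\to\infty}\lambda_d(rW)^{-1}\operatorname{Var}[K\Phi(rW)]=\lim_{r\to\infty}\lambda_d(rW)^{-1}\operatorname{Var}[L\Phi(rW)]$$ if one of the limits exists.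
   Context: $(\Omega,\mathcal A,\mathbb P)$ is a probability space, $\lambda_d$ Lebesgue measure on $\mathbb R^d$. A random measure is a random locally finite measure. A random transport is a random measure $T$ on $\mathbb R^d\times\mathbb R^d$ such that $T(\cdot\times\mathbb R^d)$ is locally finite; it is stationary if its distribution is invariant under all diagonal shifts $\theta_xT(B\times C):=T((B+x)\times(C+x))$, $x\in\mathbb R^d$. A random measure $\Phi$ on $\mathbb R^d$ is purely discrete if it can be written as $\Phi=\sum_{n\ge1}Y_n\delta_{X_n}$ with random $Y_n\ge0$ and $X_n\in\mathbb R^d$; $\Phi\{x\}:=\Phi(\{x\})$ and $x\in\Phi$ means $\Phi\{x\}>0$. Its intensity $\gamma:=\mathbb E\Phi([0,1]^d)$ is assumed positive and finite. $\mathbb E^\Phi_0$ is expectation w.r.t. the Palm distribution of $\Phi$; explicitly $\mathbb E^\Phi_0\Phi\{0\}=\gamma^{-1}\mathbb E\int_{[0,1]^d}\Phi\{x\}\,\Phi(\mathrm dx)$. A random measure is locally square-integrable if $\mathbb E\Phi(B)^2<\infty$ for all bounded Borel $B$. For a probability kernel $K$ from $\Omega\times\mathbb R^d$ to $\mathbb R^d$, $K_x=K(x)$ is the random probability measure $\omega\mapsto K(\omega,x,\cdot)$, and $K\Phi(\omega,\cdot):=\int K(\omega,x,\cdot)\,\Phi(\omega,\mathrm dx)$. The conditional statements about $\{K_x:x\in\Phi\}$ refer to the ($T$-measurably enumerated) atoms of $\Phi$. $\mathbf M^1(\mathbb R^d)$ is the space of probability measures on $\mathbb R^d$ with the $\sigma$-field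 generated by the evaluations $\pi\mapsto\pi(B)$; $\Pi_d$ is the space of probability measures on $\mathbf M^1(\mathbb R^d)$ with the analogous $\sigma$-field; $\theta_x\pi:=\pi(\cdot+x)$. $\mathcal K_0$ is the set of convex bounded subsets of $\mathbb R^d$ containing $0$ in their interior. *)

theory Defs
  imports "HOL-Probability.Probability"
begin

section \<open>Random measures and stationary random transports\<close>

definition locally_finite_measures :: "'a::euclidean_space measure set" where
  "locally_finite_measures =
    {\<mu>. sets \<mu> = sets borel \<and> (\<forall>B\<in>sets borel. bounded B \<longrightarrow> emeasure \<mu> B < \<infinity>)}"

text \<open>The \<sigma>-field generated by the evaluations, built in the same way as
  \<^const>\<open>subprob_algebra\<close>.\<close>

definition locally_finite_algebra :: "'a::euclidean_space measure measure" where
  "locally_finite_algebra =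
    (SUP B \<in> sets borel. vimage_algebra locally_finite_measures (\<lambda>\<mu>. emeasure \<mu> B) borel)"

definition random_measure :: "'w measure \<Rightarrow> ('w \<Rightarrow> 'a::euclidean_space measure) \<Rightarrow> bool" where
  "random_measure M \<Phi> \<longleftrightarrow> \<Phi> \<in> measurable M locally_finite_algebra"

text \<open>The marginal \<open>T(\<cdot> \<times> \<real>\<^sup>d)\<close>.\<close>

definition source :: "('w \<Rightarrow> ('a::euclidean_space \<times> 'a) measure) \<Rightarrow> 'w \<Rightarrow> 'a measure" where
  "source T \<omega> = distr (T \<omega>) borel fst"

definition random_transport ::
    "'w measure \<Rightarrow> ('w \<Rightarrow> ('a::euclidean_space \<times> 'a) measure) \<Rightarrow> bool" where
  "random_transport M T \<longleftrightarrow>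
    random_measure M T \<and> (\<forall>\<omega>\<in>space M. source T \<omega> \<in> locally_finite_measures)"

text \<open>\<open>(\<theta>\<^sub>x \<mu>)(B) = \<mu>(B + x)\<close>; the diagonal shift of a measure on the product space is the
  shift by \<open>(x, x)\<close>.\<close>

definition translate :: "'a::euclidean_space \<Rightarrow> 'a measure \<Rightarrow> 'a measure" where
  "translate x \<mu> = distr \<mu> borel (\<lambda>y. y - x)"

definition stationary_transport ::
    "'w measure \<Rightarrow> ('w \<Rightarrow> ('a::euclidean_space \<times> 'a) measure) \<Rightarrow> bool" where
  "stationary_transport M T \<longleftrightarrow>
    (\<forall>x. distr M locally_finite_algebra (\<lambda>\<omega>. translate (x, x) (T \<omega>)) =
         distr M locally_finite_algebra T)"

text \<open>The identity \<open>\<Phi> = \<Sum>\<^sub>n Y\<^sub>n \<delta>\<^bsub>X\<^sub>n\<^esub>\<close> is required almost surely.\<close>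

definition purely_discrete :: "'w measure \<Rightarrow> ('w \<Rightarrow> 'a::euclidean_space measure) \<Rightarrow> bool" where
  "purely_discrete M \<Phi> \<longleftrightarrow>
    (\<exists>(Y :: nat \<Rightarrow> 'w \<Rightarrow> real) (X :: nat \<Rightarrow> 'w \<Rightarrow> 'a).
      (\<forall>n. Y n \<in> borel_measurable M \<and> (\<forall>\<omega>\<in>space M. 0 \<le> Y n \<omega>)) \<and>
      (\<forall>n. X n \<in> borel_measurable M) \<and>
      (AE \<omega> in M. \<forall>B\<in>sets borel.
         emeasure (\<Phi> \<omega>) B = (\<Sum>n. ennreal (Y n \<omega>) * indicator B (X n \<omega>))))"

definition intensity :: "'w measure \<Rightarrow> ('w \<Rightarrow> 'a::euclidean_space measure) \<Rightarrow> ennreal" where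
  "intensity M \<Phi> = (\<integral>\<^sup>+\<omega>. emeasure (\<Phi> \<omega>) (cbox 0 One) \<partial>M)"

text \<open>Expectation of \<open>f\<close> under the Palm distribution
  \<open>A \<mapsto> \<gamma>\<^sup>-\<^sup>1 \<EE> \<integral>\<^bsub>[0,1]\<^sup>d\<^esub> 1{\<theta>\<^sub>x \<Phi> \<in> A} \<Phi>(dx)\<close>.  For \<open>f \<mu> = \<mu>{0}\<close> the integrand is \<open>\<Phi>{x}\<close>.\<close>

definition palm_expectation ::
    "'w measure \<Rightarrow> ('w \<Rightarrow> 'a::euclidean_space measure) \<Rightarrow> ('a measure \<Rightarrow> ennreal) \<Rightarrow> ennreal" where
  "palm_expectation M \<Phi> f =
    inverse (intensity M \<Phi>) *
    (\<integral>\<^sup>+\<omega>. (\<integral>\<^sup>+x\<in>cbox 0 One. f (translate x (\<Phi> \<omega>)) \<partial>\<Phi> \<omega>) \<partial>M)"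

definition locally_square_integrable ::
    "'w measure \<Rightarrow> ('w \<Rightarrow> 'a::euclidean_space measure) \<Rightarrow> bool" where
  "locally_square_integrable M \<Phi> \<longleftrightarrow>
    (\<forall>B\<in>sets borel. bounded B \<longrightarrow> (\<integral>\<^sup>+\<omega>. (emeasure (\<Phi> \<omega>) B)\<^sup>2 \<partial>M) < \<infinity>)"

section \<open>Kernels\<close>

definition random_kernel ::
    "'w measure \<Rightarrow> ('w \<Rightarrow> 'a::euclidean_space \<Rightarrow> 'a measure) \<Rightarrow> bool" where
  "random_kernel M K \<longleftrightarrow> (\<lambda>(\<omega>, x). K \<omega> x) \<in> measurable (M \<Otimes>\<^sub>M borel) (prob_algebra borel)"

text \<open>\<open>T(d(x,y)) = L(x,dy) \<Phi>(dx)\<close> almost surely.\<close>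

definition disintegrates ::
    "'w measure \<Rightarrow> ('w \<Rightarrow> ('a::euclidean_space \<times> 'a) measure) \<Rightarrow> ('w \<Rightarrow> 'a measure)
      \<Rightarrow> ('w \<Rightarrow> 'a \<Rightarrow> 'a measure) \<Rightarrow> bool" where
  "disintegrates M T \<Phi> L \<longleftrightarrow>
    (AE \<omega> in M. \<forall>A\<in>sets borel.
       emeasure (T \<omega>) A = (\<integral>\<^sup>+x. (\<integral>\<^sup>+y. indicator A (x, y) \<partial>L \<omega> x) \<partial>\<Phi> \<omega>))"

text \<open>The measure \<open>K\<Phi>(\<omega>, \<cdot>) = \<integral> K(\<omega>, x, \<cdot>) \<Phi>(\<omega>, dx)\<close>; the monadic \<^const>\<open>bind\<close> is not restricted to
  sub-probability measures in its first argument.\<close>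

definition kernel_image ::
    "('w \<Rightarrow> 'a::euclidean_space \<Rightarrow> 'a measure) \<Rightarrow> ('w \<Rightarrow> 'a measure) \<Rightarrow> 'w \<Rightarrow> 'a measure" where
  "kernel_image K \<Phi> \<omega> = bind (\<Phi> \<omega>) (K \<omega>)"

section \<open>Conditioning on the transport\<close>

definition generated_by ::
    "'w measure \<Rightarrow> ('w \<Rightarrow> 'a::euclidean_space measure) \<Rightarrow> 'w measure" where
  "generated_by M T = vimage_algebra (space M) T locally_finite_algebra"

definition cond_prob_given :: "'w measure \<Rightarrow> 'w measure \<Rightarrow> 'w set \<Rightarrow> 'w \<Rightarrow> real" where
  "cond_prob_given M G E = real_cond_exp M G (indicator E)"

text \<open>A \<open>G\<close>-measurable enumeration without repetitions \<open>X 0, X 1, \<dots>\<close> of the atoms of \<open>\<Phi>\<close>.  Only the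
  \<open>X n\<close> with \<open>n < N\<close> are atoms, where \<open>N\<close> is the (possibly infinite, possibly zero) random
  number of atoms; the remaining \<open>X n\<close> are irrelevant.  An enumeration with \<open>G = \<sigma>(\<Phi>)\<close> exists for
  every random measure.\<close>

definition enumerates_atoms ::
    "'w measure \<Rightarrow> 'w measure \<Rightarrow> ('w \<Rightarrow> 'a::euclidean_space measure)
      \<Rightarrow> ('w \<Rightarrow> enat) \<Rightarrow> (nat \<Rightarrow> 'w \<Rightarrow> 'a) \<Rightarrow> bool" where
  "enumerates_atoms M G \<Phi> N X \<longleftrightarrow>
    N \<in> measurable G (count_space UNIV) \<and>
    (\<forall>n. X n \<in> borel_measurable G) \<and>
    (AE \<omega> in M. bij_betw (\<lambda>n. X n \<omega>) {n. enat n < N \<omega>} {x. emeasure (\<Phi> \<omega>) {x} > 0})"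

text \<open>Conditional independence given \<open>G\<close> of the family \<open>{Z n : n < N}\<close> with random, \<open>G\<close>-measurable index set:
  the product formula for a finite index set \<open>J\<close> is required on the event that \<open>J\<close> lies below \<open>N\<close>.\<close>

definition cond_indep_given ::
    "'w measure \<Rightarrow> 'w measure \<Rightarrow> 'b measure \<Rightarrow> ('w \<Rightarrow> enat) \<Rightarrow> (nat \<Rightarrow> 'w \<Rightarrow> 'b) \<Rightarrow> bool" where
  "cond_indep_given M G S N Z \<longleftrightarrow>
    (\<forall>J A. finite J \<longrightarrow> (\<forall>j\<in>J. A j \<in> sets S) \<longrightarrow>
      (AE \<omega> in M. (\<forall>j\<in>J. enat j < N \<omega>) \<longrightarrow>
         cond_prob_given M G {\<omega>'\<in>space M. \<forall>j\<in>J. Z j \<omega>' \<in> A j} \<omega> =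
         (\<Prod>j\<in>J. cond_prob_given M G {\<omega>'\<in>space M. Z j \<omega>' \<in> A j} \<omega>)))"

text \<open>\<open>\<bbbP>(Z n \<in> \<cdot> | G) = Q n\<close> almost surely on \<open>{n < N}\<close>, for all \<open>n\<close>.\<close>

definition cond_law_given ::
    "'w measure \<Rightarrow> 'w measure \<Rightarrow> 'b measure \<Rightarrow> ('w \<Rightarrow> enat) \<Rightarrow> (nat \<Rightarrow> 'w \<Rightarrow> 'b)
      \<Rightarrow> (nat \<Rightarrow> 'w \<Rightarrow> 'b measure) \<Rightarrow> bool" where
  "cond_law_given M G S N Z Q \<longleftrightarrow>
    (\<forall>n. \<forall>A\<in>sets S. AE \<omega> in M. enat n < N \<omega> \<longrightarrow>
       cond_prob_given M G {\<omega>'\<in>space M. Z n \<omega>' \<in> A} \<omega> = measure (Q n \<omega>) A)"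

section \<open>Averaging sets and asymptotic variance\<close>

definition convex_averaging_sets :: "'a::euclidean_space set set" where
  "convex_averaging_sets = {W. convex W \<and> bounded W \<and> 0 \<in> interior W}"

text \<open>\<open>\<lambda>\<^sub>d(rW)\<^sup>-\<^sup>1 Var[\<Psi>(rW)]\<close>.  A convex set need not be Borel; \<open>\<Psi>(rW)\<close> is \<open>0\<close>
  by the library convention for non-measurable sets if \<open>W\<close> is not.\<close>

definition normalized_variance ::
    "'w measure \<Rightarrow> ('w \<Rightarrow> 'a::euclidean_space measure) \<Rightarrow> 'a set \<Rightarrow> real \<Rightarrow> real" where
  "normalized_variance M \<Psi> W r =
    inverse (measure lebesgue ((*\<^sub>R) r ` W)) *
    prob_space.variance M (\<lambda>\<omega>. measure (\<Psi> \<omega>) ((*\<^sub>R) r ` W))"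

end

theory Submission
  imports Defs
begin

section \<open>Randomizing the kernel of a stationary transport\<close>

text \<open>
  Write \<open>\<Phi> = \<Sum>\<^sub>n a\<^sub>n \<delta>\<^bsub>X\<^sub>n\<^esub>\<close>, so that \<open>K\<Phi>(B) = \<Sum>\<^sub>n a\<^sub>n K\<^sub>n(B)\<close> with \<open>K\<^sub>n = K(X\<^sub>n)\<close>, and similarly for \<open>L\<close>.
  Conditional independence and the barycenter property of \<open>F\<close> show that the first moments and the
  off-diagonal terms \<open>E a\<^sub>m a\<^sub>n K\<^sub>m(B) K\<^sub>n(B)\<close> do not change when \<open>K\<close> is replaced by \<open>L\<close>.  Hence the
  variances differ by \<open>\<Sum>\<^sub>n E a\<^sub>n\<^sup>2 (K\<^sub>n(B)\<^sup>2 - L\<^sub>n(B)\<^sup>2)\<close>, which by Jensen's inequality is nonnegative and,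
  as \<open>K\<^sub>n(B)\<^sup>2 \<le> K\<^sub>n(B)\<close>, is at most \<open>\<Sum>\<^sub>n E a\<^sub>n\<^sup>2 L\<^sub>n(B) L\<^sub>n(-B)\<close>.  By stationarity the last sum equals
  \<open>E \<Sum>\<^sub>n 1{X\<^sub>n \<in> [0,1]\<^sup>d} a\<^sub>n\<^sup>2 \<integral>\<integral> \<lambda>{t. y + t \<in> B, z + t \<notin> B} L\<^sub>n(dy) L\<^sub>n(dz)\<close>.  The Palm hypothesis makes this finite,
  and for \<open>B = rW\<close> it is of smaller order than \<open>\<lambda>(rW)\<close> by dominated convergence.
\<close>

section \<open>Kernels of locally finite measures\<close>


text \<open>Replacing \<open>K\<close> by \<open>L\<close> is a computation given \<open>T\<close>
  along an enumeration of the atoms, whereas stationarity concerns the law of \<open>T\<close>, and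
  an enumeration need not be compatible with shifts. The two views meet in
  \<open>diag_integral\<close>, which integrates twice against \<open>T\<close> over pairs with a
  common first coordinate. It is a measurable functional of \<open>T\<close> that mentions no
  enumeration, and on a purely discrete source it is a sum over the atoms with squared masses. The
  products L_n(B) L_n(-B) are of this form, so the error term depends on \<open>T\<close> alone and
  stationarity of \<open>T\<close> applies to it. Second moments may be infinite. They are compared
  in \<open>ennreal\<close> through an additive identity without differences; the Palm hypothesis
  makes the diagonal terms finite on bounded sets, which permits cancellation and the passage to
  real variances. The boundary estimate rests on a ball of radius \<epsilon> inside W: a
  displacement by v costs at most |v| / \<epsilon> in the scale r, hence a fraction 1 - (1 - |v| /
  (\<epsilon> r))^d of the volume, which tends to 0 for each fixed v.\<close>

lemma space_locally_finite_algebra: "space locally_finite_algebra = locally_finite_measures"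
proof -
  have "sets (borel :: 'a measure) \<noteq> {}" by auto
  then show ?thesis
    by (auto simp add: locally_finite_algebra_def space_Sup_eq_UN)
qed

lemma measurable_emeasure_locally_finite_algebra:
  "B \<in> sets borel \<Longrightarrow> (\<lambda>\<mu>. emeasure \<mu> B) \<in> borel_measurable locally_finite_algebra"
  by (auto intro!: measurable_Sup1 measurable_vimage_algebra1 simp: locally_finite_algebra_def)

lemma measurable_locally_finite_algebraI:
  assumes "\<And>x. x \<in> space N \<Longrightarrow> k x \<in> locally_finite_measures"
    and "\<And>B. B \<in> sets borel \<Longrightarrow> (\<lambda>x. emeasure (k x) B) \<in> borel_measurable N"
  shows "k \<in> measurable N locally_finite_algebra"
  using assms
  by (auto intro!: measurable_Sup2 measurable_vimage_algebra2 simp: locally_finite_algebra_def)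

lemma locally_finite_measuresD:
  assumes "\<mu> \<in> locally_finite_measures"
  shows "sets \<mu> = sets borel" "space \<mu> = UNIV"
    "\<And>B. B \<in> sets borel \<Longrightarrow> bounded B \<Longrightarrow> emeasure \<mu> B < \<infinity>"
proof -
  show "sets \<mu> = sets borel" using assms by (simp add: locally_finite_measures_def)
  then show "space \<mu> = UNIV" using sets_eq_imp_space_eq[of \<mu> borel] by simp
  show "emeasure \<mu> B < \<infinity>" if "B \<in> sets borel" "bounded B" for B
    using assms that by (simp add: locally_finite_measures_def)
qed

lemma sigma_finite_locally_finite:
  fixes \<mu> :: "'a::euclidean_space measure"
  assumes "\<mu> \<in> locally_finite_measures"
  shows "sigma_finite_measure \<mu>"
proof
  note D = locally_finite_measuresD[OF assms]
  show "\<exists>A. countable A \<and> A \<subseteq> sets \<mu> \<and> \<Union> A = space \<mu> \<and> (\<forall>a\<in>A. emeasure \<mu> a \<noteq> \<infinity>)"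
  proof (intro exI conjI)
    show "countable (range (\<lambda>n::nat. ball (0::'a) (real n)))" by simp
    show "range (\<lambda>n::nat. ball (0::'a) (real n)) \<subseteq> sets \<mu>" by (auto simp: D)
    show "\<Union> (range (\<lambda>n::nat. ball (0::'a) (real n))) = space \<mu>"
      by (auto simp: D intro: reals_Archimedean2)
    show "\<forall>a\<in>range (\<lambda>n::nat. ball (0::'a) (real n)). emeasure \<mu> a \<noteq> \<infinity>"
      using D(3) by (auto simp: less_top[symmetric])
  qed
qed

lemma measurable_lf_kernelD:
  assumes "k \<in> measurable N locally_finite_algebra" "x \<in> space N"
  shows "k x \<in> locally_finite_measures"
  using measurable_space[OF assms] by (simp add: space_locally_finite_algebra)

lemma measurable_emeasure_lf_kernel:
  assumes "k \<in> measurable N locally_finite_algebra" "B \<in> sets borel"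
  shows "(\<lambda>x. emeasure (k x) B) \<in> borel_measurable N"
  using measurable_compose[OF assms(1) measurable_emeasure_locally_finite_algebra[OF assms(2)]] .

text \<open>Dynkin class argument over rectangles. Intersecting with a bounded \<open>Q\<close>
  makes the complement step work: there the section is subtracted from \<open>Q\<close>, which
  requires finite measure.\<close>

lemma measurable_emeasure_lf_kernel_section_bounded:
  fixes k :: "'w \<Rightarrow> 'a::euclidean_space measure"
  assumes k: "k \<in> measurable N locally_finite_algebra"
    and A: "A \<in> sets (N \<Otimes>\<^sub>M borel)" and Q: "Q \<in> sets borel" "bounded Q"
  shows "(\<lambda>x. emeasure (k x) (Pair x -` A \<inter> Q)) \<in> borel_measurable N"
proof -
  note D = locally_finite_measuresD[OF measurable_lf_kernelD[OF k]]
  have sec: "Pair x -` A \<in> sets borel" if "A \<in> sets (N \<Otimes>\<^sub>M borel)" for A x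
    using sets_Pair1[OF that] .
  let ?G = "{a \<times> b |a b. a \<in> sets N \<and> b \<in> sets (borel :: 'a measure)}"
  have A': "A \<in> sigma_sets (space N \<times> UNIV) ?G"
    using A by (simp add: sets_pair_measure)
  have eq: "sigma_sets (space N \<times> UNIV) ?G = sets (N \<Otimes>\<^sub>M borel)"
    by (simp add: sets_pair_measure)
  show ?thesis
  proof (rule sigma_sets_induct_disjoint[OF Int_stable_pair_measure_generator _ A', where P="\<lambda>A. (\<lambda>x. emeasure (k x) (Pair x -` A \<inter> Q)) \<in> borel_measurable N"])
    show "?G \<subseteq> Pow (space N \<times> UNIV)" using sets.sets_into_space by fastforce
  next
    fix A assume "A \<in> ?G"
    then obtain a b where ab: "A = a \<times> b" "a \<in> sets N" "b \<in> sets borel" by blast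
    have "emeasure (k x) (Pair x -` A \<inter> Q) = indicator a x * emeasure (k x) (b \<inter> Q)" for x
      by (cases "x \<in> a") (auto simp: ab)
    moreover have [measurable]: "(\<lambda>x. emeasure (k x) (b \<inter> Q)) \<in> borel_measurable N" "a \<in> sets N"
      using ab Q by (auto intro: measurable_emeasure_lf_kernel[OF k])
    ultimately show "(\<lambda>x. emeasure (k x) (Pair x -` A \<inter> Q)) \<in> borel_measurable N"
      by simp
  next
    show "(\<lambda>x. emeasure (k x) (Pair x -` {} \<inter> Q)) \<in> borel_measurable N" by simp
  next
    fix A assume A: "A \<in> sigma_sets (space N \<times> UNIV) ?G"
      and m[measurable]: "(\<lambda>x. emeasure (k x) (Pair x -` A \<inter> Q)) \<in> borel_measurable N"
    have [measurable]: "(\<lambda>x. emeasure (k x) Q) \<in> borel_measurable N"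
      using measurable_emeasure_lf_kernel[OF k Q(1)] .
    have "(\<lambda>x. emeasure (k x) Q - emeasure (k x) (Pair x -` A \<inter> Q)) \<in> borel_measurable N"
      by measurable
    also have "?this \<longleftrightarrow> (\<lambda>x. emeasure (k x) (Pair x -` (space N \<times> UNIV - A) \<inter> Q)) \<in> borel_measurable N"
    proof (rule measurable_cong)
      fix x assume x: "x \<in> space N"
      have s: "Pair x -` A \<in> sets borel" using sec A eq by auto
      have "emeasure (k x) (Pair x -` A \<inter> Q) \<le> emeasure (k x) Q"
        using D[OF x] Q by (intro emeasure_mono) auto
      also have "\<dots> < \<infinity>" using D(3)[OF x] Q by auto
      finally have fin: "emeasure (k x) (Pair x -` A \<inter> Q) \<noteq> \<infinity>" by auto
      have "Pair x -` (space N \<times> UNIV - A) \<inter> Q = Q - (Pair x -` A \<inter> Q)" using x by auto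
      then show "emeasure (k x) Q - emeasure (k x) (Pair x -` A \<inter> Q) =
        emeasure (k x) (Pair x -` (space N \<times> UNIV - A) \<inter> Q)"
        using D[OF x] Q s fin by (simp add: emeasure_Diff)
    qed
    finally show "(\<lambda>x. emeasure (k x) (Pair x -` (space N \<times> UNIV - A) \<inter> Q)) \<in> borel_measurable N" .
  next
    fix A :: "nat \<Rightarrow> _" assume dis: "disjoint_family A" and A: "range A \<subseteq> sigma_sets (space N \<times> UNIV) ?G"
      and m[measurable]: "\<And>i. (\<lambda>x. emeasure (k x) (Pair x -` A i \<inter> Q)) \<in> borel_measurable N"
    have "(\<lambda>x. \<Sum>i. emeasure (k x) (Pair x -` A i \<inter> Q)) \<in> borel_measurable N"
      by measurable
    also have "?this \<longleftrightarrow> (\<lambda>x. emeasure (k x) (Pair x -` (\<Union> (range A)) \<inter> Q)) \<in> borel_measurable N"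
    proof (rule measurable_cong)
      fix x assume x: "x \<in> space N"
      have s: "Pair x -` A i \<in> sets borel" for i using sec[of "A i"] A eq by auto
      have dis': "i = j" if "z \<in> A i" "z \<in> A j" for i j z
        using disjoint_family_onD[OF dis, of i j] that by auto
      have "(\<Sum>i. emeasure (k x) (Pair x -` A i \<inter> Q)) = emeasure (k x) (\<Union>i. Pair x -` A i \<inter> Q)"
        using D(1)[OF x] Q s by (intro suminf_emeasure) (auto simp: disjoint_family_on_def dest: dis')
      also have "(\<Union>i. Pair x -` A i \<inter> Q) = Pair x -` (\<Union> (range A)) \<inter> Q" by auto
      finally show "(\<Sum>i. emeasure (k x) (Pair x -` A i \<inter> Q)) = emeasure (k x) (Pair x -` (\<Union> (range A)) \<inter> Q)" .
    qed
    finally show "(\<lambda>x. emeasure (k x) (Pair x -` (\<Union> (range A)) \<inter> Q)) \<in> borel_measurable N" .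
  qed
qed

text \<open>The kernel may have infinite total mass, so the bounded case is applied to balls of
  integer radius, on which the measures of the section increase to the full value.\<close>

lemma measurable_emeasure_lf_kernel_section:
  fixes k :: "'w \<Rightarrow> 'a::euclidean_space measure"
  assumes k: "k \<in> measurable N locally_finite_algebra"
    and A: "A \<in> sets (N \<Otimes>\<^sub>M borel)"
  shows "(\<lambda>x. emeasure (k x) (Pair x -` A)) \<in> borel_measurable N"
proof -
  have [measurable]: "(\<lambda>x. emeasure (k x) (Pair x -` A \<inter> ball 0 (real n))) \<in> borel_measurable N" for n :: nat
    using measurable_emeasure_lf_kernel_section_bounded[OF k A] by simp
  have "(\<lambda>x. SUP n. emeasure (k x) (Pair x -` A \<inter> ball 0 (real n))) \<in> borel_measurable N"
    by measurable
  also have "?this \<longleftrightarrow> ?thesis"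
  proof (rule measurable_cong)
    fix x assume x: "x \<in> space N"
    note D = locally_finite_measuresD[OF measurable_lf_kernelD[OF k x]]
    have "(SUP n. emeasure (k x) (Pair x -` A \<inter> ball 0 (real n))) =
      emeasure (k x) (\<Union>n. Pair x -` A \<inter> ball 0 (real n))"
    proof (rule SUP_emeasure_incseq)
      show "range (\<lambda>n. Pair x -` A \<inter> ball 0 (real n)) \<subseteq> sets (k x)"
        using sets_Pair1[OF A, of x] by (auto simp: D(1))
      show "incseq (\<lambda>n. Pair x -` A \<inter> ball 0 (real n))"
        by (auto simp: incseq_def)
    qed
    also have "(\<Union>n. Pair x -` A \<inter> ball 0 (real n)) = Pair x -` A"
      by (auto intro: reals_Archimedean2)
    finally show "(SUP n. emeasure (k x) (Pair x -` A \<inter> ball 0 (real n))) = emeasure (k x) (Pair x -` A)" .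
  qed
  finally show ?thesis .
qed

text \<open>A random measure is read as a kernel on its probability space, in general of infinite
  mass. Monotone class induction with the sections as base case; iterating it yields measurability
  of double integrals against \<open>T\<close>.\<close>

lemma nn_integral_measurable_lf_kernel:
  fixes k :: "'w \<Rightarrow> 'a::euclidean_space measure"
  assumes k: "k \<in> measurable N locally_finite_algebra"
    and f: "f \<in> borel_measurable (N \<Otimes>\<^sub>M borel)"
  shows "(\<lambda>x. \<integral>\<^sup>+y. f (x, y) \<partial>k x) \<in> borel_measurable N"
proof -
  note D = locally_finite_measuresD[OF measurable_lf_kernelD[OF k]]
  have msec: "(\<lambda>y. u (x, y)) \<in> borel_measurable (k x)"
    if "u \<in> borel_measurable (N \<Otimes>\<^sub>M borel)" "x \<in> space N" for u :: "'w \<times> 'a \<Rightarrow> ennreal" and x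
    using measurable_compose[OF measurable_Pair1'[OF that(2)] that(1)] D(1)[OF that(2)]
    by (simp cong: measurable_cong_sets)
  show ?thesis using f
  proof induct
    case (cong f g)
    have "(\<lambda>x. \<integral>\<^sup>+y. f (x, y) \<partial>k x) \<in> borel_measurable N \<longleftrightarrow> (\<lambda>x. \<integral>\<^sup>+y. g (x, y) \<partial>k x) \<in> borel_measurable N"
      by (intro measurable_cong nn_integral_cong cong(3)) (auto simp: space_pair_measure)
    with cong show ?case by simp
  next
    case (set A)
    have "(\<integral>\<^sup>+y. indicator A (x, y) \<partial>k x) = emeasure (k x) (Pair x -` A)" if "x \<in> space N" for x
    proof -
      have "(\<integral>\<^sup>+y. indicator A (x, y) \<partial>k x) = (\<integral>\<^sup>+y. indicator (Pair x -` A) y \<partial>k x)"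
        by (intro nn_integral_cong) (auto simp: indicator_def)
      also have "\<dots> = emeasure (k x) (Pair x -` A)"
        using sets_Pair1[OF set, of x] D[OF that] by (intro nn_integral_indicator) simp
      finally show ?thesis .
    qed
    with measurable_emeasure_lf_kernel_section[OF k set] show ?case
      by (simp cong: measurable_cong)
  next
    case (mult u c)
    have "(\<lambda>x. c * (\<integral>\<^sup>+y. u (x, y) \<partial>k x)) \<in> borel_measurable N" using mult by measurable
    also have "?this \<longleftrightarrow> (\<lambda>x. \<integral>\<^sup>+y. c * u (x, y) \<partial>k x) \<in> borel_measurable N"
      by (intro measurable_cong) (simp add: nn_integral_cmult msec mult(2))
    finally show ?case .
  next
    case (add u v)
    have "(\<lambda>x. (\<integral>\<^sup>+y. u (x, y) \<partial>k x) + (\<integral>\<^sup>+y. v (x, y) \<partial>k x)) \<in> borel_measurable N"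
      using add by measurable
    also have "?this \<longleftrightarrow> (\<lambda>x. \<integral>\<^sup>+y. u (x, y) + v (x, y) \<partial>k x) \<in> borel_measurable N"
      by (intro measurable_cong) (simp add: nn_integral_add msec add(1,4))
    finally show ?case
      by (simp add: add.commute)
  next
    case (seq U)
    have [measurable]: "(\<lambda>x. \<integral>\<^sup>+y. U i (x, y) \<partial>k x) \<in> borel_measurable N" for i
      using seq by auto
    have "(\<lambda>x. SUP i. \<integral>\<^sup>+y. U i (x, y) \<partial>k x) \<in> borel_measurable N" by measurable
    also have "?this \<longleftrightarrow> (\<lambda>x. \<integral>\<^sup>+y. (SUP i. U i) (x, y) \<partial>k x) \<in> borel_measurable N"
      using seq(4)
      by (intro measurable_cong)
         (auto simp: nn_integral_monotone_convergence_SUP[symmetric] msec seq(1) incseq_def le_fun_def image_comp)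
    finally show ?case .
  qed
qed

section \<open>Translations of locally finite measures\<close>

lemma translate_locally_finite:
  fixes \<mu> :: "'a::euclidean_space measure"
  assumes \<mu>: "\<mu> \<in> locally_finite_measures"
  shows "translate x \<mu> \<in> locally_finite_measures"
proof -
  note D = locally_finite_measuresD[OF \<mu>]
  have m: "(\<lambda>y. y - x) \<in> measurable \<mu> borel"
    using D(1) by (simp cong: measurable_cong_sets)
  have "emeasure (translate x \<mu>) B < \<infinity>" if B: "B \<in> sets borel" "bounded B" for B
  proof -
    have eq: "(\<lambda>y. y - x) -` B = (\<lambda>y. y + x) ` B"
      by (auto simp: image_iff) (metis diff_add_cancel)
    have "bounded ((\<lambda>y. y + x) ` B)"
      using bounded_translation[OF B(2), of x] by (simp add: add.commute)
    moreover have "(\<lambda>y. y - x) -` B \<in> sets borel"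
      using measurable_sets[OF m B(1)] D by simp
    ultimately show ?thesis
      using D(3)[of "(\<lambda>y. y - x) -` B"] B D(2) m by (simp add: translate_def emeasure_distr eq)
  qed
  then show ?thesis by (auto simp: locally_finite_measures_def translate_def)
qed

text \<open>Makes the translated transport a random element of the same space, so that integrals
  under the two laws in the stationarity hypothesis can be pulled back to the probability
  space.\<close>

lemma measurable_translate:
  "translate x \<in> measurable locally_finite_algebra (locally_finite_algebra :: 'a::euclidean_space measure measure)"
proof (rule measurable_locally_finite_algebraI)
  fix \<mu> :: "'a measure" assume "\<mu> \<in> space locally_finite_algebra"
  then show "translate x \<mu> \<in> locally_finite_measures"
    by (simp add: translate_locally_finite space_locally_finite_algebra)
next
  fix B :: "'a set" assume B: "B \<in> sets borel"
  have m: "(\<lambda>y. y - x) -` B \<in> sets borel"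
    using measurable_sets[of "\<lambda>y. y - x" borel borel B] B by simp
  have "(\<lambda>\<mu>. emeasure \<mu> ((\<lambda>y. y - x) -` B)) \<in> borel_measurable locally_finite_algebra"
    using m by (rule measurable_emeasure_locally_finite_algebra)
  also have "?this \<longleftrightarrow> (\<lambda>\<mu>. emeasure (translate x \<mu>) B) \<in> borel_measurable locally_finite_algebra"
  proof (rule measurable_cong)
    fix \<mu> :: "'a measure" assume "\<mu> \<in> space locally_finite_algebra"
    then have D: "sets \<mu> = sets borel" "space \<mu> = UNIV"
      using locally_finite_measuresD by (auto simp: space_locally_finite_algebra)
    have "(\<lambda>y. y - x) \<in> measurable \<mu> borel" using D(1) by (simp cong: measurable_cong_sets)
    then show "emeasure \<mu> ((\<lambda>y. y - x) -` B) = emeasure (translate x \<mu>) B"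
      using B D by (simp add: translate_def emeasure_distr)
  qed
  finally show "(\<lambda>\<mu>. emeasure (translate x \<mu>) B) \<in> borel_measurable locally_finite_algebra" .
qed

section \<open>Purely discrete measures\<close>


text \<open>Two descriptions of \<open>\<mu>\<close> are reconciled: the points \<open>x n\<close>
  may repeat or carry weight zero, whereas \<open>X\<close> lists each atom once on
  \<open>I\<close>. A weight sitting at a point that is not an atom is bounded by the mass of that
  point and hence vanishes, so the complement of the set of atoms is null and the integrand can be
  expanded over the atoms.\<close>

lemma nn_integral_purely_discrete:
  fixes \<mu> :: "'a::euclidean_space measure" and X :: "nat \<Rightarrow> 'a"
  assumes sets: "sets \<mu> = sets borel"
    and disc: "\<And>B. B \<in> sets borel \<Longrightarrow> emeasure \<mu> B = (\<Sum>n. ennreal (Y n) * indicator B (x n))"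
    and bij: "bij_betw X I {x. emeasure \<mu> {x} > 0}"
    and f: "f \<in> borel_measurable borel"
  shows "(\<integral>\<^sup>+x. f x \<partial>\<mu>) = (\<Sum>n. (if n \<in> I then emeasure \<mu> {X n} else 0) * f (X n))"
proof -
  define D where "D = {x. emeasure \<mu> {x} > 0}"
  have D: "D = X ` I" "inj_on X I"
    using bij by (auto simp: bij_betw_def D_def)
  have "countable D" by (simp add: D)
  then have Db: "D \<in> sets borel" by (rule sets.countable[rotated]) simp
  have fm: "f \<in> borel_measurable \<mu>"
    using f sets by (simp cong: measurable_cong_sets)
  have summand0: "ennreal (Y n) * indicator (- D) (x n) = 0" for n
  proof (cases "x n \<in> D")
    case False
    have "ennreal (Y n) = (\<Sum>i. if i = n then ennreal (Y i) * indicator {x n} (x i) else 0)"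
      by (rule sums_unique) (use sums_single[of n "\<lambda>i. ennreal (Y i) * indicator {x n} (x i)"] in simp)
    also have "\<dots> \<le> (\<Sum>i. ennreal (Y i) * indicator {x n} (x i))"
      by (intro suminf_le) auto
    also have "\<dots> = emeasure \<mu> {x n}" using disc[of "{x n}"] by simp
    also have "\<dots> = 0" using False by (simp add: D_def)
    finally show ?thesis by simp
  qed simp
  have null: "emeasure \<mu> (- D) = 0"
    using disc[of "- D"] Db summand0 by simp
  have AE: "AE x in \<mu>. x \<in> D"
    by (rule AE_I[OF _ null]) (use Db sets in auto)
  have "(\<integral>\<^sup>+x. f x \<partial>\<mu>) = (\<integral>\<^sup>+x. (\<Sum>n. (if n \<in> I then f (X n) else 0) * indicator {X n} x) \<partial>\<mu>)"
  proof (rule nn_integral_cong_AE, rule AE_mp[OF AE], rule AE_I2, rule impI)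
    fix x assume "x \<in> D"
    then obtain n where n: "n \<in> I" "x = X n" using D by auto
    have "(\<Sum>m. (if m \<in> I then f (X m) else 0) * indicator {X m} x) = (\<Sum>m. if m = n then f (X m) else 0)"
      using n D(2) by (intro arg_cong[where f=suminf]) (auto simp: fun_eq_iff inj_on_def indicator_def)
    also have "\<dots> = f x"
      using sums_unique[OF sums_single[of n "\<lambda>m. f (X m)"]] n by simp
    finally show "f x = (\<Sum>n. (if n \<in> I then f (X n) else 0) * indicator {X n} x)" ..
  qed
  also have "\<dots> = (\<Sum>n. \<integral>\<^sup>+x. (if n \<in> I then f (X n) else 0) * indicator {X n} x \<partial>\<mu>)"
  proof (rule nn_integral_suminf)
    fix n
    have [measurable]: "{X n} \<in> sets \<mu>" by (simp add: sets)
    show "(\<lambda>x. (if n \<in> I then f (X n) else 0) * indicator {X n} x) \<in> borel_measurable \<mu>"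
      by measurable
  qed
  also have "\<dots> = (\<Sum>n. (if n \<in> I then emeasure \<mu> {X n} else 0) * f (X n))"
    by (intro arg_cong[where f=suminf]) (auto simp: fun_eq_iff nn_integral_cmult_indicator sets mult.commute)
  finally show ?thesis .
qed

text \<open>The disintegration is given for sets only. It identifies \<open>\<tau>\<close> with the
  monadic composition of \<open>\<mu>\<close> and the kernel sending \<open>x\<close> to the law of
  \<open>(x, y)\<close> with \<open>y\<close> drawn from \<open>L x\<close>; the integral formula
  for \<open>bind\<close> then covers all measurable functions.\<close>

lemma nn_integral_disintegration:
  fixes \<mu> :: "'a::euclidean_space measure" and \<tau> :: "('a \<times> 'a) measure"
  assumes \<tau>: "sets \<tau> = sets borel" and \<mu>: "sets \<mu> = sets borel"
    and L: "L \<in> measurable borel (prob_algebra borel)"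
    and dis: "\<And>A. A \<in> sets borel \<Longrightarrow> emeasure \<tau> A = (\<integral>\<^sup>+x. (\<integral>\<^sup>+y. indicator A (x, y) \<partial>L x) \<partial>\<mu>)"
    and f: "f \<in> borel_measurable borel"
  shows "(\<integral>\<^sup>+p. f p \<partial>\<tau>) = (\<integral>\<^sup>+x. (\<integral>\<^sup>+y. f (x, y) \<partial>L x) \<partial>\<mu>)"
proof -
  let ?k = "\<lambda>x. distr (L x) borel (Pair x)"
  have setsL: "sets (L x) = sets borel" for x
    using measurable_space[OF L, of x] by (simp add: space_prob_algebra)
  have Lm: "L \<in> measurable \<mu> (subprob_algebra borel)"
    using measurable_prob_algebraD[OF L] \<mu> by (simp cong: measurable_cong_sets)
  have "(\<lambda>(x, y). (x, y)) \<in> borel_measurable (\<mu> \<Otimes>\<^sub>M (borel :: 'a measure))"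
  proof -
    have "sets (\<mu> \<Otimes>\<^sub>M (borel :: 'a measure)) = sets (borel :: ('a \<times> 'a) measure)"
      unfolding borel_prod[symmetric] by (rule sets_pair_measure_cong[OF \<mu> refl])
    then show ?thesis by (simp cong: measurable_cong_sets add: case_prod_eta)
  qed
  then have k: "?k \<in> measurable \<mu> (subprob_algebra borel)"
    by (intro measurable_distr2[OF _ Lm]) simp
  have P: "Pair x \<in> measurable (L x) borel" for x
    using setsL by (simp cong: measurable_cong_sets add: borel_prod[symmetric])
  have ne: "space \<mu> \<noteq> {}" using sets_eq_imp_space_eq[OF \<mu>] by simp
  have "\<tau> = bind \<mu> ?k"
  proof (rule measure_eqI)
    show "sets \<tau> = sets (bind \<mu> ?k)"
      using ne \<tau> by (subst sets_bind[where N=borel]) auto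
    fix A assume "A \<in> sets \<tau>"
    then have A: "A \<in> sets borel" using \<tau> by simp
    have "emeasure (bind \<mu> ?k) A = (\<integral>\<^sup>+x. emeasure (?k x) A \<partial>\<mu>)"
      using ne k A by (rule emeasure_bind)
    also have "\<dots> = (\<integral>\<^sup>+x. (\<integral>\<^sup>+y. indicator A (x, y) \<partial>L x) \<partial>\<mu>)"
    proof (rule nn_integral_cong)
      fix x
      have "emeasure (?k x) A = (\<integral>\<^sup>+p. indicator A p \<partial>?k x)" using A by simp
      also have "\<dots> = (\<integral>\<^sup>+y. indicator A (x, y) \<partial>L x)"
        by (rule nn_integral_distr[OF P]) (use A in simp)
      finally show "emeasure (?k x) A = (\<integral>\<^sup>+y. indicator A (x, y) \<partial>L x)" .
    qed
    finally show "emeasure \<tau> A = emeasure (bind \<mu> ?k) A" using dis[OF A] by simp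
  qed
  then have "(\<integral>\<^sup>+p. f p \<partial>\<tau>) = (\<integral>\<^sup>+x. (\<integral>\<^sup>+p. f p \<partial>?k x) \<partial>\<mu>)"
    using nn_integral_bind[OF f k] by simp
  also have "\<dots> = (\<integral>\<^sup>+x. (\<integral>\<^sup>+y. f (x, y) \<partial>L x) \<partial>\<mu>)"
    by (intro nn_integral_cong nn_integral_distr P f[THEN measurable_compose[rotated]]) (use f in auto)
  finally show ?thesis .
qed

text \<open>The integral of \<open>f x y z\<close> over \<open>\<tau>(d(x,y)) \<tau>(d(x',z))\<close> restricted to \<open>x = x'\<close>; only the atoms of the
  first marginal contribute.\<close>

definition diag_integral :: "('a::euclidean_space \<Rightarrow> 'a \<Rightarrow> 'a \<Rightarrow> ennreal) \<Rightarrow> ('a \<times> 'a) measure \<Rightarrow> ennreal" where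
  "diag_integral f \<tau> = (\<integral>\<^sup>+p. \<integral>\<^sup>+q. (if fst p = fst q then f (fst p) (snd p) (snd q) else 0) \<partial>\<tau> \<partial>\<tau>)"

text \<open>Expanding both integrals gives a double series over \<open>m\<close> and
  \<open>n\<close>. Equality of first coordinates and injectivity of \<open>X\<close> on
  \<open>I\<close> leave the terms with \<open>m = n\<close>, whence the squared weight. In each of
  them \<open>y\<close> and \<open>z\<close> are two independent draws from the same measure
  \<open>L (X n)\<close>.\<close>

lemma diag_integral_eq_suminf:
  fixes \<tau> :: "('a::euclidean_space \<times> 'a) measure" and a :: "nat \<Rightarrow> ennreal"
  assumes \<tau>: "\<tau> \<in> locally_finite_measures"
    and sum: "\<And>g. g \<in> borel_measurable borel \<Longrightarrow> (\<integral>\<^sup>+p. g p \<partial>\<tau>) = (\<Sum>n. a n * (\<integral>\<^sup>+y. g (X n, y) \<partial>L (X n)))"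
    and L: "L \<in> measurable borel (prob_algebra borel)"
    and inj: "inj_on X I" and a0: "\<And>n. n \<notin> I \<Longrightarrow> a n = 0"
    and f[measurable]: "(\<lambda>(x, y, z). f x y z) \<in> borel_measurable (borel \<Otimes>\<^sub>M borel \<Otimes>\<^sub>M borel)"
  shows "diag_integral f \<tau> = (\<Sum>n. a n * a n * (\<integral>\<^sup>+y. \<integral>\<^sup>+z. f (X n) y z \<partial>L (X n) \<partial>L (X n)))"
proof -
  interpret sigma_finite_measure \<tau> by (rule sigma_finite_locally_finite[OF \<tau>])
  note D = locally_finite_measuresD[OF \<tau>]
  let ?h = "\<lambda>p q. if fst p = fst q then f (fst p) (snd p) (snd q) else 0"
  have fm[measurable]: "(\<lambda>w. f (u w) (v w) (t w)) \<in> borel_measurable M"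
    if [measurable]: "u \<in> borel_measurable M" "v \<in> borel_measurable M" "t \<in> borel_measurable M" for u v t and M :: "'m measure"
  proof -
    have "(\<lambda>w. (u w, v w, t w)) \<in> measurable M (borel \<Otimes>\<^sub>M borel \<Otimes>\<^sub>M borel)" by measurable
    from measurable_compose[OF this f] show ?thesis by simp
  qed
  have h: "(\<lambda>(p, q). ?h p q) \<in> borel_measurable (borel \<Otimes>\<^sub>M borel)"
    unfolding borel_prod[symmetric] case_prod_beta'
    by (intro measurable_If fm) measurable
  have inner: "(\<integral>\<^sup>+q. ?h p q \<partial>\<tau>) = (\<Sum>m. a m * (\<integral>\<^sup>+z. (if fst p = X m then f (fst p) (snd p) z else 0) \<partial>L (X m)))" for p
  proof -
    have "(\<lambda>q. ?h p q) \<in> borel_measurable borel"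
      using measurable_Pair2[OF h, of p] by simp
    from sum[OF this] show ?thesis by (simp cong: if_cong)
  qed
  have inner': "(\<integral>\<^sup>+q. ?h (X n, y) q \<partial>\<tau>) = a n * (\<integral>\<^sup>+z. f (X n) y z \<partial>L (X n))" if n: "n \<in> I" for n y
  proof -
    \<comment> \<open>For \<open>m\<close> outside \<open>I\<close> the point \<open>X m\<close> may
      coincide with \<open>X n\<close>; there the weight \<open>a m\<close> is zero.\<close>
    have eq: "a m * (\<integral>\<^sup>+z. (if X n = X m then f (X n) y z else 0) \<partial>L (X m))
         = (if m = n then a m * (\<integral>\<^sup>+z. f (X m) y z \<partial>L (X m)) else 0)" for m
    proof (cases "X n = X m \<and> m \<in> I")
      case True
      then have "m = n" using inj n by (auto simp: inj_on_def)
      then show ?thesis by simp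
    next
      case False
      then show ?thesis using a0[of m] n by auto
    qed
    have "(\<integral>\<^sup>+q. ?h (X n, y) q \<partial>\<tau>) = (\<Sum>m. a m * (\<integral>\<^sup>+z. (if X n = X m then f (X n) y z else 0) \<partial>L (X m)))"
      by (rule trans[OF inner]) (simp only: fst_conv snd_conv)
    also have "\<dots> = (\<Sum>m. if m = n then a m * (\<integral>\<^sup>+z. f (X m) y z \<partial>L (X m)) else 0)"
      by (simp only: eq)
    also have "\<dots> = a n * (\<integral>\<^sup>+z. f (X n) y z \<partial>L (X n))"
      using sums_unique[OF sums_single[of n "\<lambda>m. a m * (\<integral>\<^sup>+z. f (X m) y z \<partial>L (X m))"]] by simp
    finally show ?thesis .
  qed
  have "(\<lambda>(p, q). ?h p q) \<in> borel_measurable (borel \<Otimes>\<^sub>M \<tau>)"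
    using h unfolding measurable_cong_sets[OF sets_pair_measure_cong[OF refl D(1)] refl] .
  then have "(\<lambda>p. \<integral>\<^sup>+q. ?h p q \<partial>\<tau>) \<in> borel_measurable borel"
    by (rule borel_measurable_nn_integral)
  from sum[OF this] have "diag_integral f \<tau> = (\<Sum>n. a n * (\<integral>\<^sup>+y. (\<integral>\<^sup>+q. ?h (X n, y) q \<partial>\<tau>) \<partial>L (X n)))"
    by (simp add: diag_integral_def)
  also have "\<dots> = (\<Sum>n. a n * (\<integral>\<^sup>+y. a n * (\<integral>\<^sup>+z. f (X n) y z \<partial>L (X n)) \<partial>L (X n)))"
  proof (rule arg_cong[where f=suminf], rule ext)
    fix n show "a n * (\<integral>\<^sup>+y. (\<integral>\<^sup>+q. ?h (X n, y) q \<partial>\<tau>) \<partial>L (X n)) = a n * (\<integral>\<^sup>+y. a n * (\<integral>\<^sup>+z. f (X n) y z \<partial>L (X n)) \<partial>L (X n))"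
      using inner' a0 by (cases "n \<in> I") simp_all
  qed
  also have "\<dots> = (\<Sum>n. a n * a n * (\<integral>\<^sup>+y. \<integral>\<^sup>+z. f (X n) y z \<partial>L (X n) \<partial>L (X n)))"
  proof (rule arg_cong[where f=suminf], rule ext)
    fix n
    have Ln: "L (X n) \<in> space (prob_algebra borel)" using measurable_space[OF L] by simp
    then have sL: "sets (L (X n)) = sets borel" and pL: "prob_space (L (X n))"
      by (auto simp: space_prob_algebra)
    interpret Ln: prob_space "L (X n)" by fact
    have "(\<lambda>(y, z). f (X n) y z) \<in> borel_measurable (L (X n) \<Otimes>\<^sub>M L (X n))"
      unfolding measurable_cong_sets[OF sets_pair_measure_cong[OF sL sL] refl] case_prod_beta'
      by (intro fm) measurable
    then have "(\<lambda>y. \<integral>\<^sup>+z. f (X n) y z \<partial>L (X n)) \<in> borel_measurable (L (X n))"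
      by (rule Ln.borel_measurable_nn_integral)
    then show "a n * (\<integral>\<^sup>+y. a n * (\<integral>\<^sup>+z. f (X n) y z \<partial>L (X n)) \<partial>L (X n)) =
       a n * a n * (\<integral>\<^sup>+y. \<integral>\<^sup>+z. f (X n) y z \<partial>L (X n) \<partial>L (X n))"
      by (simp add: nn_integral_cmult mult.assoc)
  qed
  finally show ?thesis .
qed

section \<open>Conditional laws\<close>


text \<open>Extension from indicators to nonnegative functions. The weights \<open>u\<close> and
  \<open>v\<close> of the two sides may differ, so that in a two-variable identity the factor of the
  other variable can be absorbed into them and the lemma applied once per variable.\<close>

lemma nn_integral_kernel_induct:
  fixes u v :: "'w \<Rightarrow> ennreal"
  assumes [measurable]: "u \<in> borel_measurable M" "v \<in> borel_measurable M"
    and Z[measurable]: "Z \<in> measurable M S" and Q[measurable]: "Q \<in> measurable M (prob_algebra S)"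
    and eq: "\<And>A. A \<in> sets S \<Longrightarrow>
      (\<integral>\<^sup>+\<omega>. u \<omega> * indicator A (Z \<omega>) \<partial>M) = (\<integral>\<^sup>+\<omega>. v \<omega> * emeasure (Q \<omega>) A \<partial>M)"
    and h: "h \<in> borel_measurable S"
  shows "(\<integral>\<^sup>+\<omega>. u \<omega> * h (Z \<omega>) \<partial>M) = (\<integral>\<^sup>+\<omega>. v \<omega> * (\<integral>\<^sup>+x. h x \<partial>Q \<omega>) \<partial>M)"
proof -
  have Qs: "sets (Q \<omega>) = sets S" if "\<omega> \<in> space M" for \<omega>
    using measurable_space[OF Q that] by (simp add: space_prob_algebra)
  have Qm: "g \<in> borel_measurable (Q \<omega>)" if "g \<in> borel_measurable S" "\<omega> \<in> space M" for g :: "_ \<Rightarrow> ennreal" and \<omega>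
    using that unfolding measurable_cong_sets[OF Qs[OF that(2)] refl] by simp
  have Qi[measurable]: "(\<lambda>\<omega>. \<integral>\<^sup>+x. g x \<partial>Q \<omega>) \<in> borel_measurable M" if "g \<in> borel_measurable S" for g :: "_ \<Rightarrow> ennreal"
    using measurable_compose[OF measurable_prob_algebraD[OF Q] nn_integral_measurable_subprob_algebra[OF that]] .
  show ?thesis using h
  proof induct
    case (cong f g)
    have "(\<integral>\<^sup>+\<omega>. u \<omega> * f (Z \<omega>) \<partial>M) = (\<integral>\<^sup>+\<omega>. u \<omega> * g (Z \<omega>) \<partial>M)"
      using cong(3) measurable_space[OF Z] by (intro nn_integral_cong) auto
    moreover have "(\<integral>\<^sup>+\<omega>. v \<omega> * (\<integral>\<^sup>+x. f x \<partial>Q \<omega>) \<partial>M) = (\<integral>\<^sup>+\<omega>. v \<omega> * (\<integral>\<^sup>+x. g x \<partial>Q \<omega>) \<partial>M)"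
      using cong(3) sets_eq_imp_space_eq[OF Qs]
      by (intro nn_integral_cong arg_cong2[where f="(*)"] refl) auto
    ultimately show ?case using cong(4) by simp
  next
    case (set A)
    have "(\<integral>\<^sup>+\<omega>. v \<omega> * (\<integral>\<^sup>+x. indicator A x \<partial>Q \<omega>) \<partial>M) = (\<integral>\<^sup>+\<omega>. v \<omega> * emeasure (Q \<omega>) A \<partial>M)"
      using set Qs by (intro nn_integral_cong) (simp add: nn_integral_indicator)
    with eq[OF set] show ?case by simp
  next
    case (mult g c)
    note [measurable] = mult(2)
    have "(\<integral>\<^sup>+\<omega>. u \<omega> * (c * g (Z \<omega>)) \<partial>M) = c * (\<integral>\<^sup>+\<omega>. u \<omega> * g (Z \<omega>) \<partial>M)"
      by (subst nn_integral_cmult[symmetric]) (auto intro!: nn_integral_cong simp: mult_ac)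
    also have "\<dots> = (\<integral>\<^sup>+\<omega>. c * (v \<omega> * (\<integral>\<^sup>+x. g x \<partial>Q \<omega>)) \<partial>M)"
      unfolding mult(4) by (rule nn_integral_cmult[symmetric]) (use Qi[OF mult(2)] in measurable)
    also have "\<dots> = (\<integral>\<^sup>+\<omega>. v \<omega> * (\<integral>\<^sup>+x. c * g x \<partial>Q \<omega>) \<partial>M)"
      by (intro nn_integral_cong) (simp add: nn_integral_cmult Qm mult(2) mult_ac)
    finally show ?case .
  next
    case (add g g')
    note [measurable] = add(1,4)
    have "(\<integral>\<^sup>+\<omega>. u \<omega> * (g' (Z \<omega>) + g (Z \<omega>)) \<partial>M) = (\<integral>\<^sup>+\<omega>. u \<omega> * g' (Z \<omega>) \<partial>M) + (\<integral>\<^sup>+\<omega>. u \<omega> * g (Z \<omega>) \<partial>M)"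
      by (subst nn_integral_add[symmetric]) (auto intro!: nn_integral_cong simp: distrib_left)
    also have "\<dots> = (\<integral>\<^sup>+\<omega>. v \<omega> * (\<integral>\<^sup>+x. g' x \<partial>Q \<omega>) + v \<omega> * (\<integral>\<^sup>+x. g x \<partial>Q \<omega>) \<partial>M)"
      unfolding add(3) add(7) by (rule nn_integral_add[symmetric]) (use Qi[OF add(1)] Qi[OF add(4)] in measurable)
    also have "\<dots> = (\<integral>\<^sup>+\<omega>. v \<omega> * (\<integral>\<^sup>+x. g' x + g x \<partial>Q \<omega>) \<partial>M)"
      by (intro nn_integral_cong) (simp add: nn_integral_add Qm add(1,4) distrib_left)
    finally show ?case by simp
  next
    case (seq U)
    note [measurable] = seq(1)
    have "(\<integral>\<^sup>+\<omega>. u \<omega> * (SUP i. U i) (Z \<omega>) \<partial>M) = (\<integral>\<^sup>+\<omega>. (SUP i. u \<omega> * U i (Z \<omega>)) \<partial>M)"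
      by (simp add: SUP_mult_left_ennreal image_comp)
    also have "\<dots> = (SUP i. \<integral>\<^sup>+\<omega>. u \<omega> * U i (Z \<omega>) \<partial>M)"
      using seq(4) by (intro nn_integral_monotone_convergence_SUP)
        (auto simp: incseq_def le_fun_def intro!: mult_left_mono)
    also have "\<dots> = (SUP i. \<integral>\<^sup>+\<omega>. v \<omega> * (\<integral>\<^sup>+x. U i x \<partial>Q \<omega>) \<partial>M)"
      using seq(3) by simp
    also have "\<dots> = (\<integral>\<^sup>+\<omega>. (SUP i. v \<omega> * (\<integral>\<^sup>+x. U i x \<partial>Q \<omega>)) \<partial>M)"
      using seq(4) Qi[OF seq(1)] by (intro nn_integral_monotone_convergence_SUP[symmetric])
        (auto simp: incseq_def le_fun_def intro!: mult_left_mono nn_integral_mono)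
    also have "\<dots> = (\<integral>\<^sup>+\<omega>. v \<omega> * (\<integral>\<^sup>+x. (SUP i. U i) x \<partial>Q \<omega>) \<partial>M)"
    proof (intro nn_integral_cong)
      fix \<omega> assume "\<omega> \<in> space M"
      then have "(\<integral>\<^sup>+x. (SUP i. U i x) \<partial>Q \<omega>) = (SUP i. \<integral>\<^sup>+x. U i x \<partial>Q \<omega>)"
        by (intro nn_integral_monotone_convergence_SUP[OF seq(4) Qm[OF seq(1)]])
      then show "(SUP i. v \<omega> * (\<integral>\<^sup>+x. U i x \<partial>Q \<omega>)) = v \<omega> * (\<integral>\<^sup>+x. (SUP i. U i) x \<partial>Q \<omega>)"
        by (simp add: SUP_mult_left_ennreal image_comp)
    qed
    finally show ?case .
  qed
qed

text \<open>\<open>cond_prob_given\<close> is a real conditional expectation, while the weight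
  \<open>c\<close> may be infinite or not integrable. The argument therefore uses the nonnegative
  conditional expectation, which is at most 1 and so loses nothing in the conversion to a real
  number.\<close>

lemma nn_integral_cond_prob_given:
  assumes "prob_space M" and G: "subalgebra M G"
    and E[measurable]: "E \<in> sets M" and c: "c \<in> borel_measurable G"
  shows "(\<integral>\<^sup>+\<omega>. c \<omega> * indicator E \<omega> \<partial>M) = (\<integral>\<^sup>+\<omega>. c \<omega> * ennreal (cond_prob_given M G E \<omega>) \<partial>M)"
proof -
  interpret prob_space M by fact
  interpret G: finite_measure_subalgebra M G by unfold_locales (rule G)
  let ?e = "nn_cond_exp M G (\<lambda>\<omega>. ennreal (indicator E \<omega>))"
  have "AE \<omega> in M. ?e \<omega> \<le> nn_cond_exp M G (\<lambda>_. 1) \<omega>"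
    by (intro G.nn_cond_exp_mono AE_I2) (auto simp: indicator_def)
  moreover have "AE \<omega> in M. 1 = nn_cond_exp M G (\<lambda>_. 1) \<omega>"
    by (rule G.nn_cond_exp_F_meas) simp
  \<comment> \<open>\<open>real_cond_exp\<close> is the difference of the conditional expectations
    of the positive and the negative part; for an indicator the second one vanishes.\<close>
  moreover have "AE \<omega> in M. 0 = nn_cond_exp M G (\<lambda>\<omega>. ennreal (- indicator E \<omega>)) \<omega>"
  proof -
    have "(\<lambda>\<omega>. ennreal (- indicator E \<omega>)) = (\<lambda>_. 0)" by (auto simp: indicator_def fun_eq_iff ennreal_neg)
    then show ?thesis using G.nn_cond_exp_F_meas[of "\<lambda>_. 0"] by simp
  qed
  ultimately have AE: "AE \<omega> in M. ennreal (cond_prob_given M G E \<omega>) = ?e \<omega>"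
  proof eventually_elim
    case (elim \<omega>)
    then have "?e \<omega> < \<infinity>" by (metis ennreal_one_less_top infinity_ennreal_def le_less_trans)
    with elim show ?case by (simp add: cond_prob_given_def real_cond_exp_def elim(3)[symmetric])
  qed
  have "(\<integral>\<^sup>+\<omega>. c \<omega> * indicator E \<omega> \<partial>M) = (\<integral>\<^sup>+\<omega>. c \<omega> * ?e \<omega> \<partial>M)"
    using G.nn_cond_exp_intg[OF c, of "\<lambda>\<omega>. ennreal (indicator E \<omega>)"] by (simp add: ennreal_indicator)
  also have "\<dots> = (\<integral>\<^sup>+\<omega>. c \<omega> * ennreal (cond_prob_given M G E \<omega>) \<partial>M)"
    using AE by (intro nn_integral_cong_AE) auto
  finally show ?thesis .
qed

text \<open>The conditional law is prescribed only where \<open>c\<close> is nonzero. Elsewhere both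
  integrands vanish, and this is how a law known for the indices below \<open>N\<close> becomes an
  identity of unconditional integrals.\<close>

lemma nn_integral_cond_law:
  assumes M: "prob_space M" and G: "subalgebra M G"
    and c: "c \<in> borel_measurable G"
    and Z[measurable]: "Z \<in> measurable M S" and Q[measurable]: "Q \<in> measurable M (prob_algebra S)"
    and law: "\<And>A. A \<in> sets S \<Longrightarrow> AE \<omega> in M. c \<omega> \<noteq> 0 \<longrightarrow>
      cond_prob_given M G {\<omega>'\<in>space M. Z \<omega>' \<in> A} \<omega> = measure (Q \<omega>) A"
    and h: "h \<in> borel_measurable S"
  shows "(\<integral>\<^sup>+\<omega>. c \<omega> * h (Z \<omega>) \<partial>M) = (\<integral>\<^sup>+\<omega>. c \<omega> * (\<integral>\<^sup>+x. h x \<partial>Q \<omega>) \<partial>M)"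
proof (rule nn_integral_kernel_induct[OF _ _ Z Q _ h])
  show cM: "c \<in> borel_measurable M" "c \<in> borel_measurable M"
    using measurable_from_subalg[OF G c] by auto
  fix A assume A[measurable]: "A \<in> sets S"
  have "(\<integral>\<^sup>+\<omega>. c \<omega> * indicator A (Z \<omega>) \<partial>M) = (\<integral>\<^sup>+\<omega>. c \<omega> * indicator {\<omega>\<in>space M. Z \<omega> \<in> A} \<omega> \<partial>M)"
    by (intro nn_integral_cong) (auto simp: indicator_def)
  also have "\<dots> = (\<integral>\<^sup>+\<omega>. c \<omega> * ennreal (cond_prob_given M G {\<omega>\<in>space M. Z \<omega> \<in> A} \<omega>) \<partial>M)"
    by (intro nn_integral_cond_prob_given M G c) measurable
  also have "\<dots> = (\<integral>\<^sup>+\<omega>. c \<omega> * emeasure (Q \<omega>) A \<partial>M)"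
  proof (rule nn_integral_cong_AE, rule AE_mp[OF law[OF A]], rule AE_I2, rule impI)
    fix \<omega> assume \<omega>: "\<omega> \<in> space M"
      and l: "c \<omega> \<noteq> 0 \<longrightarrow> cond_prob_given M G {\<omega>'\<in>space M. Z \<omega>' \<in> A} \<omega> = measure (Q \<omega>) A"
    interpret Q: prob_space "Q \<omega>" using measurable_space[OF Q \<omega>] by (simp add: space_prob_algebra)
    show "c \<omega> * ennreal (cond_prob_given M G {\<omega>\<in>space M. Z \<omega> \<in> A} \<omega>) = c \<omega> * emeasure (Q \<omega>) A"
      using l by (cases "c \<omega> = 0") (simp_all add: Q.emeasure_eq_measure)
  qed
  finally show "(\<integral>\<^sup>+\<omega>. c \<omega> * indicator A (Z \<omega>) \<partial>M) = (\<integral>\<^sup>+\<omega>. c \<omega> * emeasure (Q \<omega>) A \<partial>M)" .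
qed

text \<open>The product formula is known for pairs of events. With the event of \<open>Z2\<close>
  kept inside the weight it extends to functions of \<open>Z1\<close>, and with such a function
  inside the weight it extends to functions of \<open>Z2\<close>.\<close>

lemma nn_integral_cond_indep_pair:
  assumes M: "prob_space M" and G: "subalgebra M G"
    and c: "c \<in> borel_measurable G"
    and Z1[measurable]: "Z1 \<in> measurable M S" and Q1[measurable]: "Q1 \<in> measurable M (prob_algebra S)"
    and Z2[measurable]: "Z2 \<in> measurable M S" and Q2[measurable]: "Q2 \<in> measurable M (prob_algebra S)"
    and law: "\<And>A B. A \<in> sets S \<Longrightarrow> B \<in> sets S \<Longrightarrow> AE \<omega> in M. c \<omega> \<noteq> 0 \<longrightarrow>
      cond_prob_given M G {\<omega>'\<in>space M. Z1 \<omega>' \<in> A \<and> Z2 \<omega>' \<in> B} \<omega> = measure (Q1 \<omega>) A * measure (Q2 \<omega>) B"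
    and h1[measurable]: "h1 \<in> borel_measurable S" and h2: "h2 \<in> borel_measurable S"
  shows "(\<integral>\<^sup>+\<omega>. c \<omega> * h1 (Z1 \<omega>) * h2 (Z2 \<omega>) \<partial>M) =
    (\<integral>\<^sup>+\<omega>. c \<omega> * (\<integral>\<^sup>+x. h1 x \<partial>Q1 \<omega>) * (\<integral>\<^sup>+x. h2 x \<partial>Q2 \<omega>) \<partial>M)"
proof (rule nn_integral_kernel_induct[OF _ _ Z2 Q2 _ h2])
  have cM[measurable]: "c \<in> borel_measurable M"
    using measurable_from_subalg[OF G c] by auto
  have [measurable]: "(\<lambda>\<omega>. \<integral>\<^sup>+x. h1 x \<partial>Q1 \<omega>) \<in> borel_measurable M"
    using measurable_compose[OF measurable_prob_algebraD[OF Q1] nn_integral_measurable_subprob_algebra[OF h1]] .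
  have emQ2[measurable]: "(\<lambda>\<omega>. emeasure (Q2 \<omega>) B) \<in> borel_measurable M" if "B \<in> sets S" for B
    using measurable_compose[OF measurable_prob_algebraD[OF Q2] measurable_emeasure_subprob_algebra[OF that]] .
  show "(\<lambda>\<omega>. c \<omega> * h1 (Z1 \<omega>)) \<in> borel_measurable M" "(\<lambda>\<omega>. c \<omega> * (\<integral>\<^sup>+x. h1 x \<partial>Q1 \<omega>)) \<in> borel_measurable M"
    by measurable
  fix B assume B[measurable]: "B \<in> sets S"
  have "(\<integral>\<^sup>+\<omega>. (c \<omega> * indicator B (Z2 \<omega>)) * h1 (Z1 \<omega>) \<partial>M) = (\<integral>\<^sup>+\<omega>. (c \<omega> * emeasure (Q2 \<omega>) B) * (\<integral>\<^sup>+x. h1 x \<partial>Q1 \<omega>) \<partial>M)"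
  proof (rule nn_integral_kernel_induct[OF _ _ Z1 Q1 _ h1])
    show "(\<lambda>\<omega>. c \<omega> * indicator B (Z2 \<omega>)) \<in> borel_measurable M" "(\<lambda>\<omega>. c \<omega> * emeasure (Q2 \<omega>) B) \<in> borel_measurable M"
      by measurable
    fix A assume A[measurable]: "A \<in> sets S"
    let ?E = "{\<omega>\<in>space M. Z1 \<omega> \<in> A \<and> Z2 \<omega> \<in> B}"
    have "(\<integral>\<^sup>+\<omega>. c \<omega> * indicator B (Z2 \<omega>) * indicator A (Z1 \<omega>) \<partial>M) = (\<integral>\<^sup>+\<omega>. c \<omega> * indicator ?E \<omega> \<partial>M)"
      by (intro nn_integral_cong) (auto simp: indicator_def)
    also have "\<dots> = (\<integral>\<^sup>+\<omega>. c \<omega> * ennreal (cond_prob_given M G ?E \<omega>) \<partial>M)"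
      by (intro nn_integral_cond_prob_given M G c) measurable
    also have "\<dots> = (\<integral>\<^sup>+\<omega>. c \<omega> * emeasure (Q2 \<omega>) B * emeasure (Q1 \<omega>) A \<partial>M)"
    proof (rule nn_integral_cong_AE, rule AE_mp[OF law[OF A B]], rule AE_I2, rule impI)
      fix \<omega> assume \<omega>: "\<omega> \<in> space M"
        and l: "c \<omega> \<noteq> 0 \<longrightarrow> cond_prob_given M G ?E \<omega> = measure (Q1 \<omega>) A * measure (Q2 \<omega>) B"
      interpret Q1: prob_space "Q1 \<omega>" using measurable_space[OF Q1 \<omega>] by (simp add: space_prob_algebra)
      interpret Q2: prob_space "Q2 \<omega>" using measurable_space[OF Q2 \<omega>] by (simp add: space_prob_algebra)
      show "c \<omega> * ennreal (cond_prob_given M G ?E \<omega>) = c \<omega> * emeasure (Q2 \<omega>) B * emeasure (Q1 \<omega>) A"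
        using l by (cases "c \<omega> = 0") (simp_all add: Q1.emeasure_eq_measure Q2.emeasure_eq_measure ennreal_mult' mult_ac)
    qed
    finally show "(\<integral>\<^sup>+\<omega>. c \<omega> * indicator B (Z2 \<omega>) * indicator A (Z1 \<omega>) \<partial>M) =
      (\<integral>\<^sup>+\<omega>. c \<omega> * emeasure (Q2 \<omega>) B * emeasure (Q1 \<omega>) A \<partial>M)" .
  qed
  then show "(\<integral>\<^sup>+\<omega>. c \<omega> * h1 (Z1 \<omega>) * indicator B (Z2 \<omega>) \<partial>M) =
    (\<integral>\<^sup>+\<omega>. c \<omega> * (\<integral>\<^sup>+x. h1 x \<partial>Q1 \<omega>) * emeasure (Q2 \<omega>) B \<partial>M)"
    by (simp add: mult_ac)
qed

text \<open>Jensen's inequality for the square, obtained from the nonnegativity of a variance; the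
  bound by 1 makes both moments finite, so that real integrals can be used.\<close>

lemma (in prob_space) nn_integral_power2_ge:
  assumes [measurable]: "f \<in> borel_measurable M" and fin: "\<And>x. x \<in> space M \<Longrightarrow> f x \<le> 1"
  shows "(\<integral>\<^sup>+x. f x \<partial>M)\<^sup>2 \<le> (\<integral>\<^sup>+x. (f x)\<^sup>2 \<partial>M)"
proof -
  define g where "g x = enn2real (f x)" for x
  have f: "f x = ennreal (g x)" "0 \<le> g x" "g x \<le> 1" if "x \<in> space M" for x
  proof -
    have "f x < \<top>" using le_less_trans[OF fin[OF that] ennreal_one_less_top] .
    then show "f x = ennreal (g x)" by (simp add: g_def)
    show "0 \<le> g x" by (simp add: g_def)
    show "g x \<le> 1" unfolding g_def using fin[OF that] by (intro enn2real_leI) simp_all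
  qed
  have [measurable]: "g \<in> borel_measurable M" unfolding g_def by measurable
  have int: "integrable M g" "integrable M (\<lambda>x. (g x)\<^sup>2)"
    using f by (auto intro!: integrable_const_bound[where B=1] simp: power_le_one)
  have "(\<integral>\<^sup>+x. f x \<partial>M) = (\<integral>\<^sup>+x. ennreal (g x) \<partial>M)" using f by (intro nn_integral_cong) auto
  also have "\<dots> = ennreal (expectation g)" using f int by (intro nn_integral_eq_integral) auto
  finally have 1: "(\<integral>\<^sup>+x. f x \<partial>M) = ennreal (expectation g)" .
  have "(\<integral>\<^sup>+x. (f x)\<^sup>2 \<partial>M) = (\<integral>\<^sup>+x. ennreal ((g x)\<^sup>2) \<partial>M)" using f by (intro nn_integral_cong) (auto simp: ennreal_power)
  also have "\<dots> = ennreal (expectation (\<lambda>x. (g x)\<^sup>2))" using f int by (intro nn_integral_eq_integral) auto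
  finally have 2: "(\<integral>\<^sup>+x. (f x)\<^sup>2 \<partial>M) = ennreal (expectation (\<lambda>x. (g x)\<^sup>2))" .
  have "0 \<le> variance g" by (rule variance_positive)
  then have "(expectation g)\<^sup>2 \<le> expectation (\<lambda>x. (g x)\<^sup>2)" using variance_eq[OF int] by simp
  moreover have "0 \<le> expectation g" using f by (intro Bochner_Integration.integral_nonneg) auto
  ultimately show ?thesis unfolding 1 2 by (simp add: ennreal_power ennreal_leI)
qed

section \<open>Mass transport\<close>


text \<open>The parameter space is left general because three choices occur: an outcome, an outcome
  together with a shift, and the measure itself with \<open>k\<close> the identity.\<close>

lemma measurable_diag_integral:
  fixes k :: "'w \<Rightarrow> ('a::euclidean_space \<times> 'a) measure"
  assumes k: "k \<in> measurable N locally_finite_algebra"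
    and f: "(\<lambda>(n, x, y, z). f n x y z) \<in> borel_measurable (N \<Otimes>\<^sub>M borel \<Otimes>\<^sub>M borel \<Otimes>\<^sub>M borel)"
  shows "(\<lambda>n. diag_integral (f n) (k n)) \<in> borel_measurable N"
proof -
  have fm: "(\<lambda>w. f (m w) (u w) (v w) (t w)) \<in> borel_measurable M'"
    if [measurable]: "m \<in> measurable M' N" "u \<in> borel_measurable M'" "v \<in> borel_measurable M'" "t \<in> borel_measurable M'"
    for m u v t and M' :: "'m measure"
  proof -
    have "(\<lambda>w. (m w, u w, v w, t w)) \<in> measurable M' (N \<Otimes>\<^sub>M borel \<Otimes>\<^sub>M borel \<Otimes>\<^sub>M borel)" by measurable
    from measurable_compose[OF this f] show ?thesis by simp
  qed
  let ?h = "\<lambda>n p q. if fst p = fst q then f n (fst p) (snd p) (snd q) else 0"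
  have "(\<lambda>w. ?h (fst (fst w)) (snd (fst w)) (snd w)) \<in> borel_measurable ((N \<Otimes>\<^sub>M (borel \<Otimes>\<^sub>M borel)) \<Otimes>\<^sub>M (borel \<Otimes>\<^sub>M borel))"
    by (intro measurable_If fm) measurable
  then have h: "(\<lambda>w. ?h (fst (fst w)) (snd (fst w)) (snd w)) \<in> borel_measurable ((N \<Otimes>\<^sub>M borel) \<Otimes>\<^sub>M borel)"
    unfolding borel_prod .
  have k': "(\<lambda>w. k (fst w)) \<in> measurable (N \<Otimes>\<^sub>M (borel :: ('a \<times> 'a) measure)) locally_finite_algebra"
    using measurable_compose[OF measurable_fst k] .
  have "(\<lambda>w. \<integral>\<^sup>+q. ?h (fst w) (snd w) q \<partial>k (fst w)) \<in> borel_measurable (N \<Otimes>\<^sub>M borel)"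
    using nn_integral_measurable_lf_kernel[OF k' h] by (simp cong: if_cong)
  from nn_integral_measurable_lf_kernel[OF k this]
  show ?thesis by (simp add: diag_integral_def cong: if_cong)
qed

lemma diag_integral_nn_integral:
  fixes \<tau> :: "('a::euclidean_space \<times> 'a) measure"
  assumes \<tau>: "\<tau> \<in> locally_finite_measures" and S: "sigma_finite_measure S"
    and f: "(\<lambda>(t, x, y, z). f t x y z) \<in> borel_measurable (S \<Otimes>\<^sub>M borel \<Otimes>\<^sub>M borel \<Otimes>\<^sub>M borel)"
  shows "diag_integral (\<lambda>x y z. \<integral>\<^sup>+t. f t x y z \<partial>S) \<tau> = (\<integral>\<^sup>+t. diag_integral (f t) \<tau> \<partial>S)"
proof -
  interpret \<tau>: sigma_finite_measure \<tau> by (rule sigma_finite_locally_finite[OF \<tau>])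
  interpret S: sigma_finite_measure S by (rule S)
  interpret P: pair_sigma_finite S \<tau> by unfold_locales
  note sets\<tau> = locally_finite_measuresD(1)[OF \<tau>]
  have fm: "(\<lambda>w. f (m w) (u w) (v w) (t w)) \<in> borel_measurable M'"
    if [measurable]: "m \<in> measurable M' S" "u \<in> borel_measurable M'" "v \<in> borel_measurable M'" "t \<in> borel_measurable M'"
    for m u v t and M' :: "'m measure"
  proof -
    have "(\<lambda>w. (m w, u w, v w, t w)) \<in> measurable M' (S \<Otimes>\<^sub>M borel \<Otimes>\<^sub>M borel \<Otimes>\<^sub>M borel)" by measurable
    from measurable_compose[OF this f] show ?thesis by simp
  qed
  let ?h = "\<lambda>t p q. if fst p = fst q then f t (fst p) (snd p) (snd q) else 0"
  have h: "(\<lambda>((t, p), q). ?h t p q) \<in> borel_measurable ((S \<Otimes>\<^sub>M \<tau>) \<Otimes>\<^sub>M \<tau>)"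
    unfolding measurable_cong_sets[OF sets_pair_measure_cong[OF sets_pair_measure_cong[OF refl sets\<tau>] sets\<tau>] refl]
    unfolding case_prod_beta' borel_prod[symmetric]
    by (intro measurable_If fm) measurable
  have hp: "(\<lambda>(t, q). ?h t p q) \<in> borel_measurable (S \<Otimes>\<^sub>M \<tau>)" for p
    unfolding measurable_cong_sets[OF sets_pair_measure_cong[OF refl sets\<tau>] refl]
    unfolding case_prod_beta' borel_prod[symmetric]
    by (intro measurable_If fm) measurable
  have hi: "(\<lambda>(t, p). \<integral>\<^sup>+q. ?h t p q \<partial>\<tau>) \<in> borel_measurable (S \<Otimes>\<^sub>M \<tau>)"
    using \<tau>.borel_measurable_nn_integral[of "\<lambda>w q. ?h (fst w) (snd w) q" "S \<Otimes>\<^sub>M \<tau>"] h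
    by (simp add: case_prod_beta')
  have "diag_integral (\<lambda>x y z. \<integral>\<^sup>+t. f t x y z \<partial>S) \<tau> = (\<integral>\<^sup>+p. \<integral>\<^sup>+q. \<integral>\<^sup>+t. ?h t p q \<partial>S \<partial>\<tau> \<partial>\<tau>)"
    unfolding diag_integral_def by (intro nn_integral_cong) auto
  also have "\<dots> = (\<integral>\<^sup>+p. \<integral>\<^sup>+t. \<integral>\<^sup>+q. ?h t p q \<partial>\<tau> \<partial>S \<partial>\<tau>)"
    by (intro nn_integral_cong P.Fubini'[OF hp])
  also have "\<dots> = (\<integral>\<^sup>+t. \<integral>\<^sup>+p. \<integral>\<^sup>+q. ?h t p q \<partial>\<tau> \<partial>\<tau> \<partial>S)"
    by (rule P.Fubini'[OF hi])
  finally show ?thesis unfolding diag_integral_def .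
qed

text \<open>The diagonal shift moves both coordinates by the same vector, so the constraint of equal
  first coordinates is preserved and only the arguments of \<open>f\<close> change.\<close>

lemma diag_integral_translate:
  fixes \<tau> :: "('a::euclidean_space \<times> 'a) measure"
  assumes \<tau>: "\<tau> \<in> locally_finite_measures"
    and f: "(\<lambda>(x, y, z). f x y z) \<in> borel_measurable (borel \<Otimes>\<^sub>M borel \<Otimes>\<^sub>M borel)"
  shows "diag_integral f (translate (t, t) \<tau>) = diag_integral (\<lambda>x y z. f (x - t) (y - t) (z - t)) \<tau>"
proof -
  note sets\<tau> = locally_finite_measuresD(1)[OF \<tau>]
  have tm: "(\<lambda>p. p - (t, t)) \<in> measurable \<tau> borel"
    unfolding measurable_cong_sets[OF sets\<tau> refl] by measurable
  interpret sigma_finite_measure "translate (t, t) \<tau>"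
    by (rule sigma_finite_locally_finite[OF translate_locally_finite[OF \<tau>]])
  note setst = locally_finite_measuresD(1)[OF translate_locally_finite[OF \<tau>, of "(t, t)"]]
  have fm: "(\<lambda>w. f (u w) (v w) (t w)) \<in> borel_measurable M'"
    if [measurable]: "u \<in> borel_measurable M'" "v \<in> borel_measurable M'" "t \<in> borel_measurable M'"
    for u v t and M' :: "'m measure"
  proof -
    have "(\<lambda>w. (u w, v w, t w)) \<in> measurable M' (borel \<Otimes>\<^sub>M borel \<Otimes>\<^sub>M borel)" by measurable
    from measurable_compose[OF this f] show ?thesis by simp
  qed
  let ?h = "\<lambda>p q. if fst p = fst q then f (fst p) (snd p) (snd q) else 0"
  have hp: "?h p \<in> borel_measurable borel" for p
    unfolding borel_prod[symmetric] by (intro measurable_If fm) measurable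
  have h: "(\<lambda>(p, q). ?h p q) \<in> borel_measurable (borel \<Otimes>\<^sub>M translate (t, t) \<tau>)"
    unfolding measurable_cong_sets[OF sets_pair_measure_cong[OF refl setst] refl]
    unfolding case_prod_beta' borel_prod[symmetric]
    by (intro measurable_If fm) measurable
  have "diag_integral f (translate (t, t) \<tau>) = (\<integral>\<^sup>+p. (\<integral>\<^sup>+q. ?h (p - (t, t)) q \<partial>translate (t, t) \<tau>) \<partial>\<tau>)"
    unfolding diag_integral_def
    by (subst translate_def) (rule nn_integral_distr[OF tm], simp, rule borel_measurable_nn_integral[OF h])
  also have "\<dots> = (\<integral>\<^sup>+p. (\<integral>\<^sup>+q. ?h (p - (t, t)) (q - (t, t)) \<partial>\<tau>) \<partial>\<tau>)"
    unfolding translate_def by (intro nn_integral_cong nn_integral_distr[OF tm]) (simp only: measurable_distr_eq1 hp)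
  also have "\<dots> = diag_integral (\<lambda>x y z. f (x - t) (y - t) (z - t)) \<tau>"
    unfolding diag_integral_def by (intro nn_integral_cong) (auto simp: fst_diff snd_diff)
  finally show ?thesis .
qed

lemma nn_integral_indicator_cbox_minus:
  "(\<integral>\<^sup>+t. indicator (cbox 0 One) (x - t) \<partial>lborel) = (1 :: ennreal)" for x :: "'a::euclidean_space"
proof -
  have "(\<integral>\<^sup>+t. indicator (cbox 0 One) (x - t) \<partial>lborel) = (\<integral>\<^sup>+t. indicator (cbox (x - One) x) t \<partial>lborel)"
    by (intro nn_integral_cong) (auto simp: indicator_def mem_box inner_diff_left algebra_simps)
  also have "\<dots> = emeasure lborel (cbox (x - One) x)" by simp
  also have "\<dots> = 1" by (simp add: emeasure_lborel_cbox_eq inner_diff_left)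
  finally show ?thesis .
qed

text \<open>Insert \<open>1 = \<integral> 1{x - t \<in> [0,1]\<^sup>d} dt\<close> and shift by \<open>t\<close>.\<close>

lemma mass_transport:
  fixes T :: "'w \<Rightarrow> ('a::euclidean_space \<times> 'a) measure"
  assumes M: "prob_space M" and T: "T \<in> measurable M locally_finite_algebra"
    and stat: "stationary_transport M T"
    and g: "(\<lambda>(y, z). g y z) \<in> borel_measurable (borel \<Otimes>\<^sub>M borel)"
  shows "(\<integral>\<^sup>+\<omega>. diag_integral (\<lambda>x y z. g y z) (T \<omega>) \<partial>M) =
    (\<integral>\<^sup>+\<omega>. diag_integral (\<lambda>x y z. indicator (cbox 0 One) x * (\<integral>\<^sup>+t. g (y + t) (z + t) \<partial>lborel)) (T \<omega>) \<partial>M)"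
proof -
  interpret prob_space M by (rule M)
  interpret P: pair_sigma_finite M lborel by unfold_locales
  note Tlf = measurable_lf_kernelD[OF T]
  let ?i = "indicator (cbox (0::'a) One) :: 'a \<Rightarrow> ennreal"
  have gm[measurable]: "(\<lambda>w. g (u w) (v w)) \<in> borel_measurable M'"
    if [measurable]: "u \<in> borel_measurable M'" "v \<in> borel_measurable M'" for u v and M' :: "'m measure"
  proof -
    have "(\<lambda>w. (u w, v w)) \<in> measurable M' (borel \<Otimes>\<^sub>M borel)" by measurable
    from measurable_compose[OF this g] show ?thesis by simp
  qed
  let ?f = "\<lambda>t x y z. ?i (x - t) * g y z" and ?f' = "\<lambda>t x y z. ?i x * g (y + t) (z + t)"
  have f: "(\<lambda>(t, x, y, z). ?f t x y z) \<in> borel_measurable (borel \<Otimes>\<^sub>M borel \<Otimes>\<^sub>M borel \<Otimes>\<^sub>M borel)"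
    and f': "(\<lambda>(t, x, y, z). ?f' t x y z) \<in> borel_measurable (borel \<Otimes>\<^sub>M borel \<Otimes>\<^sub>M borel \<Otimes>\<^sub>M borel)"
    by measurable
  have swap: "(\<integral>\<^sup>+\<omega>. \<integral>\<^sup>+t. diag_integral (F t) (T \<omega>) \<partial>lborel \<partial>M) = (\<integral>\<^sup>+t. \<integral>\<^sup>+\<omega>. diag_integral (F t) (T \<omega>) \<partial>M \<partial>lborel)"
    if F: "(\<lambda>(t, x, y, z). F t x y z) \<in> borel_measurable (borel \<Otimes>\<^sub>M borel \<Otimes>\<^sub>M borel \<Otimes>\<^sub>M borel)" for F :: "'a \<Rightarrow> 'a \<Rightarrow> 'a \<Rightarrow> 'a \<Rightarrow> ennreal"
  proof (rule P.Fubini'[symmetric])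
    have "(\<lambda>w. (snd (fst w), snd w)) \<in> measurable ((M \<Otimes>\<^sub>M lborel) \<Otimes>\<^sub>M (borel \<Otimes>\<^sub>M borel \<Otimes>\<^sub>M borel))
      ((borel::'a measure) \<Otimes>\<^sub>M (borel::'a measure) \<Otimes>\<^sub>M (borel::'a measure) \<Otimes>\<^sub>M (borel::'a measure))"
      by measurable
    from measurable_compose[OF this F]
    have "(\<lambda>(w, x, y, z). F (snd w) x y z) \<in> borel_measurable ((M \<Otimes>\<^sub>M lborel) \<Otimes>\<^sub>M borel \<Otimes>\<^sub>M borel \<Otimes>\<^sub>M borel)"
      by (simp add: case_prod_beta')
    from measurable_diag_integral[OF measurable_compose[OF measurable_fst T] this]
    show "(\<lambda>(\<omega>, t). diag_integral (F t) (T \<omega>)) \<in> borel_measurable (M \<Otimes>\<^sub>M lborel)"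
      by (simp add: case_prod_beta')
  qed
  have lb: "borel_measurable (lborel \<Otimes>\<^sub>M borel \<Otimes>\<^sub>M borel \<Otimes>\<^sub>M borel) =
     (borel_measurable (borel \<Otimes>\<^sub>M borel \<Otimes>\<^sub>M borel \<Otimes>\<^sub>M borel) :: ('a \<times> 'a \<times> 'a \<times> 'a \<Rightarrow> ennreal) set)"
    by (intro measurable_cong_sets sets_pair_measure_cong refl) simp
  \<comment> \<open>\<open>?f t\<close> is what \<open>?f' t\<close> becomes on a measure shifted by
    \<open>(t, t)\<close>: the arguments \<open>y - t + t\<close> and \<open>z - t + t\<close>
    collapse, while the cube indicator is evaluated at \<open>x - t\<close>. Stationarity applies to
    one fixed \<open>t\<close>, which is why the expectation has to stand inside the integral over
    \<open>t\<close>.\<close>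
  have shift: "(\<integral>\<^sup>+\<omega>. diag_integral (?f t) (T \<omega>) \<partial>M) = (\<integral>\<^sup>+\<omega>. diag_integral (?f' t) (T \<omega>) \<partial>M)" for t
  proof -
    have f't: "(\<lambda>(x, y, z). ?f' t x y z) \<in> borel_measurable (borel \<Otimes>\<^sub>M borel \<Otimes>\<^sub>M borel)"
      by measurable
    have Dm: "diag_integral (?f' t) \<in> borel_measurable locally_finite_algebra"
      by (rule measurable_diag_integral[where k="\<lambda>x. x" and f="\<lambda>_. ?f' t"]) measurable
    have Tt: "(\<lambda>\<omega>. translate (t, t) (T \<omega>)) \<in> measurable M locally_finite_algebra"
      using measurable_compose[OF T measurable_translate] .
    have "(\<integral>\<^sup>+\<omega>. diag_integral (?f t) (T \<omega>) \<partial>M) = (\<integral>\<^sup>+\<omega>. diag_integral (?f' t) (translate (t, t) (T \<omega>)) \<partial>M)"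
      by (intro nn_integral_cong) (simp add: diag_integral_translate[OF Tlf f't])
    also have "\<dots> = (\<integral>\<^sup>+\<tau>. diag_integral (?f' t) \<tau> \<partial>distr M locally_finite_algebra (\<lambda>\<omega>. translate (t, t) (T \<omega>)))"
      using Tt Dm by (simp add: nn_integral_distr)
    also have "\<dots> = (\<integral>\<^sup>+\<tau>. diag_integral (?f' t) \<tau> \<partial>distr M locally_finite_algebra T)"
      using stat by (simp add: stationary_transport_def)
    also have "\<dots> = (\<integral>\<^sup>+\<omega>. diag_integral (?f' t) (T \<omega>) \<partial>M)"
      using T Dm by (simp add: nn_integral_distr)
    finally show ?thesis .
  qed
  have "(\<integral>\<^sup>+\<omega>. diag_integral (\<lambda>x y z. g y z) (T \<omega>) \<partial>M) =
    (\<integral>\<^sup>+\<omega>. diag_integral (\<lambda>x y z. \<integral>\<^sup>+t. ?f t x y z \<partial>lborel) (T \<omega>) \<partial>M)"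
    by (simp add: nn_integral_multc nn_integral_indicator_cbox_minus)
  also have "\<dots> = (\<integral>\<^sup>+\<omega>. \<integral>\<^sup>+t. diag_integral (?f t) (T \<omega>) \<partial>lborel \<partial>M)"
    by (intro nn_integral_cong diag_integral_nn_integral Tlf sigma_finite_lborel) (use f lb in simp_all)
  also have "\<dots> = (\<integral>\<^sup>+\<omega>. \<integral>\<^sup>+t. diag_integral (?f' t) (T \<omega>) \<partial>lborel \<partial>M)"
    unfolding swap[OF f] swap[OF f'] shift ..
  also have "\<dots> = (\<integral>\<^sup>+\<omega>. diag_integral (\<lambda>x y z. \<integral>\<^sup>+t. ?f' t x y z \<partial>lborel) (T \<omega>) \<partial>M)"
    by (intro nn_integral_cong diag_integral_nn_integral[symmetric] Tlf sigma_finite_lborel) (use f' lb in simp_all)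
  also have "\<dots> = (\<integral>\<^sup>+\<omega>. diag_integral (\<lambda>x y z. ?i x * (\<integral>\<^sup>+t. g (y + t) (z + t) \<partial>lborel)) (T \<omega>) \<partial>M)"
    by (simp add: nn_integral_cmult)
  finally show ?thesis .
qed

section \<open>Boundary layers of convex sets\<close>


lemma scaleR_image_borel:
  fixes W :: "'a::euclidean_space set"
  assumes "W \<in> sets borel"
  shows "(*\<^sub>R) r ` W \<in> sets borel"
proof (cases "r = 0")
  case True
  then have "(*\<^sub>R) r ` W \<subseteq> {0}" by auto
  then have "(*\<^sub>R) r ` W = {} \<or> (*\<^sub>R) r ` W = {0}" by (rule subset_singletonD)
  then show ?thesis by (metis borel_singleton sets.empty_sets)
next
  case False
  have "(*\<^sub>R) r ` W = (*\<^sub>R) (1 / r) -` W"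
  proof (intro equalityI subsetI)
    fix x assume "x \<in> (*\<^sub>R) (1 / r) -` W"
    then show "x \<in> (*\<^sub>R) r ` W" using False by (intro image_eqI[of _ _ "(1 / r) *\<^sub>R x"]) simp_all
  next
    fix x assume "x \<in> (*\<^sub>R) r ` W"
    then show "x \<in> (*\<^sub>R) (1 / r) -` W" using False by auto
  qed
  also have "\<dots> \<in> sets borel"
    using measurable_sets[of "(*\<^sub>R) (1 / r)" borel borel W] assms by simp
  finally show ?thesis .
qed

lemma measure_scaleR_image:
  fixes W :: "'a::euclidean_space set"
  assumes "W \<in> sets borel" "0 \<le> r"
  shows "emeasure lborel ((*\<^sub>R) r ` W) = ennreal (r ^ DIM('a)) * emeasure lborel W"
  using emeasure_lebesgue_affine[of r 0 W] scaleR_image_borel[OF assms(1), of r] assms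
  by (simp add: abs_of_nonneg)

text \<open>With \<open>c = |v| / \<epsilon>\<close> one has \<open>v \<in> cW\<close>, and \<open>(r - c)W + cW \<subseteq> rW\<close> by convexity.\<close>

lemma convex_scaleR_add:
  fixes W :: "'a::real_normed_vector set"
  assumes W: "convex W" and \<epsilon>: "cball 0 \<epsilon> \<subseteq> W" "0 < \<epsilon>"
    and r: "norm v / \<epsilon> < r" and s: "s \<in> (*\<^sub>R) (r - norm v / \<epsilon>) ` W"
  shows "s + v \<in> (*\<^sub>R) r ` W"
proof -
  define c where "c = norm v / \<epsilon>"
  have c: "0 \<le> c" "c < r" using \<epsilon> r by (auto simp: c_def)
  obtain w where w: "w \<in> W" "s = (r - c) *\<^sub>R w" using s by (auto simp: c_def)
  obtain w' where w': "w' \<in> W" "v = c *\<^sub>R w'"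
  proof (cases "v = 0")
    case True
    moreover have "0 \<in> W" using \<epsilon> by (auto simp: subset_eq)
    ultimately show ?thesis using that[of 0] by simp
  next
    case False
    then have "c > 0" using \<epsilon> by (simp add: c_def)
    moreover have "norm (v /\<^sub>R c) = \<epsilon>" using False \<epsilon> by (simp add: c_def field_simps)
    ultimately show ?thesis using that[of "v /\<^sub>R c"] \<epsilon> by (auto simp: subset_eq)
  qed
  have "((r - c) / r) *\<^sub>R w + (c / r) *\<^sub>R w' \<in> W"
    using W w w' c by (intro convexD) (auto simp: field_simps)
  moreover have "s + v = r *\<^sub>R (((r - c) / r) *\<^sub>R w + (c / r) *\<^sub>R w')"
    using w w' c by (simp add: scaleR_add_right)
  ultimately show ?thesis by blast
qed

lemma nn_integral_lborel_translate:
  fixes f :: "'a::euclidean_space \<Rightarrow> ennreal"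
  assumes f: "f \<in> borel_measurable borel"
  shows "(\<integral>\<^sup>+t. f (y + t) \<partial>lborel) = (\<integral>\<^sup>+t. f t \<partial>lborel)"
proof -
  have "(\<integral>\<^sup>+t. f t \<partial>lborel) = (\<integral>\<^sup>+t. f t \<partial>distr lborel borel ((+) y))"
    by (simp add: lborel_distr_plus)
  also have "\<dots> = (\<integral>\<^sup>+t. f (y + t) \<partial>lborel)" using f by (intro nn_integral_distr) auto
  finally show ?thesis ..
qed

text \<open>Put c = |z - y| / \<epsilon>. If y + t lies in (r - c)W, then adding z - y leads to a
  point of rW, so the integrand vanishes unless y + t lies in rW but not in (r - c)W. The volume of
  this shell is r^d - (r - c)^d times that of W; it is stated relative to the volume of rW because
  the ratio is what tends to 0.\<close>

lemma boundary_layer_le: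
  fixes W :: "'a::euclidean_space set"
  assumes W: "convex W" "W \<in> sets borel" and \<epsilon>: "cball 0 \<epsilon> \<subseteq> W" "0 < \<epsilon>"
    and fin: "emeasure lborel W < \<infinity>" and r: "norm (z - y) / \<epsilon> < r"
  shows "(\<integral>\<^sup>+t. indicator ((*\<^sub>R) r ` W) (y + t) * indicator (- ((*\<^sub>R) r ` W)) (z + t) \<partial>lborel)
    \<le> ennreal (1 - (1 - norm (z - y) / \<epsilon> / r) ^ DIM('a)) * emeasure lborel ((*\<^sub>R) r ` W)"
proof -
  define c where "c = norm (z - y) / \<epsilon>"
  have c: "0 \<le> c" "c < r" using \<epsilon> r by (auto simp: c_def)
  let ?r = "(*\<^sub>R) r ` W" and ?s = "(*\<^sub>R) (r - c) ` W"
  have b[measurable]: "?r \<in> sets borel" "?s \<in> sets borel" using W(2) by (intro scaleR_image_borel; simp)+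
  have "0 \<in> W" using \<epsilon> by auto
  have sub: "?s \<subseteq> ?r"
  proof
    fix s assume "s \<in> ?s"
    then obtain w where w: "w \<in> W" "s = (r - c) *\<^sub>R w" by auto
    have "((r - c) / r) *\<^sub>R w + (c / r) *\<^sub>R 0 \<in> W"
      using W(1) w \<open>0 \<in> W\<close> c by (intro convexD) (auto simp: field_simps)
    then show "s \<in> ?r" using w c by (auto intro!: image_eqI[where x="((r - c) / r) *\<^sub>R w"])
  qed
  have "(\<integral>\<^sup>+t. indicator ?r (y + t) * indicator (- ?r) (z + t) \<partial>lborel) \<le>
    (\<integral>\<^sup>+t. indicator (?r - ?s) (y + t) \<partial>lborel)"
  proof (intro nn_integral_mono)
    fix t :: 'a
    have "z + t \<in> ?r" if "y + t \<in> ?s"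
      using convex_scaleR_add[OF W(1) \<epsilon> r, of "y + t"] that by (simp add: c_def algebra_simps)
    then show "indicator ?r (y + t) * indicator (- ?r) (z + t) \<le> (indicator (?r - ?s) (y + t) :: ennreal)"
      by (auto simp: indicator_def)
  qed
  also have "\<dots> = emeasure lborel (?r - ?s)"
    using nn_integral_lborel_translate[of "indicator (?r - ?s)" y] by simp
  also have "\<dots> = emeasure lborel ?r - emeasure lborel ?s"
    using sub fin c W(2) by (intro emeasure_Diff) (auto simp: measure_scaleR_image ennreal_mult_less_top less_top)
  also have "\<dots> = ennreal (1 - (1 - c / r) ^ DIM('a)) * emeasure lborel ?r"
  proof -
    obtain w where w: "emeasure lborel W = ennreal w" "0 \<le> w" using fin by (cases "emeasure lborel W") auto
    have "(r - c) ^ DIM('a) = (1 - c / r) ^ DIM('a) * r ^ DIM('a)"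
      using c by (simp add: power_mult_distrib[symmetric] field_simps)
    moreover have "(1 - c / r) ^ DIM('a) \<le> 1" using c by (intro power_le_one) auto
    ultimately have "r ^ DIM('a) * w - (r - c) ^ DIM('a) * w = (1 - (1 - c / r) ^ DIM('a)) * (r ^ DIM('a) * w)"
      "0 \<le> 1 - (1 - c / r) ^ DIM('a)" by (simp_all add: algebra_simps)
    moreover have "emeasure lborel ?r = ennreal (r ^ DIM('a) * w)"
      using c w measure_scaleR_image[OF W(2), of r] by (simp add: ennreal_mult)
    moreover have "emeasure lborel ?s = ennreal ((r - c) ^ DIM('a) * w)"
      using c w measure_scaleR_image[OF W(2), of "r - c"] by (simp add: ennreal_mult)
    ultimately show ?thesis
      using c w by (simp add: ennreal_mult[symmetric] ennreal_minus)
  qed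
  finally show ?thesis by (simp add: c_def)
qed

text \<open>Dominated convergence for the inner and for the outer integral. Finiteness of
  \<open>diag_integral g\<close> bounds the inner integral of \<open>g\<close> only for almost every
  \<open>p\<close>, so the inner limit is an almost everywhere statement as well.\<close>

lemma diag_integral_tendsto_0:
  fixes \<tau> :: "('a::euclidean_space \<times> 'a) measure"
  assumes \<tau>: "\<tau> \<in> locally_finite_measures"
    and f: "\<And>n. (\<lambda>(x, y, z). f n x y z) \<in> borel_measurable (borel \<Otimes>\<^sub>M borel \<Otimes>\<^sub>M borel)"
    and g: "(\<lambda>(x, y, z). g x y z) \<in> borel_measurable (borel \<Otimes>\<^sub>M borel \<Otimes>\<^sub>M borel)"
    and le: "\<And>n x y z. f n x y z \<le> g x y z" and fin: "diag_integral g \<tau> < \<infinity>"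
    and lim: "\<And>x y z. (\<lambda>n. f n x y z) \<longlonglongrightarrow> 0"
  shows "(\<lambda>n. diag_integral (f n) \<tau>) \<longlonglongrightarrow> 0"
proof -
  interpret \<tau>: sigma_finite_measure \<tau> by (rule sigma_finite_locally_finite[OF \<tau>])
  note sets\<tau> = locally_finite_measuresD(1)[OF \<tau>]
  let ?h = "\<lambda>f p q. if fst p = fst q then f (fst p) (snd p) (snd q) else (0::ennreal)"
  have h: "(\<lambda>(p, q). ?h f p q) \<in> borel_measurable (\<tau> \<Otimes>\<^sub>M \<tau>)"
    if f: "(\<lambda>(x, y, z). f x y z) \<in> borel_measurable (borel \<Otimes>\<^sub>M borel \<Otimes>\<^sub>M borel)" for f :: "'a \<Rightarrow> 'a \<Rightarrow> 'a \<Rightarrow> ennreal"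
  proof -
    have "(\<lambda>w. (fst (fst w), snd (fst w), snd (snd w))) \<in> measurable (((borel::'a measure) \<Otimes>\<^sub>M borel) \<Otimes>\<^sub>M (borel \<Otimes>\<^sub>M borel)) (borel \<Otimes>\<^sub>M (borel::'a measure) \<Otimes>\<^sub>M (borel::'a measure))"
      by measurable
    from measurable_compose[OF this f]
    have [measurable]: "(\<lambda>w. f (fst (fst w)) (snd (fst w)) (snd (snd w))) \<in> borel_measurable (((borel::'a measure) \<Otimes>\<^sub>M borel) \<Otimes>\<^sub>M (borel \<Otimes>\<^sub>M borel))"
      by simp
    show ?thesis
      unfolding measurable_cong_sets[OF sets_pair_measure_cong[OF sets\<tau> sets\<tau>] refl]
      unfolding case_prod_beta' borel_prod[symmetric] by measurable
  qed
  have hp: "?h f p \<in> borel_measurable \<tau>" if "p \<in> space \<tau>"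
    "(\<lambda>(x, y, z). f x y z) \<in> borel_measurable (borel \<Otimes>\<^sub>M borel \<Otimes>\<^sub>M borel)" for p and f :: "'a \<Rightarrow> 'a \<Rightarrow> 'a \<Rightarrow> ennreal"
    using measurable_compose[OF measurable_Pair1'[OF that(1)] h[OF that(2)]] by simp
  have hi: "(\<lambda>p. \<integral>\<^sup>+q. ?h f p q \<partial>\<tau>) \<in> borel_measurable \<tau>"
    if "(\<lambda>(x, y, z). f x y z) \<in> borel_measurable (borel \<Otimes>\<^sub>M borel \<Otimes>\<^sub>M borel)" for f :: "'a \<Rightarrow> 'a \<Rightarrow> 'a \<Rightarrow> ennreal"
    by (rule \<tau>.borel_measurable_nn_integral[OF h[OF that]])
  have AE: "AE p in \<tau>. (\<integral>\<^sup>+q. ?h g p q \<partial>\<tau>) \<noteq> \<infinity>"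
    using fin hi[OF g] by (intro nn_integral_PInf_AE) (auto simp: diag_integral_def)
  have inner: "(\<lambda>n. \<integral>\<^sup>+q. ?h (f n) p q \<partial>\<tau>) \<longlonglongrightarrow> 0"
    if p: "p \<in> space \<tau>" and fp: "(\<integral>\<^sup>+q. ?h g p q \<partial>\<tau>) \<noteq> \<infinity>" for p
  proof -
    have "(\<lambda>n. \<integral>\<^sup>+q. ?h (f n) p q \<partial>\<tau>) \<longlonglongrightarrow> (\<integral>\<^sup>+q. 0 \<partial>\<tau>)"
    proof (rule nn_integral_dominated_convergence[OF hp[OF p f] _ hp[OF p g]])
      show "AE q in \<tau>. ?h (f n) p q \<le> ?h g p q" for n using le by (intro AE_I2) simp
      show "(\<integral>\<^sup>+q. ?h g p q \<partial>\<tau>) < \<infinity>" using fp by (simp add: less_top)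
      show "AE q in \<tau>. (\<lambda>n. ?h (f n) p q) \<longlonglongrightarrow> 0"
      proof (rule AE_I2)
        fix q show "(\<lambda>n. ?h (f n) p q) \<longlonglongrightarrow> 0" using lim by (cases "fst p = fst q") simp_all
      qed
    qed simp
    then show ?thesis by simp
  qed
  have "(\<lambda>n. \<integral>\<^sup>+p. \<integral>\<^sup>+q. ?h (f n) p q \<partial>\<tau> \<partial>\<tau>) \<longlonglongrightarrow> (\<integral>\<^sup>+p. 0 \<partial>\<tau>)"
  proof (rule nn_integral_dominated_convergence[OF hi[OF f] _ hi[OF g]])
    show "AE p in \<tau>. (\<integral>\<^sup>+q. ?h (f n) p q \<partial>\<tau>) \<le> (\<integral>\<^sup>+q. ?h g p q \<partial>\<tau>)" for n
      using le by (intro AE_I2 nn_integral_mono) simp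
    show "(\<integral>\<^sup>+p. \<integral>\<^sup>+q. ?h g p q \<partial>\<tau> \<partial>\<tau>) < \<infinity>" using fin by (simp add: diag_integral_def)
    show "AE p in \<tau>. (\<lambda>n. \<integral>\<^sup>+q. ?h (f n) p q \<partial>\<tau>) \<longlonglongrightarrow> 0"
      by (rule AE_mp[OF AE]) (use inner in auto)
  qed simp
  then show ?thesis by (simp add: diag_integral_def)
qed


lemma diag_integral_mono:
  "(\<And>x y z. f x y z \<le> g x y z) \<Longrightarrow> diag_integral f \<tau> \<le> diag_integral g \<tau>"
  unfolding diag_integral_def by (intro nn_integral_mono) simp

lemma diag_integral_multc:
  fixes \<tau> :: "('a::euclidean_space \<times> 'a) measure"
  assumes \<tau>: "\<tau> \<in> locally_finite_measures"
    and f: "(\<lambda>(x, y, z). f x y z) \<in> borel_measurable (borel \<Otimes>\<^sub>M borel \<Otimes>\<^sub>M borel)"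
  shows "diag_integral (\<lambda>x y z. f x y z * c) \<tau> = diag_integral f \<tau> * c"
proof -
  interpret \<tau>: sigma_finite_measure \<tau> by (rule sigma_finite_locally_finite[OF \<tau>])
  note sets\<tau> = locally_finite_measuresD(1)[OF \<tau>]
  let ?h = "\<lambda>p q. if fst p = fst q then f (fst p) (snd p) (snd q) else (0::ennreal)"
  have "(\<lambda>w. (fst (fst w), snd (fst w), snd (snd w))) \<in> measurable (((borel::'a measure) \<Otimes>\<^sub>M borel) \<Otimes>\<^sub>M (borel \<Otimes>\<^sub>M borel)) (borel \<Otimes>\<^sub>M (borel::'a measure) \<Otimes>\<^sub>M (borel::'a measure))"
    by measurable
  from measurable_compose[OF this f]
  have [measurable]: "(\<lambda>w. f (fst (fst w)) (snd (fst w)) (snd (snd w))) \<in> borel_measurable (((borel::'a measure) \<Otimes>\<^sub>M borel) \<Otimes>\<^sub>M (borel \<Otimes>\<^sub>M borel))"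
    by simp
  have h: "(\<lambda>(p, q). ?h p q) \<in> borel_measurable (\<tau> \<Otimes>\<^sub>M \<tau>)"
    unfolding measurable_cong_sets[OF sets_pair_measure_cong[OF sets\<tau> sets\<tau>] refl]
    unfolding case_prod_beta' borel_prod[symmetric] by measurable
  have hp: "?h p \<in> borel_measurable \<tau>" if "p \<in> space \<tau>" for p
    using measurable_compose[OF measurable_Pair1'[OF that] h] by simp
  have "diag_integral (\<lambda>x y z. f x y z * c) \<tau> = (\<integral>\<^sup>+p. \<integral>\<^sup>+q. ?h p q * c \<partial>\<tau> \<partial>\<tau>)"
    unfolding diag_integral_def by (intro nn_integral_cong) simp
  also have "\<dots> = (\<integral>\<^sup>+p. (\<integral>\<^sup>+q. ?h p q \<partial>\<tau>) * c \<partial>\<tau>)"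
    by (intro nn_integral_cong nn_integral_multc hp)
  also have "\<dots> = diag_integral f \<tau> * c"
    unfolding diag_integral_def by (intro nn_integral_multc \<tau>.borel_measurable_nn_integral[OF h])
  finally show ?thesis .
qed

text \<open>\<open>palm\<close> expresses the Palm hypothesis through \<open>T\<close>: with the
  second coordinates integrated out, what remains is the mean sum of the squared atoms of the source
  in the unit cube. Neither a kernel nor an enumeration enters.\<close>

locale palm_square_integrable_transport = prob_space M
  for M :: "'w measure" and T :: "'w \<Rightarrow> ('a::euclidean_space \<times> 'a) measure" +
  assumes T: "T \<in> measurable M locally_finite_algebra"
    and stationary: "stationary_transport M T"
    and palm: "(\<integral>\<^sup>+\<omega>. diag_integral (\<lambda>x y z. indicator (cbox 0 One) x) (T \<omega>) \<partial>M) < \<infinity>"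
begin

text \<open>Mass transport for the indicator of \<open>B\<close> at \<open>y\<close>: its integral
  over all shifts is the volume of \<open>B\<close> whatever \<open>y\<close> is, so the expectation
  is this volume times the quantity in \<open>palm\<close>.\<close>

lemma diag_mass_finite:
  assumes B: "B \<in> sets borel" "bounded B"
  shows "(\<integral>\<^sup>+\<omega>. diag_integral (\<lambda>x y z. indicator B y) (T \<omega>) \<partial>M) < \<infinity>"
proof -
  let ?i = "\<lambda>x y z. indicator (cbox (0::'a) One) x :: ennreal"
  have i: "(\<lambda>(x, y, z). ?i x y z) \<in> borel_measurable (borel \<Otimes>\<^sub>M (borel::'a measure) \<Otimes>\<^sub>M (borel::'a measure))"
    by measurable
  have g: "(\<lambda>(y, z). indicator B y) \<in> borel_measurable (borel \<Otimes>\<^sub>M (borel :: 'a measure))"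
    using B(1) by measurable
  have Di: "(\<lambda>\<omega>. diag_integral ?i (T \<omega>)) \<in> borel_measurable M"
    by (rule measurable_diag_integral[OF T]) measurable
  have tr: "(\<integral>\<^sup>+t. indicator B (y + t) \<partial>lborel) = emeasure lborel B" for y
    using nn_integral_lborel_translate[of "indicator B" y] B by simp
  have "(\<integral>\<^sup>+\<omega>. diag_integral (\<lambda>x y z. indicator B y) (T \<omega>) \<partial>M) =
    (\<integral>\<^sup>+\<omega>. diag_integral (\<lambda>x y z. ?i x y z * emeasure lborel B) (T \<omega>) \<partial>M)"
    using mass_transport[OF prob_space_axioms T stationary g] by (simp add: tr)
  also have "\<dots> = (\<integral>\<^sup>+\<omega>. diag_integral ?i (T \<omega>) * emeasure lborel B \<partial>M)"
    by (intro nn_integral_cong diag_integral_multc[OF measurable_lf_kernelD[OF T] i])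
  also have "\<dots> = (\<integral>\<^sup>+\<omega>. diag_integral ?i (T \<omega>) \<partial>M) * emeasure lborel B"
    by (rule nn_integral_multc[OF Di])
  also have "\<dots> < \<infinity>"
    using palm emeasure_bounded_finite[OF B(2)] by (simp add: ennreal_mult_less_top)
  finally show ?thesis .
qed

text \<open>Mass transport turns the quotient into the mean diagonal integral of
  \<open>\<rho>\<close>, which measures the shifts separating \<open>y\<close> from \<open>z\<close>
  relative to the volume of rW, for sources in the unit cube. \<open>\<rho>\<close> is at most the
  cube indicator, integrable by \<open>palm\<close>, and tends to 0 for fixed \<open>y\<close> and
  \<open>z\<close> by \<open>boundary_layer_le\<close>. Dominated convergence thus needs no uniform
  control of |z - y|.\<close>

lemma diag_boundary_tendsto_0:
  assumes W: "convex W" "W \<in> sets borel" "bounded W" "0 \<in> interior W"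
  shows "((\<lambda>r. (\<integral>\<^sup>+\<omega>. diag_integral (\<lambda>x y z. indicator ((*\<^sub>R) r ` W) y * indicator (- ((*\<^sub>R) r ` W)) z) (T \<omega>) \<partial>M)
     / emeasure lborel ((*\<^sub>R) r ` W)) \<longlongrightarrow> 0) at_top"
proof (rule tendsto_at_topI_sequentially)
  \<comment> \<open>Dominated convergence speaks of sequences, so \<open>r\<close> is an arbitrary
    sequence tending to infinity.\<close>
  fix r :: "nat \<Rightarrow> real" assume r: "filterlim r at_top sequentially"
  obtain \<epsilon> where \<epsilon>: "0 < \<epsilon>" "cball 0 \<epsilon> \<subseteq> W"
    using W(4) unfolding mem_interior_cball by auto
  have fin: "emeasure lborel W < \<infinity>" using emeasure_bounded_finite[OF W(3)] by simp
  let ?W = "\<lambda>n. (*\<^sub>R) (r n) ` W"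
  have Wb[measurable]: "?W n \<in> sets borel" for n by (rule scaleR_image_borel[OF W(2)])
  define \<phi> where "\<phi> n y z = (\<integral>\<^sup>+t. indicator (?W n) (y + t) * indicator (- ?W n) (z + t) \<partial>lborel)" for n and y z :: 'a
  define \<rho> where "\<rho> n x y z = indicator (cbox 0 One) x * (\<phi> n y z / emeasure lborel (?W n))" for n and x y z :: 'a
  let ?i = "\<lambda>x y z. indicator (cbox (0::'a) One) x :: ennreal"
  have i: "(\<lambda>(x, y, z). ?i x y z) \<in> borel_measurable (borel \<Otimes>\<^sub>M (borel::'a measure) \<Otimes>\<^sub>M (borel::'a measure))"
    by measurable
  have \<phi>m[measurable]: "(\<lambda>w. \<phi> n (u w) (v w)) \<in> borel_measurable N"
    if [measurable]: "u \<in> borel_measurable N" "v \<in> borel_measurable N" for n u v and N :: "'n measure"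
    unfolding \<phi>_def by measurable
  have \<rho>m: "(\<lambda>(x, y, z). \<rho> n x y z) \<in> borel_measurable (borel \<Otimes>\<^sub>M borel \<Otimes>\<^sub>M borel)" for n
    unfolding \<rho>_def by measurable
  have \<phi>W: "\<phi> n y z \<le> emeasure lborel (?W n)" for n y z
  proof -
    have "\<phi> n y z \<le> (\<integral>\<^sup>+t. indicator (?W n) (y + t) \<partial>lborel)"
      unfolding \<phi>_def by (intro nn_integral_mono) (auto simp: indicator_def)
    also have "\<dots> = emeasure lborel (?W n)"
      using nn_integral_lborel_translate[of "indicator (?W n)" y] by simp
    finally show ?thesis .
  qed
  \<comment> \<open>Covers degenerate scalings: the sequence \<open>r\<close> may contain values
    that make the volume 0, and \<open>0 / 0\<close> is 0 in \<open>ennreal\<close>.\<close>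
  have self: "e / e \<le> 1" for e :: ennreal
  proof (cases "e = 0 \<or> e = \<top>")
    case False
    then show ?thesis using ennreal_divide_self[of e] by (simp add: less_top)
  qed auto
  have \<phi>1: "\<phi> n y z / emeasure lborel (?W n) \<le> 1" for n y z
  proof -
    have "\<phi> n y z / emeasure lborel (?W n) \<le> emeasure lborel (?W n) / emeasure lborel (?W n)"
      by (rule divide_right_mono_ennreal[OF \<phi>W])
    also have "\<dots> \<le> 1" by (rule self)
    finally show ?thesis .
  qed
  have le: "\<rho> n x y z \<le> ?i x y z" for n x y z
    unfolding \<rho>_def using mult_left_mono[OF \<phi>1[of n y z], of "?i x y z"] by simp
  have lim: "(\<lambda>n. \<rho> n x y z) \<longlonglongrightarrow> 0" for x y z
  proof (rule tendsto_sandwich[OF _ _ tendsto_const])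
    let ?c = "norm (z - y) / \<epsilon>"
    show "\<forall>\<^sub>F n in sequentially. 0 \<le> \<rho> n x y z" by simp
    have "\<forall>\<^sub>F n in sequentially. max ?c 0 < r n"
      using r unfolding filterlim_at_top_dense by (rule spec)
    then show "\<forall>\<^sub>F n in sequentially. \<rho> n x y z \<le> ennreal (1 - (1 - ?c / r n) ^ DIM('a))"
    proof eventually_elim
      case (elim n)
      then have c: "?c < r n" "0 < r n" by auto
      have "\<phi> n y z / emeasure lborel (?W n) \<le> (ennreal (1 - (1 - ?c / r n) ^ DIM('a)) * emeasure lborel (?W n)) / emeasure lborel (?W n)"
        unfolding \<phi>_def by (intro divide_right_mono_ennreal boundary_layer_le W \<epsilon> fin c)
      also have "\<dots> \<le> ennreal (1 - (1 - ?c / r n) ^ DIM('a)) * 1"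
        unfolding ennreal_times_divide[symmetric]
        by (intro mult_left_mono self) simp
      finally have "\<phi> n y z / emeasure lborel (?W n) \<le> ennreal (1 - (1 - ?c / r n) ^ DIM('a))" by simp
      moreover have "\<rho> n x y z \<le> \<phi> n y z / emeasure lborel (?W n)"
        by (auto simp: \<rho>_def indicator_def)
      ultimately show ?case by (rule order_trans[rotated])
    qed
    have "(\<lambda>n. ?c / r n) \<longlonglongrightarrow> 0"
      by (intro real_tendsto_divide_at_top[OF tendsto_const r])
    then have "(\<lambda>n. 1 - (1 - ?c / r n) ^ DIM('a)) \<longlonglongrightarrow> 1 - (1 - 0) ^ DIM('a)"
      by (intro tendsto_intros)
    then show "(\<lambda>n. ennreal (1 - (1 - ?c / r n) ^ DIM('a))) \<longlonglongrightarrow> 0"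
      using tendsto_ennrealI by fastforce
  qed
  have D\<rho>: "(\<lambda>\<omega>. diag_integral (\<rho> n) (T \<omega>)) \<in> borel_measurable M" for n
    by (rule measurable_diag_integral[OF T]) (use \<rho>m[of n] in measurable)
  have Di: "(\<lambda>\<omega>. diag_integral ?i (T \<omega>)) \<in> borel_measurable M"
    by (rule measurable_diag_integral[OF T]) measurable
  have AE: "AE \<omega> in M. diag_integral ?i (T \<omega>) \<noteq> \<infinity>"
    using palm Di by (intro nn_integral_PInf_AE) auto
  have "(\<lambda>n. \<integral>\<^sup>+\<omega>. diag_integral (\<rho> n) (T \<omega>) \<partial>M) \<longlonglongrightarrow> (\<integral>\<^sup>+\<omega>. 0 \<partial>M)"
  proof (rule nn_integral_dominated_convergence[OF D\<rho> _ Di])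
    show "AE \<omega> in M. diag_integral (\<rho> n) (T \<omega>) \<le> diag_integral ?i (T \<omega>)" for n
      by (intro AE_I2 diag_integral_mono le)
    show "AE \<omega> in M. (\<lambda>n. diag_integral (\<rho> n) (T \<omega>)) \<longlonglongrightarrow> 0"
    proof (rule AE_mp[OF AE], rule AE_I2, rule impI)
      fix \<omega> assume "\<omega> \<in> space M" "diag_integral ?i (T \<omega>) \<noteq> \<infinity>"
      then show "(\<lambda>n. diag_integral (\<rho> n) (T \<omega>)) \<longlonglongrightarrow> 0"
        by (intro diag_integral_tendsto_0[OF measurable_lf_kernelD[OF T] \<rho>m i le _ lim])
          (simp_all add: less_top)
    qed
  qed (use palm in simp_all)
  moreover have "(\<integral>\<^sup>+\<omega>. diag_integral (\<rho> n) (T \<omega>) \<partial>M) =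
    (\<integral>\<^sup>+\<omega>. diag_integral (\<lambda>x y z. indicator (?W n) y * indicator (- ?W n) z) (T \<omega>) \<partial>M)
     / emeasure lborel (?W n)" for n
  proof -
    have g: "(\<lambda>(y, z). indicator (?W n) y * indicator (- ?W n) z :: ennreal) \<in> borel_measurable (borel \<Otimes>\<^sub>M (borel :: 'a measure))"
      by measurable
    have \<phi>': "(\<lambda>(x, y, z). ?i x y z * \<phi> n y z) \<in> borel_measurable (borel \<Otimes>\<^sub>M borel \<Otimes>\<^sub>M borel)"
      by measurable
    have D\<phi>: "(\<lambda>\<omega>. diag_integral (\<lambda>x y z. ?i x y z * \<phi> n y z) (T \<omega>)) \<in> borel_measurable M"
      by (rule measurable_diag_integral[OF T]) measurable
    have \<rho>eq: "\<rho> n = (\<lambda>x y z. ?i x y z * \<phi> n y z * inverse (emeasure lborel (?W n)))"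
      by (simp add: fun_eq_iff \<rho>_def divide_ennreal_def mult.assoc)
    have "(\<integral>\<^sup>+\<omega>. diag_integral (\<rho> n) (T \<omega>) \<partial>M) =
      (\<integral>\<^sup>+\<omega>. diag_integral (\<lambda>x y z. ?i x y z * \<phi> n y z) (T \<omega>) * inverse (emeasure lborel (?W n)) \<partial>M)"
      unfolding \<rho>eq by (intro nn_integral_cong diag_integral_multc[OF measurable_lf_kernelD[OF T] \<phi>'])
    also have "\<dots> = (\<integral>\<^sup>+\<omega>. diag_integral (\<lambda>x y z. ?i x y z * \<phi> n y z) (T \<omega>) \<partial>M) * inverse (emeasure lborel (?W n))"
      by (rule nn_integral_multc[OF D\<phi>])
    finally show ?thesis
      using mass_transport[OF prob_space_axioms T stationary g] by (simp add: \<phi>_def divide_ennreal_def)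
  qed
  ultimately show "(\<lambda>n. (\<integral>\<^sup>+\<omega>. diag_integral (\<lambda>x y z. indicator (?W n) y * indicator (- ?W n) z) (T \<omega>) \<partial>M)
     / emeasure lborel (?W n)) \<longlonglongrightarrow> 0" by simp
qed

end

section \<open>Randomized transports\<close>


text \<open>The singleton is the section at \<open>x\<close> of the diagonal, which is a measurable
  set of the product space.\<close>

lemma measurable_emeasure_singleton:
  fixes \<mu> :: "'a::euclidean_space measure"
  assumes \<mu>: "\<mu> \<in> locally_finite_measures"
  shows "(\<lambda>x. emeasure \<mu> {x}) \<in> borel_measurable borel"
proof -
  interpret sigma_finite_measure \<mu> by (rule sigma_finite_locally_finite[OF \<mu>])
  note D = locally_finite_measuresD[OF \<mu>]
  have "{w \<in> space (borel \<Otimes>\<^sub>M (borel :: 'a measure)). fst w = snd w} \<in> sets (borel \<Otimes>\<^sub>M borel)"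
    by measurable
  then have "{w. fst w = snd w} \<in> sets (borel \<Otimes>\<^sub>M \<mu>)"
    using sets_pair_measure_cong[OF refl[of "sets (borel :: 'a measure)"] D(1)] by (simp add: space_pair_measure)
  from measurable_emeasure_Pair[OF this]
  have "(\<lambda>x. emeasure \<mu> (Pair x -` {w. fst w = snd w})) \<in> borel_measurable borel" .
  moreover have "Pair x -` {w. fst w = snd w} = {x}" for x :: 'a by auto
  ultimately show ?thesis by simp
qed

lemma random_kernelD:
  assumes "random_kernel M J"
  shows "\<omega> \<in> space M \<Longrightarrow> J \<omega> \<in> measurable borel (prob_algebra borel)"
    and "X \<in> borel_measurable M \<Longrightarrow> (\<lambda>\<omega>. J \<omega> (X \<omega>)) \<in> measurable M (prob_algebra borel)"
    and "\<omega> \<in> space M \<Longrightarrow> J \<omega> x \<in> space (prob_algebra borel)"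
    and "\<omega> \<in> space M \<Longrightarrow> sets (J \<omega> x) = sets borel"
    and "\<omega> \<in> space M \<Longrightarrow> prob_space (J \<omega> x)"
proof -
  have J: "(\<lambda>(\<omega>, x). J \<omega> x) \<in> measurable (M \<Otimes>\<^sub>M borel) (prob_algebra borel)"
    using assms by (simp add: random_kernel_def)
  show 1: "J \<omega> \<in> measurable borel (prob_algebra borel)" if "\<omega> \<in> space M" for \<omega>
    using measurable_compose[OF measurable_Pair1'[OF that] J] by simp
  show "(\<lambda>\<omega>. J \<omega> (X \<omega>)) \<in> measurable M (prob_algebra borel)" if [measurable]: "X \<in> borel_measurable M"
  proof -
    have "(\<lambda>\<omega>. (\<omega>, X \<omega>)) \<in> measurable M (M \<Otimes>\<^sub>M borel)" by measurable
    from measurable_compose[OF this J] show ?thesis by simp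
  qed
  show 3: "J \<omega> x \<in> space (prob_algebra borel)" if "\<omega> \<in> space M" for \<omega> x
    using measurable_space[OF 1[OF that], of x] by simp
  show "sets (J \<omega> x) = sets borel" "prob_space (J \<omega> x)" if "\<omega> \<in> space M"
    using 3[OF that] by (auto simp: space_prob_algebra)
qed

lemma measurable_emeasure_prob_algebra:
  "B \<in> sets S \<Longrightarrow> (\<lambda>\<pi>. emeasure \<pi> B) \<in> borel_measurable (prob_algebra S)"
  by (rule measurable_compose[OF measurable_prob_algebraD[OF measurable_ident_sets[OF refl]] measurable_emeasure_subprob_algebra])

lemma kernel_image_emeasure:
  assumes J: "random_kernel M J" and \<omega>: "\<omega> \<in> space M" and \<Phi>: "sets (\<Phi> \<omega>) = sets borel"
  shows "sets (kernel_image J \<Phi> \<omega>) = sets borel"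
    and "B \<in> sets borel \<Longrightarrow> emeasure (kernel_image J \<Phi> \<omega>) B = (\<integral>\<^sup>+x. emeasure (J \<omega> x) B \<partial>\<Phi> \<omega>)"
proof -
  have ne: "space (\<Phi> \<omega>) \<noteq> {}" using sets_eq_imp_space_eq[OF \<Phi>] by simp
  have Jm: "J \<omega> \<in> measurable (\<Phi> \<omega>) (subprob_algebra borel)"
    unfolding measurable_cong_sets[OF \<Phi> refl] by (rule measurable_prob_algebraD[OF random_kernelD(1)[OF J \<omega>]])
  show "sets (kernel_image J \<Phi> \<omega>) = sets borel"
    unfolding kernel_image_def using ne random_kernelD(4)[OF J \<omega>] by (intro sets_bind) auto
  show "emeasure (kernel_image J \<Phi> \<omega>) B = (\<integral>\<^sup>+x. emeasure (J \<omega> x) B \<partial>\<Phi> \<omega>)" if "B \<in> sets borel"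
    unfolding kernel_image_def by (rule emeasure_bind[OF ne Jm that])
qed

locale randomized_transport = prob_space M
  for M :: "'w measure" and T :: "'w \<Rightarrow> ('a::euclidean_space \<times> 'a) measure"
    and \<Phi> :: "'w \<Rightarrow> 'a measure"
    and L K :: "'w \<Rightarrow> 'a \<Rightarrow> 'a measure"
    and F :: "'a measure \<Rightarrow> 'a measure measure"
    and N :: "'w \<Rightarrow> enat"
    and X :: "nat \<Rightarrow> 'w \<Rightarrow> 'a" +
  assumes transport: "random_transport M T"
    and stationary: "stationary_transport M T"
    and source: "\<Phi> = source T"
    and discrete: "purely_discrete M \<Phi>"
    and intensity: "0 < intensity M \<Phi>" "intensity M \<Phi> < \<infinity>"
    and L: "random_kernel M L"
    and disintegrates: "disintegrates M T \<Phi> L"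
    and F: "F \<in> measurable (prob_algebra borel) (prob_algebra (prob_algebra borel))"
    and barycenter: "\<And>\<pi> B. \<pi> \<in> space (prob_algebra borel) \<Longrightarrow> B \<in> sets borel \<Longrightarrow>
           (\<integral>\<^sup>+\<pi>'. emeasure \<pi>' B \<partial>F \<pi>) = emeasure \<pi> B"
    and K: "random_kernel M K"
    and enumerates: "enumerates_atoms M (generated_by M T) \<Phi> N X"
    and cond_indep: "cond_indep_given M (generated_by M T) (prob_algebra borel) N (\<lambda>n \<omega>. K \<omega> (X n \<omega>))"
    and cond_law: "cond_law_given M (generated_by M T) (prob_algebra borel) N
           (\<lambda>n \<omega>. K \<omega> (X n \<omega>)) (\<lambda>n \<omega>. F (L \<omega> (X n \<omega>)))"
    and palm: "palm_expectation M \<Phi> (\<lambda>\<mu>. emeasure \<mu> {0}) < \<infinity>"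
begin

abbreviation G :: "'w measure" where "G \<equiv> generated_by M T"

lemma T: "T \<in> measurable M locally_finite_algebra"
  using transport by (simp add: random_transport_def random_measure_def)

lemma T_lf: "\<omega> \<in> space M \<Longrightarrow> T \<omega> \<in> locally_finite_measures"
  by (rule measurable_lf_kernelD[OF T])

lemma \<Phi>_lf: "\<omega> \<in> space M \<Longrightarrow> \<Phi> \<omega> \<in> locally_finite_measures"
  using transport by (simp add: random_transport_def source)

lemma sets_\<Phi>: "\<omega> \<in> space M \<Longrightarrow> sets (\<Phi> \<omega>) = sets borel"
  by (rule locally_finite_measuresD(1)[OF \<Phi>_lf])

lemma subalgebra_G: "subalgebra M G"
proof -
  have "sets (vimage_algebra (space M) T locally_finite_algebra) \<subseteq> sets M"
    using T by (intro sets_image_in_sets) auto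
  then show ?thesis by (simp add: subalgebra_def generated_by_def)
qed

lemma T_G: "T \<in> measurable G locally_finite_algebra"
  unfolding generated_by_def
  by (rule measurable_vimage_algebra1) (use measurable_space[OF T] in auto)

lemma X_G: "X n \<in> borel_measurable G"
  using enumerates by (simp add: enumerates_atoms_def)

lemma X_M: "X n \<in> borel_measurable M"
  by (rule measurable_from_subalg[OF subalgebra_G X_G])

lemma N_G: "N \<in> measurable G (count_space UNIV)"
  using enumerates by (simp add: enumerates_atoms_def)

text \<open>The weight a_n of the n-th atom. It is read off \<open>T\<close> so that measurability
  with respect to \<open>G\<close> follows from that of \<open>T\<close>, and it is 0 from index
  \<open>N\<close> on, so that all series can run over every \<open>n\<close>.\<close>

definition mass :: "nat \<Rightarrow> 'w \<Rightarrow> ennreal" where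
  "mass n \<omega> = (if enat n < N \<omega> then emeasure (T \<omega>) ({X n \<omega>} \<times> UNIV) else 0)"

text \<open>The weights must be determined by \<open>T\<close> in order to pass through the
  conditional laws. The strip over the moving point \<open>X n \<omega>\<close> is the section at
  \<open>\<omega>\<close> of one measurable set, so measurability of section measures
  applies.\<close>

lemma mass_G: "mass n \<in> borel_measurable G"
proof -
  note [measurable] = X_G N_G
  have "{w \<in> space (G \<Otimes>\<^sub>M (borel \<Otimes>\<^sub>M borel)). fst (snd w) = X n (fst w)} \<in> sets (G \<Otimes>\<^sub>M (borel \<Otimes>\<^sub>M (borel :: 'a measure)))"
    by measurable
  then have A: "{w \<in> space (G \<Otimes>\<^sub>M borel). fst (snd w) = X n (fst w)} \<in> sets (G \<Otimes>\<^sub>M (borel :: ('a \<times> 'a) measure))"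
    unfolding borel_prod .
  have "(\<lambda>\<omega>. emeasure (T \<omega>) (Pair \<omega> -` {w \<in> space (G \<Otimes>\<^sub>M borel). fst (snd w) = X n (fst w)})) \<in> borel_measurable G"
    by (rule measurable_emeasure_lf_kernel_section[OF T_G A])
  also have "?this \<longleftrightarrow> (\<lambda>\<omega>. emeasure (T \<omega>) ({X n \<omega>} \<times> UNIV)) \<in> borel_measurable G"
    by (intro measurable_cong arg_cong[where f="emeasure _"]) (auto simp: space_pair_measure)
  finally have [measurable]: "(\<lambda>\<omega>. emeasure (T \<omega>) ({X n \<omega>} \<times> UNIV)) \<in> borel_measurable G" .
  show ?thesis unfolding mass_def by measurable
qed

lemma mass_M[measurable]: "mass n \<in> borel_measurable M"
  by (rule measurable_from_subalg[OF subalgebra_G mass_G])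

lemma mass_eq: "\<omega> \<in> space M \<Longrightarrow> mass n \<omega> = (if enat n < N \<omega> then emeasure (\<Phi> \<omega>) {X n \<omega>} else 0)"
proof -
  assume \<omega>: "\<omega> \<in> space M"
  note D = locally_finite_measuresD[OF T_lf[OF \<omega>]]
  have "(fst :: 'a \<times> 'a \<Rightarrow> 'a) \<in> measurable (T \<omega>) borel"
    unfolding measurable_cong_sets[OF D(1) refl] by (simp add: borel_prod[symmetric])
  moreover have "fst -` {X n \<omega>} = {X n \<omega>} \<times> (UNIV :: 'a set)" by auto
  ultimately show ?thesis by (simp add: mass_def source source_def emeasure_distr D(2))
qed

lemma AE_inj: "AE \<omega> in M. inj_on (\<lambda>n. X n \<omega>) {n. enat n < N \<omega>}"
  using enumerates by (auto simp: enumerates_atoms_def bij_betw_def)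

text \<open>The quantifier over \<open>f\<close> stands inside the almost sure statement: one null
  set serves all functions, so that integrands depending on \<open>\<omega>\<close>, such as those
  built from \<open>J \<omega>\<close> or \<open>L \<omega>\<close>, may be inserted.\<close>

lemma AE_nn_integral_\<Phi>:
  "AE \<omega> in M. \<forall>f\<in>borel_measurable borel. (\<integral>\<^sup>+x. f x \<partial>\<Phi> \<omega>) = (\<Sum>n. mass n \<omega> * f (X n \<omega>))"
proof -
  obtain Y X' where Y: "AE \<omega> in M. \<forall>B\<in>sets borel.
         emeasure (\<Phi> \<omega>) B = (\<Sum>n. ennreal (Y n \<omega>) * indicator B (X' n \<omega> :: 'a))"
    using discrete unfolding purely_discrete_def by blast
  have bij: "AE \<omega> in M. bij_betw (\<lambda>n. X n \<omega>) {n. enat n < N \<omega>} {x. emeasure (\<Phi> \<omega>) {x} > 0}"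
    using enumerates by (simp add: enumerates_atoms_def)
  show ?thesis using Y bij AE_space
  proof eventually_elim
    case (elim \<omega>)
    show ?case
    proof
      fix f :: "'a \<Rightarrow> ennreal" assume f: "f \<in> borel_measurable borel"
      have "(\<integral>\<^sup>+x. f x \<partial>\<Phi> \<omega>) = (\<Sum>n. (if n \<in> {n. enat n < N \<omega>} then emeasure (\<Phi> \<omega>) {X n \<omega>} else 0) * f (X n \<omega>))"
        using elim by (intro nn_integral_purely_discrete[OF sets_\<Phi> _ _ f, where Y="\<lambda>n. Y n \<omega>" and x="\<lambda>n. X' n \<omega>"]) auto
      then show "(\<integral>\<^sup>+x. f x \<partial>\<Phi> \<omega>) = (\<Sum>n. mass n \<omega> * f (X n \<omega>))"
        using elim(3) by (simp add: mass_eq)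
    qed
  qed
qed

lemma AE_kernel_image:
  assumes J: "random_kernel M J"
  shows "AE \<omega> in M. \<forall>B\<in>sets borel. emeasure (kernel_image J \<Phi> \<omega>) B = (\<Sum>n. mass n \<omega> * emeasure (J \<omega> (X n \<omega>)) B)"
  using AE_nn_integral_\<Phi> AE_space
proof eventually_elim
  case (elim \<omega>)
  have "(\<lambda>x. emeasure (J \<omega> x) B) \<in> borel_measurable borel" if "B \<in> sets borel" for B
    using measurable_compose[OF random_kernelD(1)[OF J elim(2)] measurable_emeasure_prob_algebra[OF that]] .
  then show ?case
    using elim(1) kernel_image_emeasure(2)[where \<Phi>=\<Phi>, OF J elim(2) sets_\<Phi>[OF elim(2)]] by auto
qed

text \<open>Disintegration followed by expansion over the atoms, again with one null set for all
  \<open>f\<close>. This is the summation premise of \<open>diag_integral_eq_suminf\<close>.\<close>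

lemma AE_nn_integral_T:
  "AE \<omega> in M. \<forall>f\<in>borel_measurable borel.
    (\<integral>\<^sup>+p. f p \<partial>T \<omega>) = (\<Sum>n. mass n \<omega> * (\<integral>\<^sup>+y. f (X n \<omega>, y) \<partial>L \<omega> (X n \<omega>)))"
  using AE_nn_integral_\<Phi> disintegrates[unfolded disintegrates_def] AE_space
proof eventually_elim
  case (elim \<omega>)
  note D = locally_finite_measuresD[OF T_lf[OF elim(3)]]
  show ?case
  proof
    fix f :: "'a \<times> 'a \<Rightarrow> ennreal" assume f: "f \<in> borel_measurable borel"
    have "(\<lambda>(x, y). f (x, y)) \<in> borel_measurable (borel \<Otimes>\<^sub>M borel)" using f by (simp add: borel_prod)
    then have m: "(\<lambda>x. \<integral>\<^sup>+y. f (x, y) \<partial>L \<omega> x) \<in> borel_measurable borel"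
      by (rule nn_integral_measurable_subprob_algebra2) (rule measurable_prob_algebraD[OF random_kernelD(1)[OF L elim(3)]])
    have "(\<integral>\<^sup>+p. f p \<partial>T \<omega>) = (\<integral>\<^sup>+x. (\<integral>\<^sup>+y. f (x, y) \<partial>L \<omega> x) \<partial>\<Phi> \<omega>)"
      using elim(2) by (intro nn_integral_disintegration[OF D(1) sets_\<Phi>[OF elim(3)] random_kernelD(1)[OF L elim(3)] _ f]) auto
    also have "\<dots> = (\<Sum>n. mass n \<omega> * (\<integral>\<^sup>+y. f (X n \<omega>, y) \<partial>L \<omega> (X n \<omega>)))"
      using elim(1) m by blast
    finally show "(\<integral>\<^sup>+p. f p \<partial>T \<omega>) = (\<Sum>n. mass n \<omega> * (\<integral>\<^sup>+y. f (X n \<omega>, y) \<partial>L \<omega> (X n \<omega>)))" .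
  qed
qed

text \<open>The bridge of the argument: on the left a functional of \<open>T\<close> to which
  stationarity applies, on the right the series over atoms in which moments are computed.\<close>

lemma AE_diag_integral:
  assumes f: "(\<lambda>(x, y, z). f x y z) \<in> borel_measurable (borel \<Otimes>\<^sub>M borel \<Otimes>\<^sub>M borel)"
  shows "AE \<omega> in M. diag_integral f (T \<omega>) =
    (\<Sum>n. mass n \<omega> * mass n \<omega> * (\<integral>\<^sup>+y. \<integral>\<^sup>+z. f (X n \<omega>) y z \<partial>L \<omega> (X n \<omega>) \<partial>L \<omega> (X n \<omega>)))"
  using AE_nn_integral_T AE_inj AE_space
proof eventually_elim
  case (elim \<omega>)
  show ?case
    by (rule diag_integral_eq_suminf[OF T_lf[OF elim(3)] _ random_kernelD(1)[OF L elim(3)] elim(2) _ f])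
      (use elim(1) in \<open>auto simp: mass_def\<close>)
qed

text \<open>Translating by \<open>x\<close> moves the atom at \<open>x\<close> to the origin, so the
  Palm integrand is the mass of \<open>\<Phi>\<close> at \<open>x\<close>. Its integral is the sum
  of the squared masses in the unit cube, which is the diagonal integral because \<open>L\<close>
  has total mass 1.\<close>

lemma palm_finite: "(\<integral>\<^sup>+\<omega>. diag_integral (\<lambda>x y z. indicator (cbox 0 One) x) (T \<omega>) \<partial>M) < \<infinity>"
proof -
  let ?I = "\<integral>\<^sup>+\<omega>. (\<integral>\<^sup>+x\<in>cbox 0 One. emeasure (translate x (\<Phi> \<omega>)) {0} \<partial>\<Phi> \<omega>) \<partial>M"
  have i: "(\<lambda>(x, y, z). indicator (cbox 0 One) x :: ennreal) \<in> borel_measurable (borel \<Otimes>\<^sub>M (borel::'a measure) \<Otimes>\<^sub>M (borel::'a measure))"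
    by measurable
  have "(\<integral>\<^sup>+\<omega>. diag_integral (\<lambda>x y z. indicator (cbox 0 One) x) (T \<omega>) \<partial>M) = ?I"
  proof (rule nn_integral_cong_AE)
    show "AE \<omega> in M. diag_integral (\<lambda>x y z. indicator (cbox 0 One) x) (T \<omega>) =
      (\<integral>\<^sup>+x\<in>cbox 0 One. emeasure (translate x (\<Phi> \<omega>)) {0} \<partial>\<Phi> \<omega>)"
      using AE_diag_integral[OF i] AE_nn_integral_\<Phi> AE_space
    proof eventually_elim
      case (elim \<omega>)
      have s: "sets (\<Phi> \<omega>) = sets borel" "space (\<Phi> \<omega>) = UNIV"
        using locally_finite_measuresD[OF \<Phi>_lf[OF elim(3)]] by auto
      have "emeasure (translate x (\<Phi> \<omega>)) {0} = emeasure (\<Phi> \<omega>) {x}" for x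
      proof -
        have "(\<lambda>y. y - x) \<in> measurable (\<Phi> \<omega>) borel"
          unfolding measurable_cong_sets[OF s(1) refl] by measurable
        moreover have "(\<lambda>y. y - x) -` {0} = {x}" by auto
        ultimately show ?thesis by (simp add: translate_def emeasure_distr s(2))
      qed
      moreover have "(\<lambda>x. emeasure (\<Phi> \<omega>) {x} * indicator (cbox 0 One) x) \<in> borel_measurable borel"
        using measurable_emeasure_singleton[OF \<Phi>_lf[OF elim(3)]] by measurable
      ultimately have "(\<integral>\<^sup>+x\<in>cbox 0 One. emeasure (translate x (\<Phi> \<omega>)) {0} \<partial>\<Phi> \<omega>) =
        (\<Sum>n. mass n \<omega> * (emeasure (\<Phi> \<omega>) {X n \<omega>} * indicator (cbox 0 One) (X n \<omega>)))"
        using elim(2) by simp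
      also have "\<dots> = (\<Sum>n. mass n \<omega> * mass n \<omega> * indicator (cbox 0 One) (X n \<omega>))"
        using elim(3) by (intro arg_cong[where f=suminf]) (auto simp: fun_eq_iff mass_eq mult_ac)
      also have "\<dots> = diag_integral (\<lambda>x y z. indicator (cbox 0 One) x) (T \<omega>)"
        using prob_space.emeasure_space_1[OF random_kernelD(5)[OF L elim(3)]] by (simp add: elim(1))
      finally show ?case ..
    qed
  qed
  also have "\<dots> < \<infinity>"
  proof -
    \<comment> \<open>In \<open>ennreal\<close> a finite product bounds one factor only if the other
      is nonzero; here this means that the intensity is finite.\<close>
    have "inverse (intensity M \<Phi>) \<noteq> 0" using intensity by simp
    then show ?thesis using palm by (auto simp: palm_expectation_def ennreal_mult_less_top)
  qed
  finally show ?thesis .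
qed

sublocale palm_square_integrable_transport M T
  by unfold_locales (rule T stationary palm_finite)+

end

section \<open>Moments\<close>


context randomized_transport
begin

abbreviation prob_at :: "('w \<Rightarrow> 'a \<Rightarrow> 'a measure) \<Rightarrow> 'a set \<Rightarrow> nat \<Rightarrow> 'w \<Rightarrow> ennreal" where
  "prob_at J B n \<omega> \<equiv> emeasure (J \<omega> (X n \<omega>)) B"

lemma prob_at_measurable:
  assumes "random_kernel M J" "B \<in> sets borel"
  shows "prob_at J B n \<in> borel_measurable M"
  by (rule measurable_compose[OF random_kernelD(2)[OF assms(1) X_M] measurable_emeasure_prob_algebra[OF assms(2)]])

lemma prob_at_le_1: "random_kernel M J \<Longrightarrow> \<omega> \<in> space M \<Longrightarrow> prob_at J B n \<omega> \<le> 1"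
  by (rule prob_space.emeasure_le_1[OF random_kernelD(5)])

lemma law_measurable: "(\<lambda>\<omega>. F (L \<omega> (X n \<omega>))) \<in> measurable M (prob_algebra (prob_algebra borel))"
  by (rule measurable_compose[OF random_kernelD(2)[OF L X_M] F])

lemma nn_integral_law:
  "\<omega> \<in> space M \<Longrightarrow> B \<in> sets borel \<Longrightarrow> (\<integral>\<^sup>+\<pi>. emeasure \<pi> B \<partial>F (L \<omega> (X n \<omega>))) = prob_at L B n \<omega>"
  by (rule barycenter[OF random_kernelD(3)[OF L]])

lemma mass_nonzeroD: "mass n \<omega> \<noteq> 0 \<Longrightarrow> enat n < N \<omega>"
  by (auto simp: mass_def split: if_splits)

text \<open>A general \<open>h\<close> is kept because both the evaluation at a set and its square
  get averaged. Premise \<open>c0\<close> confines the weight to outcomes that have an n-th atom,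
  the ones where the conditional law is prescribed.\<close>

lemma nn_integral_randomized:
  assumes c: "c \<in> borel_measurable G" and c0: "\<And>\<omega>. c \<omega> \<noteq> 0 \<Longrightarrow> enat n < N \<omega>"
    and h: "h \<in> borel_measurable (prob_algebra borel)"
  shows "(\<integral>\<^sup>+\<omega>. c \<omega> * h (K \<omega> (X n \<omega>)) \<partial>M) = (\<integral>\<^sup>+\<omega>. c \<omega> * (\<integral>\<^sup>+\<pi>. h \<pi> \<partial>F (L \<omega> (X n \<omega>))) \<partial>M)"
proof (rule nn_integral_cond_law[OF prob_space_axioms subalgebra_G c random_kernelD(2)[OF K X_M] law_measurable _ h])
  fix A :: "'a measure set" assume "A \<in> sets (prob_algebra borel)"
  then have "AE \<omega> in M. enat n < N \<omega> \<longrightarrow>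
     cond_prob_given M G {\<omega>'\<in>space M. K \<omega>' (X n \<omega>') \<in> A} \<omega> = measure (F (L \<omega> (X n \<omega>))) A"
    using cond_law by (auto simp: cond_law_given_def)
  then show "AE \<omega> in M. c \<omega> \<noteq> 0 \<longrightarrow>
     cond_prob_given M G {\<omega>'\<in>space M. K \<omega>' (X n \<omega>') \<in> A} \<omega> = measure (F (L \<omega> (X n \<omega>))) A"
    by eventually_elim (use c0 in auto)
qed

text \<open>Averaging the evaluation at \<open>B\<close> under \<open>F\<close> returns the
  barycenter. The weight will be \<open>mass n\<close> for first moments and its square for the
  upper bound on the diagonal.\<close>

lemma nn_integral_randomized_prob_at:
  assumes c: "c \<in> borel_measurable G" and c0: "\<And>\<omega>. c \<omega> \<noteq> 0 \<Longrightarrow> enat n < N \<omega>"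
    and B: "B \<in> sets borel"
  shows "(\<integral>\<^sup>+\<omega>. c \<omega> * prob_at K B n \<omega> \<partial>M) = (\<integral>\<^sup>+\<omega>. c \<omega> * prob_at L B n \<omega> \<partial>M)"
proof -
  have "(\<integral>\<^sup>+\<omega>. c \<omega> * prob_at K B n \<omega> \<partial>M) = (\<integral>\<^sup>+\<omega>. c \<omega> * (\<integral>\<^sup>+\<pi>. emeasure \<pi> B \<partial>F (L \<omega> (X n \<omega>))) \<partial>M)"
    by (rule nn_integral_randomized[OF c c0 measurable_emeasure_prob_algebra[OF B]])
  also have "\<dots> = (\<integral>\<^sup>+\<omega>. c \<omega> * prob_at L B n \<omega> \<partial>M)"
    by (intro nn_integral_cong) (simp add: nn_integral_law B)
  finally show ?thesis .
qed

text \<open>For distinct atoms the conditional law of the pair is a product, so the two evaluations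
  are averaged separately and each returns its barycenter.\<close>

lemma nn_integral_randomized_pair:
  assumes mn: "m \<noteq> n" and B: "B \<in> sets borel"
  shows "(\<integral>\<^sup>+\<omega>. mass m \<omega> * mass n \<omega> * prob_at K B m \<omega> * prob_at K B n \<omega> \<partial>M) =
    (\<integral>\<^sup>+\<omega>. mass m \<omega> * mass n \<omega> * prob_at L B m \<omega> * prob_at L B n \<omega> \<partial>M)"
proof -
  let ?h = "\<lambda>\<pi>. emeasure \<pi> B" and ?S = "prob_algebra (borel :: 'a measure)"
  have c: "(\<lambda>\<omega>. mass m \<omega> * mass n \<omega>) \<in> borel_measurable G"
    using mass_G by measurable
  have h: "?h \<in> borel_measurable ?S" by (rule measurable_emeasure_prob_algebra[OF B])
  let ?E = "\<lambda>k A. {\<omega>'\<in>space M. K \<omega>' (X k \<omega>') \<in> A}"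
  have law1: "AE \<omega> in M. enat k < N \<omega> \<longrightarrow> cond_prob_given M G (?E k A) \<omega> = measure (F (L \<omega> (X k \<omega>))) A"
    if "A \<in> sets ?S" for k A
    using cond_law that by (simp add: cond_law_given_def)
  have law2: "AE \<omega> in M. mass m \<omega> * mass n \<omega> \<noteq> 0 \<longrightarrow>
      cond_prob_given M G {\<omega>'\<in>space M. K \<omega>' (X m \<omega>') \<in> A1 \<and> K \<omega>' (X n \<omega>') \<in> A2} \<omega> =
      measure (F (L \<omega> (X m \<omega>))) A1 * measure (F (L \<omega> (X n \<omega>))) A2"
    if A: "A1 \<in> sets ?S" "A2 \<in> sets ?S" for A1 A2
  proof -
    \<comment> \<open>The product formula takes an indexed family of sets; selecting by
      \<open>j = m\<close> gives the intended pair since \<open>m\<close> and \<open>n\<close>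
      differ.\<close>
    define A where "A j = (if j = m then A1 else A2)" for j
    have "AE \<omega> in M. (\<forall>j\<in>{m, n}. enat j < N \<omega>) \<longrightarrow>
         cond_prob_given M G {\<omega>'\<in>space M. \<forall>j\<in>{m, n}. K \<omega>' (X j \<omega>') \<in> A j} \<omega> =
         (\<Prod>j\<in>{m, n}. cond_prob_given M G (?E j (A j)) \<omega>)"
      by (rule cond_indep[unfolded cond_indep_given_def, rule_format]) (auto simp: A_def A)
    then have "AE \<omega> in M. (\<forall>j\<in>{m, n}. enat j < N \<omega>) \<longrightarrow>
         cond_prob_given M G {\<omega>'\<in>space M. K \<omega>' (X m \<omega>') \<in> A1 \<and> K \<omega>' (X n \<omega>') \<in> A2} \<omega> =
         cond_prob_given M G (?E m A1) \<omega> * cond_prob_given M G (?E n A2) \<omega>"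
      using mn by (simp add: A_def)
    then show ?thesis using law1[OF A(1), of m] law1[OF A(2), of n]
    proof eventually_elim
      case (elim \<omega>)
      show ?case
      proof
        assume "mass m \<omega> * mass n \<omega> \<noteq> 0"
        then have "enat m < N \<omega>" "enat n < N \<omega>" using mass_nonzeroD by auto
        with elim show "cond_prob_given M G {\<omega>'\<in>space M. K \<omega>' (X m \<omega>') \<in> A1 \<and> K \<omega>' (X n \<omega>') \<in> A2} \<omega> =
          measure (F (L \<omega> (X m \<omega>))) A1 * measure (F (L \<omega> (X n \<omega>))) A2" by simp
      qed
    qed
  qed
  have "(\<integral>\<^sup>+\<omega>. mass m \<omega> * mass n \<omega> * prob_at K B m \<omega> * prob_at K B n \<omega> \<partial>M) =
    (\<integral>\<^sup>+\<omega>. mass m \<omega> * mass n \<omega> * (\<integral>\<^sup>+\<pi>. ?h \<pi> \<partial>F (L \<omega> (X m \<omega>))) * (\<integral>\<^sup>+\<pi>. ?h \<pi> \<partial>F (L \<omega> (X n \<omega>))) \<partial>M)"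
    by (rule nn_integral_cond_indep_pair[OF prob_space_axioms subalgebra_G c
      random_kernelD(2)[OF K X_M] law_measurable random_kernelD(2)[OF K X_M] law_measurable law2 h h])
  also have "\<dots> = (\<integral>\<^sup>+\<omega>. mass m \<omega> * mass n \<omega> * prob_at L B m \<omega> * prob_at L B n \<omega> \<partial>M)"
    by (intro nn_integral_cong) (simp add: nn_integral_law B)
  finally show ?thesis .
qed

section \<open>Moments of kernel images and their diagonal parts\<close>

definition first_moment :: "('w \<Rightarrow> 'a \<Rightarrow> 'a measure) \<Rightarrow> 'a set \<Rightarrow> ennreal" where
  "first_moment J B = (\<integral>\<^sup>+\<omega>. emeasure (kernel_image J \<Phi> \<omega>) B \<partial>M)"

definition second_moment :: "('w \<Rightarrow> 'a \<Rightarrow> 'a measure) \<Rightarrow> 'a set \<Rightarrow> ennreal" where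
  "second_moment J B = (\<integral>\<^sup>+\<omega>. (emeasure (kernel_image J \<Phi> \<omega>) B)\<^sup>2 \<partial>M)"

definition diag_moment :: "('w \<Rightarrow> 'a \<Rightarrow> 'a measure) \<Rightarrow> 'a set \<Rightarrow> ennreal" where
  "diag_moment J B = (\<Sum>n. \<integral>\<^sup>+\<omega>. mass n \<omega> * mass n \<omega> * (prob_at J B n \<omega>)\<^sup>2 \<partial>M)"

lemma first_moment_eq_suminf:
  assumes J: "random_kernel M J" and B: "B \<in> sets borel"
  shows "first_moment J B = (\<Sum>n. \<integral>\<^sup>+\<omega>. mass n \<omega> * prob_at J B n \<omega> \<partial>M)"
proof -
  note [measurable] = prob_at_measurable[OF J B]
  have "first_moment J B = (\<integral>\<^sup>+\<omega>. (\<Sum>n. mass n \<omega> * prob_at J B n \<omega>) \<partial>M)"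
    unfolding first_moment_def using AE_kernel_image[OF J] B by (intro nn_integral_cong_AE) auto
  also have "\<dots> = (\<Sum>n. \<integral>\<^sup>+\<omega>. mass n \<omega> * prob_at J B n \<omega> \<partial>M)"
    by (rule nn_integral_suminf) measurable
  finally show ?thesis .
qed

lemma first_moment_K_eq_L: "B \<in> sets borel \<Longrightarrow> first_moment K B = first_moment L B"
  unfolding first_moment_eq_suminf[OF K] first_moment_eq_suminf[OF L]
  by (intro arg_cong[where f=suminf] ext nn_integral_randomized_prob_at mass_G mass_nonzeroD)

text \<open>The square of a nonnegative series is a double series, and it may be integrated term by
  term even if the result is infinite. The diagonal is split off because the remaining part is the
  one preserved by the randomization.\<close>

lemma second_moment_eq_suminf:
  assumes J: "random_kernel M J" and B: "B \<in> sets borel"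
  shows "second_moment J B = diag_moment J B +
    (\<Sum>m n. if m = n then 0 else (\<integral>\<^sup>+\<omega>. mass m \<omega> * mass n \<omega> * prob_at J B m \<omega> * prob_at J B n \<omega> \<partial>M))"
proof -
  note [measurable] = prob_at_measurable[OF J B]
  let ?p = "\<lambda>m n. \<integral>\<^sup>+\<omega>. mass m \<omega> * mass n \<omega> * prob_at J B m \<omega> * prob_at J B n \<omega> \<partial>M"
  have "second_moment J B = (\<integral>\<^sup>+\<omega>. (\<Sum>m. \<Sum>n. mass m \<omega> * mass n \<omega> * prob_at J B m \<omega> * prob_at J B n \<omega>) \<partial>M)"
    unfolding second_moment_def
  proof (rule nn_integral_cong_AE, rule AE_mp[OF AE_kernel_image[OF J]], rule AE_I2, rule impI)
    fix \<omega> assume "\<forall>B\<in>sets borel. emeasure (kernel_image J \<Phi> \<omega>) B = (\<Sum>n. mass n \<omega> * prob_at J B n \<omega>)"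
    then have "(emeasure (kernel_image J \<Phi> \<omega>) B)\<^sup>2 = (\<Sum>m. mass m \<omega> * prob_at J B m \<omega>) * (\<Sum>n. mass n \<omega> * prob_at J B n \<omega>)"
      using B by (simp add: power2_eq_square)
    also have "\<dots> = (\<Sum>m. (mass m \<omega> * prob_at J B m \<omega>) * (\<Sum>n. mass n \<omega> * prob_at J B n \<omega>))"
      by (rule ennreal_suminf_multc[symmetric])
    also have "\<dots> = (\<Sum>m. \<Sum>n. (mass m \<omega> * prob_at J B m \<omega>) * (mass n \<omega> * prob_at J B n \<omega>))"
      by (simp only: ennreal_suminf_cmult)
    finally show "(emeasure (kernel_image J \<Phi> \<omega>) B)\<^sup>2 = (\<Sum>m. \<Sum>n. mass m \<omega> * mass n \<omega> * prob_at J B m \<omega> * prob_at J B n \<omega>)"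
      by (simp add: mult_ac)
  qed
  also have "\<dots> = (\<Sum>m. \<Sum>n. ?p m n)"
    by (simp add: nn_integral_suminf)
  also have "\<dots> = (\<Sum>m. ?p m m + (\<Sum>n. if m = n then 0 else ?p m n))"
  proof (rule arg_cong[where f=suminf], rule ext)
    fix m
    have "(\<Sum>n. ?p m n) = (\<Sum>n. (if n = m then ?p m n else 0) + (if m = n then 0 else ?p m n))"
      by (intro arg_cong[where f=suminf]) (auto simp: fun_eq_iff)
    also have "\<dots> = (\<Sum>n. if n = m then ?p m n else 0) + (\<Sum>n. if m = n then 0 else ?p m n)"
      by (rule suminf_add[symmetric]) simp_all
    also have "(\<Sum>n. if n = m then ?p m n else 0) = ?p m m"
      using sums_unique[OF sums_single[of m "?p m"]] by simp
    finally show "(\<Sum>n. ?p m n) = ?p m m + (\<Sum>n. if m = n then 0 else ?p m n)" .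
  qed
  also have "\<dots> = (\<Sum>m. ?p m m) + (\<Sum>m n. if m = n then 0 else ?p m n)"
    by (rule suminf_add[symmetric]) simp_all
  also have "(\<Sum>m. ?p m m) = diag_moment J B"
    by (simp add: diag_moment_def power2_eq_square mult_ac)
  finally show ?thesis .
qed

text \<open>The off-diagonal parts coincide. The identity is kept additive because second moments
  may be infinite, in which case they could not be subtracted.\<close>

lemma second_moment_exchange:
  assumes B: "B \<in> sets borel"
  shows "second_moment K B + diag_moment L B = second_moment L B + diag_moment K B"
proof -
  have "(\<Sum>m n. if m = n then 0 else (\<integral>\<^sup>+\<omega>. mass m \<omega> * mass n \<omega> * prob_at K B m \<omega> * prob_at K B n \<omega> \<partial>M)) =
    (\<Sum>m n. if m = n then 0 else (\<integral>\<^sup>+\<omega>. mass m \<omega> * mass n \<omega> * prob_at L B m \<omega> * prob_at L B n \<omega> \<partial>M))"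
    by (intro arg_cong[where f=suminf] ext if_cong refl nn_integral_randomized_pair B)
  then show ?thesis
    unfolding second_moment_eq_suminf[OF K B] second_moment_eq_suminf[OF L B] by (simp add: add_ac)
qed

lemma mass_square_G: "(\<lambda>\<omega>. mass n \<omega> * mass n \<omega>) \<in> borel_measurable G"
  using mass_G by measurable

lemma mass_square_nonzeroD: "mass n \<omega> * mass n \<omega> \<noteq> 0 \<Longrightarrow> enat n < N \<omega>"
  using mass_nonzeroD by auto

text \<open>Jensen's inequality under the conditional law of \<open>K\<close> at an atom, whose barycenter is \<open>L\<close>.\<close>

lemma diag_moment_L_le_K:
  assumes B: "B \<in> sets borel"
  shows "diag_moment L B \<le> diag_moment K B"
  unfolding diag_moment_def
proof (intro suminf_le summableI)
  fix n
  have m: "(\<lambda>\<pi>. emeasure \<pi> B) \<in> borel_measurable (prob_algebra borel)"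
    by (rule measurable_emeasure_prob_algebra[OF B])
  have "(\<integral>\<^sup>+\<omega>. mass n \<omega> * mass n \<omega> * (prob_at L B n \<omega>)\<^sup>2 \<partial>M) \<le>
    (\<integral>\<^sup>+\<omega>. mass n \<omega> * mass n \<omega> * (\<integral>\<^sup>+\<pi>. (emeasure \<pi> B)\<^sup>2 \<partial>F (L \<omega> (X n \<omega>))) \<partial>M)"
  proof (intro nn_integral_mono mult_left_mono)
    fix \<omega> assume \<omega>: "\<omega> \<in> space M"
    have Q: "F (L \<omega> (X n \<omega>)) \<in> space (prob_algebra (prob_algebra borel))"
      using measurable_space[OF law_measurable \<omega>] .
    then interpret Q: prob_space "F (L \<omega> (X n \<omega>))" by (simp add: space_prob_algebra)
    have s: "sets (F (L \<omega> (X n \<omega>))) = sets (prob_algebra borel)" using Q by (simp add: space_prob_algebra)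
    have "(\<integral>\<^sup>+\<pi>. emeasure \<pi> B \<partial>F (L \<omega> (X n \<omega>)))\<^sup>2 \<le> (\<integral>\<^sup>+\<pi>. (emeasure \<pi> B)\<^sup>2 \<partial>F (L \<omega> (X n \<omega>)))"
    proof (rule Q.nn_integral_power2_ge)
      show "(\<lambda>\<pi>. emeasure \<pi> B) \<in> borel_measurable (F (L \<omega> (X n \<omega>)))"
        unfolding measurable_cong_sets[OF s refl] by (rule m)
      fix \<pi> assume "\<pi> \<in> space (F (L \<omega> (X n \<omega>)))"
      then have "prob_space \<pi>" using sets_eq_imp_space_eq[OF s] by (simp add: space_prob_algebra)
      then show "emeasure \<pi> B \<le> 1" by (rule prob_space.emeasure_le_1)
    qed
    then show "(prob_at L B n \<omega>)\<^sup>2 \<le> (\<integral>\<^sup>+\<pi>. (emeasure \<pi> B)\<^sup>2 \<partial>F (L \<omega> (X n \<omega>)))"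
      by (simp add: nn_integral_law[OF \<omega> B])
  qed simp
  also have "\<dots> = (\<integral>\<^sup>+\<omega>. mass n \<omega> * mass n \<omega> * (prob_at K B n \<omega>)\<^sup>2 \<partial>M)"
    by (rule nn_integral_randomized[OF mass_square_G mass_square_nonzeroD, symmetric])
      (use m in measurable)
  finally show "(\<integral>\<^sup>+\<omega>. mass n \<omega> * mass n \<omega> * (prob_at L B n \<omega>)\<^sup>2 \<partial>M) \<le>
    (\<integral>\<^sup>+\<omega>. mass n \<omega> * mass n \<omega> * (prob_at K B n \<omega>)\<^sup>2 \<partial>M)" .
qed

text \<open>The quantity E \<Sum> a_n^2 L_n(B) L_n(-B), written through \<open>T\<close> so that the
  asymptotics of diagonal integrals apply to it.\<close>

definition boundary_mass :: "'a set \<Rightarrow> ennreal" where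
  "boundary_mass B = (\<integral>\<^sup>+\<omega>. diag_integral (\<lambda>x y z. indicator B y * indicator (- B) z) (T \<omega>) \<partial>M)"

text \<open>The draw \<open>z\<close> is unconstrained and integrates to 1, leaving L_n(B). The
  finiteness known for diagonal integrals over bounded \<open>B\<close> thereby reaches the
  series.\<close>

lemma sum_mass_square:
  assumes B: "B \<in> sets borel"
  shows "(\<integral>\<^sup>+\<omega>. diag_integral (\<lambda>x y z. indicator B y) (T \<omega>) \<partial>M) = (\<Sum>n. \<integral>\<^sup>+\<omega>. mass n \<omega> * mass n \<omega> * prob_at L B n \<omega> \<partial>M)"
proof -
  note [measurable] = prob_at_measurable[OF L B] B
  have f: "(\<lambda>(x, y, z). indicator B y :: ennreal) \<in> borel_measurable ((borel::'a measure) \<Otimes>\<^sub>M borel \<Otimes>\<^sub>M (borel::'a measure))"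
    by measurable
  have "(\<integral>\<^sup>+\<omega>. diag_integral (\<lambda>x y z. indicator B y) (T \<omega>) \<partial>M) = (\<integral>\<^sup>+\<omega>. (\<Sum>n. mass n \<omega> * mass n \<omega> * prob_at L B n \<omega>) \<partial>M)"
  proof (rule nn_integral_cong_AE, rule AE_mp[OF AE_diag_integral[OF f]], rule AE_I2, rule impI)
    fix \<omega> assume \<omega>: "\<omega> \<in> space M" and d: "diag_integral (\<lambda>x y z. indicator B y) (T \<omega>) =
      (\<Sum>n. mass n \<omega> * mass n \<omega> * (\<integral>\<^sup>+y. \<integral>\<^sup>+z. indicator B y \<partial>L \<omega> (X n \<omega>) \<partial>L \<omega> (X n \<omega>)))"
    show "diag_integral (\<lambda>x y z. indicator B y) (T \<omega>) = (\<Sum>n. mass n \<omega> * mass n \<omega> * prob_at L B n \<omega>)"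
      unfolding d using prob_space.emeasure_space_1[OF random_kernelD(5)[OF L \<omega>]] random_kernelD(4)[OF L \<omega>] B
      by simp
  qed
  also have "\<dots> = (\<Sum>n. \<integral>\<^sup>+\<omega>. mass n \<omega> * mass n \<omega> * prob_at L B n \<omega> \<partial>M)"
    by (rule nn_integral_suminf) measurable
  finally show ?thesis .
qed

text \<open>Since \<open>L\<close> has total mass 1, L_n(B) = L_n(B)^2 + L_n(B) L_n(-B) at each
  atom: the dominating series exceeds the diagonal of \<open>L\<close> exactly by the boundary
  mass.\<close>

lemma sum_mass_square_decomposition:
  assumes B: "B \<in> sets borel"
  shows "(\<Sum>n. \<integral>\<^sup>+\<omega>. mass n \<omega> * mass n \<omega> * prob_at L B n \<omega> \<partial>M) = diag_moment L B + boundary_mass B"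
proof -
  have B': "- B \<in> sets borel" using B by simp
  note [measurable] = prob_at_measurable[OF L B] prob_at_measurable[OF L B'] B B'
  have f: "(\<lambda>(x, y, z). indicator B y * indicator (- B) z :: ennreal) \<in> borel_measurable ((borel::'a measure) \<Otimes>\<^sub>M borel \<Otimes>\<^sub>M borel)"
    by measurable
  have "boundary_mass B = (\<integral>\<^sup>+\<omega>. (\<Sum>n. mass n \<omega> * mass n \<omega> * (prob_at L B n \<omega> * prob_at L (- B) n \<omega>)) \<partial>M)"
    unfolding boundary_mass_def
  proof (rule nn_integral_cong_AE, rule AE_mp[OF AE_diag_integral[OF f]], rule AE_I2, rule impI)
    fix \<omega> assume \<omega>: "\<omega> \<in> space M" and d: "diag_integral (\<lambda>x y z. indicator B y * indicator (- B) z) (T \<omega>) =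
      (\<Sum>n. mass n \<omega> * mass n \<omega> * (\<integral>\<^sup>+y. \<integral>\<^sup>+z. indicator B y * indicator (- B) z \<partial>L \<omega> (X n \<omega>) \<partial>L \<omega> (X n \<omega>)))"
    have "B \<in> sets (L \<omega> x)" "- B \<in> sets (L \<omega> x)" for x
      using random_kernelD(4)[OF L \<omega>] B by auto
    then have "(\<integral>\<^sup>+y. \<integral>\<^sup>+z. indicator B y * indicator (- B) z \<partial>L \<omega> x \<partial>L \<omega> x) = emeasure (L \<omega> x) B * emeasure (L \<omega> x) (- B)" for x
      by (simp add: nn_integral_cmult nn_integral_multc)
    then show "diag_integral (\<lambda>x y z. indicator B y * indicator (- B) z) (T \<omega>) = (\<Sum>n. mass n \<omega> * mass n \<omega> * (prob_at L B n \<omega> * prob_at L (- B) n \<omega>))"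
      unfolding d by simp
  qed
  also have "\<dots> = (\<Sum>n. \<integral>\<^sup>+\<omega>. mass n \<omega> * mass n \<omega> * (prob_at L B n \<omega> * prob_at L (- B) n \<omega>) \<partial>M)"
    by (rule nn_integral_suminf) measurable
  finally have "diag_moment L B + boundary_mass B = (\<Sum>n. (\<integral>\<^sup>+\<omega>. mass n \<omega> * mass n \<omega> * (prob_at L B n \<omega>)\<^sup>2 \<partial>M) +
      (\<integral>\<^sup>+\<omega>. mass n \<omega> * mass n \<omega> * (prob_at L B n \<omega> * prob_at L (- B) n \<omega>) \<partial>M))"
    unfolding diag_moment_def by (simp add: suminf_add)
  also have "\<dots> = (\<Sum>n. \<integral>\<^sup>+\<omega>. mass n \<omega> * mass n \<omega> * prob_at L B n \<omega> \<partial>M)"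
  proof (rule arg_cong[where f=suminf], rule ext)
    fix n
    have "(\<integral>\<^sup>+\<omega>. mass n \<omega> * mass n \<omega> * (prob_at L B n \<omega>)\<^sup>2 \<partial>M) +
      (\<integral>\<^sup>+\<omega>. mass n \<omega> * mass n \<omega> * (prob_at L B n \<omega> * prob_at L (- B) n \<omega>) \<partial>M) =
      (\<integral>\<^sup>+\<omega>. mass n \<omega> * mass n \<omega> * (prob_at L B n \<omega>)\<^sup>2 + mass n \<omega> * mass n \<omega> * (prob_at L B n \<omega> * prob_at L (- B) n \<omega>) \<partial>M)"
      by (rule nn_integral_add[symmetric]) measurable
    also have "\<dots> = (\<integral>\<^sup>+\<omega>. mass n \<omega> * mass n \<omega> * prob_at L B n \<omega> \<partial>M)"
    proof (rule nn_integral_cong)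
      fix \<omega> assume \<omega>: "\<omega> \<in> space M"
      have s: "B \<in> sets (L \<omega> (X n \<omega>))" "space (L \<omega> (X n \<omega>)) = UNIV" "- B \<in> sets (L \<omega> (X n \<omega>))"
        using random_kernelD(4)[OF L \<omega>, of "X n \<omega>"] sets_eq_imp_space_eq[OF random_kernelD(4)[OF L \<omega>, of "X n \<omega>"]] B by auto
      have "prob_at L B n \<omega> + prob_at L (- B) n \<omega> = emeasure (L \<omega> (X n \<omega>)) (B \<union> - B)"
        using s by (intro plus_emeasure) auto
      also have "\<dots> = 1"
        using prob_space.emeasure_space_1[OF random_kernelD(5)[OF L \<omega>, of "X n \<omega>"]] s by simp
      finally have "prob_at L B n \<omega> * (prob_at L B n \<omega> + prob_at L (- B) n \<omega>) = prob_at L B n \<omega>" by simp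
      then show "mass n \<omega> * mass n \<omega> * (prob_at L B n \<omega>)\<^sup>2 + mass n \<omega> * mass n \<omega> * (prob_at L B n \<omega> * prob_at L (- B) n \<omega>) =
        mass n \<omega> * mass n \<omega> * prob_at L B n \<omega>"
        by (simp add: power2_eq_square distrib_left[symmetric])
    qed
    finally show "(\<integral>\<^sup>+\<omega>. mass n \<omega> * mass n \<omega> * (prob_at L B n \<omega>)\<^sup>2 \<partial>M) +
      (\<integral>\<^sup>+\<omega>. mass n \<omega> * mass n \<omega> * (prob_at L B n \<omega> * prob_at L (- B) n \<omega>) \<partial>M) =
      (\<integral>\<^sup>+\<omega>. mass n \<omega> * mass n \<omega> * prob_at L B n \<omega> \<partial>M)" .
  qed
  finally show ?thesis by simp
qed

text \<open>The square is dropped before \<open>K\<close> is averaged out, because the barycenter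
  property evaluates averages of expressions linear in \<open>K\<close>.\<close>

lemma diag_moment_K_le_sum:
  assumes B: "B \<in> sets borel"
  shows "diag_moment K B \<le> (\<Sum>n. \<integral>\<^sup>+\<omega>. mass n \<omega> * mass n \<omega> * prob_at L B n \<omega> \<partial>M)"
  unfolding diag_moment_def
proof (intro suminf_le summableI)
  fix n
  have "(\<integral>\<^sup>+\<omega>. mass n \<omega> * mass n \<omega> * (prob_at K B n \<omega>)\<^sup>2 \<partial>M) \<le> (\<integral>\<^sup>+\<omega>. mass n \<omega> * mass n \<omega> * prob_at K B n \<omega> \<partial>M)"
  proof (intro nn_integral_mono mult_left_mono)
    fix \<omega> assume "\<omega> \<in> space M"
    from mult_left_mono[OF prob_at_le_1[OF K this, of n B], of "prob_at K B n \<omega>"]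
    show "(prob_at K B n \<omega>)\<^sup>2 \<le> prob_at K B n \<omega>" by (simp add: power2_eq_square)
  qed simp
  also have "\<dots> = (\<integral>\<^sup>+\<omega>. mass n \<omega> * mass n \<omega> * prob_at L B n \<omega> \<partial>M)"
    by (rule nn_integral_randomized_prob_at[OF mass_square_G mass_square_nonzeroD B])
  finally show "(\<integral>\<^sup>+\<omega>. mass n \<omega> * mass n \<omega> * (prob_at K B n \<omega>)\<^sup>2 \<partial>M) \<le> (\<integral>\<^sup>+\<omega>. mass n \<omega> * mass n \<omega> * prob_at L B n \<omega> \<partial>M)" .
qed

text \<open>All three are dominated by the series of squared masses weighted with L_n(B), finite for
  bounded \<open>B\<close> by the Palm hypothesis. This is what allows cancelling the diagonal terms
  in \<open>second_moment_exchange\<close>.\<close>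

lemma diag_moment_finite:
  assumes "B \<in> sets borel" "bounded B"
  shows "diag_moment K B < \<infinity>" "diag_moment L B < \<infinity>" "boundary_mass B < \<infinity>"
proof -
  have s: "(\<Sum>n. \<integral>\<^sup>+\<omega>. mass n \<omega> * mass n \<omega> * prob_at L B n \<omega> \<partial>M) < \<infinity>"
    using diag_mass_finite[OF assms] sum_mass_square[OF assms(1)] by simp
  show "diag_moment K B < \<infinity>" by (rule le_less_trans[OF diag_moment_K_le_sum[OF assms(1)] s])
  show "diag_moment L B < \<infinity>" "boundary_mass B < \<infinity>"
    using s unfolding sum_mass_square_decomposition[OF assms(1)] by (auto simp: less_top[symmetric] top_unique)
qed

lemma diag_moment_K_le:
  assumes "B \<in> sets borel"
  shows "diag_moment K B \<le> diag_moment L B + boundary_mass B"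
  using diag_moment_K_le_sum[OF assms] sum_mass_square_decomposition[OF assms] by simp

end

section \<open>Variances\<close>


text \<open>Limits are taken in \<open>ereal\<close>, so that divergence to infinity counts as a
  limit. Adding the difference is harmless there, because its limit 0 is finite and no indeterminate
  sum arises.\<close>

lemma ereal_tendsto_of_diff_tendsto_0:
  fixes f g :: "real \<Rightarrow> real"
  assumes f: "((\<lambda>r. ereal (f r)) \<longlongrightarrow> l) at_top" and d: "((\<lambda>r. g r - f r) \<longlongrightarrow> 0) at_top"
  shows "((\<lambda>r. ereal (g r)) \<longlongrightarrow> l) at_top"
proof -
  have "((\<lambda>r. ereal (g r - f r)) \<longlongrightarrow> ereal 0) at_top" using d by (rule tendsto_ereal)
  then have "((\<lambda>r. ereal (f r) + ereal (g r - f r)) \<longlongrightarrow> l + ereal 0) at_top"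
    by (intro tendsto_add_ereal_general f) auto
  then show ?thesis by (simp add: zero_ereal_def[symmetric])
qed

text \<open>\<open>measure\<close> arises from \<open>emeasure\<close> by \<open>enn2real\<close>,
  which sends infinity to 0. Square integrability makes infinite values a null event, so real and
  extended moments agree.\<close>

lemma (in prob_space) variance_enn2real:
  assumes [measurable]: "f \<in> borel_measurable M" and fin: "(\<integral>\<^sup>+\<omega>. (f \<omega>)\<^sup>2 \<partial>M) < \<infinity>"
  shows "variance (\<lambda>\<omega>. enn2real (f \<omega>)) = enn2real (\<integral>\<^sup>+\<omega>. (f \<omega>)\<^sup>2 \<partial>M) - (enn2real (\<integral>\<^sup>+\<omega>. f \<omega> \<partial>M))\<^sup>2"
proof -
  let ?x = "\<lambda>\<omega>. enn2real (f \<omega>)"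
  have "AE \<omega> in M. (f \<omega>)\<^sup>2 \<noteq> \<infinity>" using fin by (intro nn_integral_PInf_AE) auto
  then have AE: "AE \<omega> in M. f \<omega> = ennreal (?x \<omega>)"
    by eventually_elim (auto simp: power2_eq_square less_top ennreal_mult_eq_top_iff)
  have sq: "(\<integral>\<^sup>+\<omega>. (f \<omega>)\<^sup>2 \<partial>M) = (\<integral>\<^sup>+\<omega>. ennreal ((?x \<omega>)\<^sup>2) \<partial>M)"
    using AE by (intro nn_integral_cong_AE, eventually_elim) (metis ennreal_power enn2real_nonneg)
  have int2: "integrable M (\<lambda>\<omega>. (?x \<omega>)\<^sup>2)"
    using fin sq by (intro integrableI_nonneg) auto
  have int1: "integrable M ?x"
    by (rule square_integrable_imp_integrable[OF _ int2]) simp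
  have "(\<integral>\<^sup>+\<omega>. f \<omega> \<partial>M) = (\<integral>\<^sup>+\<omega>. ennreal (?x \<omega>) \<partial>M)"
    using AE by (intro nn_integral_cong_AE) auto
  also have "\<dots> = ennreal (expectation ?x)" by (rule nn_integral_eq_integral[OF int1]) simp
  finally have "enn2real (\<integral>\<^sup>+\<omega>. f \<omega> \<partial>M) = expectation ?x" by simp
  moreover have "enn2real (\<integral>\<^sup>+\<omega>. (f \<omega>)\<^sup>2 \<partial>M) = expectation (\<lambda>\<omega>. (?x \<omega>)\<^sup>2)"
    unfolding sq by (subst nn_integral_eq_integral[OF int2]) auto
  ultimately show ?thesis using variance_eq[OF int1 int2] by simp
qed

context randomized_transport
begin

text \<open>\<open>\<Phi>\<close> is the first marginal of \<open>T\<close>, so the integral over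
  \<open>\<Phi>\<close> is one over \<open>T\<close> whose integrand depends on the first coordinate
  alone. This gives measurability on the whole space, whereas the series over atoms represents the
  value only almost surely.\<close>

lemma measurable_kernel_image_emeasure:
  assumes J: "random_kernel M J" and B: "B \<in> sets borel"
  shows "(\<lambda>\<omega>. emeasure (kernel_image J \<Phi> \<omega>) B) \<in> borel_measurable M"
proof -
  have "(\<lambda>w. (fst w, fst (snd w))) \<in> measurable (M \<Otimes>\<^sub>M ((borel :: 'a measure) \<Otimes>\<^sub>M (borel :: 'a measure))) (M \<Otimes>\<^sub>M borel)"
    by measurable
  from measurable_compose[OF this, of "\<lambda>(\<omega>, x). J \<omega> x" "prob_algebra borel"] J
  have "(\<lambda>w. J (fst w) (fst (snd w))) \<in> measurable (M \<Otimes>\<^sub>M (borel :: ('a \<times> 'a) measure)) (prob_algebra borel)"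
    by (simp add: random_kernel_def borel_prod)
  from measurable_compose[OF this measurable_emeasure_prob_algebra[OF B]]
  have "(\<lambda>\<omega>. \<integral>\<^sup>+p. emeasure (J (fst (\<omega>, p)) (fst (snd (\<omega>, p)))) B \<partial>T \<omega>) \<in> borel_measurable M"
    by (rule nn_integral_measurable_lf_kernel[OF T])
  also have "?this \<longleftrightarrow> ?thesis"
  proof (rule measurable_cong)
    fix \<omega> assume \<omega>: "\<omega> \<in> space M"
    have f: "fst \<in> measurable (T \<omega>) (borel :: 'a measure)"
      unfolding measurable_cong_sets[OF locally_finite_measuresD(1)[OF T_lf[OF \<omega>]] refl]
      by (simp add: borel_prod[symmetric])
    have m: "(\<lambda>x. emeasure (J \<omega> x) B) \<in> borel_measurable borel"
      using measurable_compose[OF random_kernelD(1)[OF J \<omega>] measurable_emeasure_prob_algebra[OF B]] .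
    have "emeasure (kernel_image J \<Phi> \<omega>) B = (\<integral>\<^sup>+x. emeasure (J \<omega> x) B \<partial>\<Phi> \<omega>)"
      by (rule kernel_image_emeasure(2)[where \<Phi>=\<Phi>, OF J \<omega> sets_\<Phi>[OF \<omega>] B])
    also have "\<dots> = (\<integral>\<^sup>+p. emeasure (J \<omega> (fst p)) B \<partial>T \<omega>)"
      unfolding source source_def by (rule nn_integral_distr[OF f]) (use m in simp)
    finally show "(\<integral>\<^sup>+p. emeasure (J (fst (\<omega>, p)) (fst (snd (\<omega>, p)))) B \<partial>T \<omega>) = emeasure (kernel_image J \<Phi> \<omega>) B"
      by simp
  qed
  finally show ?thesis .
qed

text \<open>With finite diagonal terms on both sides of \<open>second_moment_exchange\<close>, one
  second moment is infinite exactly when the other is.\<close>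

lemma locally_square_integrable_iff:
  "locally_square_integrable M (kernel_image K \<Phi>) \<longleftrightarrow> locally_square_integrable M (kernel_image L \<Phi>)"
proof -
  have "second_moment K B < \<infinity> \<longleftrightarrow> second_moment L B < \<infinity>" if "B \<in> sets borel" "bounded B" for B
    using second_moment_exchange[OF that(1)] diag_moment_finite[OF that]
    by (metis ennreal_add_eq_top infinity_ennreal_def less_top)
  then show ?thesis
    unfolding locally_square_integrable_def second_moment_def by blast
qed

lemma variance_kernel_image:
  assumes J: "random_kernel M J" and B: "B \<in> sets borel" and fin: "second_moment J B < \<infinity>"
  shows "variance (\<lambda>\<omega>. measure (kernel_image J \<Phi> \<omega>) B) = enn2real (second_moment J B) - (enn2real (first_moment J B))\<^sup>2"
  unfolding measure_def second_moment_def first_moment_def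
  by (rule variance_enn2real[OF measurable_kernel_image_emeasure[OF J B]]) (use fin in \<open>simp add: second_moment_def\<close>)

text \<open>The first moments agree and cancel, so the variances differ by the difference of the
  diagonal moments, which lies between 0 and the boundary mass.\<close>

lemma variance_difference:
  assumes B: "B \<in> sets borel" "bounded B" and fin: "second_moment L B < \<infinity>"
  shows "\<bar>variance (\<lambda>\<omega>. measure (kernel_image K \<Phi> \<omega>) B) - variance (\<lambda>\<omega>. measure (kernel_image L \<Phi> \<omega>) B)\<bar>
    \<le> enn2real (boundary_mass B)"
proof -
  note d = diag_moment_finite[OF B]
  have finK: "second_moment K B < \<infinity>"
    using second_moment_exchange[OF B(1)] d fin
    by (metis ennreal_add_eq_top infinity_ennreal_def less_top)
  \<comment> \<open>All five quantities are finite here, so the additive identity and the two bounds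
    become statements about reals.\<close>
  obtain sK sL dK dL b where r: "second_moment K B = ennreal sK" "second_moment L B = ennreal sL"
    "diag_moment K B = ennreal dK" "diag_moment L B = ennreal dL" "boundary_mass B = ennreal b"
    "0 \<le> sK" "0 \<le> sL" "0 \<le> dK" "0 \<le> dL" "0 \<le> b"
    using d fin finK
    by (metis enn2real_nonneg ennreal_enn2real infinity_ennreal_def)
  have "sK + dL = sL + dK" using second_moment_exchange[OF B(1)] r by (simp add: ennreal_plus[symmetric] del: ennreal_plus)
  moreover have "dL \<le> dK" using diag_moment_L_le_K[OF B(1)] r by simp
  moreover have "dK \<le> dL + b" using diag_moment_K_le[OF B(1)] r by (simp add: ennreal_plus[symmetric] del: ennreal_plus)
  ultimately show ?thesis
    unfolding variance_kernel_image[OF K B(1) finK] variance_kernel_image[OF L B(1) fin]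
    using r by (simp add: first_moment_K_eq_L[OF B(1)])
qed

text \<open>For Borel \<open>W\<close> the difference is bounded by the boundary mass per volume. A
  bounded convex set may fail to be Borel; then so does rW for \<open>r > 0\<close>, and both
  variances are 0 by the convention for non-measurable sets.\<close>

lemma normalized_variance_difference_tendsto_0:
  assumes sq: "locally_square_integrable M (kernel_image L \<Phi>)" and W: "W \<in> convex_averaging_sets"
  shows "((\<lambda>r. normalized_variance M (kernel_image K \<Phi>) W r - normalized_variance M (kernel_image L \<Phi>) W r) \<longlongrightarrow> 0) at_top"
proof (cases "W \<in> sets borel")
  case True
  have W': "convex W" "bounded W" "0 \<in> interior W" using W by (auto simp: convex_averaging_sets_def)
  let ?W = "\<lambda>r. (*\<^sub>R) r ` W"
  have lim: "((\<lambda>r. enn2real (boundary_mass (?W r) / emeasure lborel (?W r))) \<longlongrightarrow> 0) at_top"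
  proof -
    have "((\<lambda>r. boundary_mass (?W r) / emeasure lborel (?W r)) \<longlongrightarrow> ennreal 0) at_top"
      using diag_boundary_tendsto_0[OF W'(1) True W'(2,3)] by (simp add: boundary_mass_def)
    from tendsto_enn2real[OF this] show ?thesis by simp
  qed
  have "\<bar>normalized_variance M (kernel_image K \<Phi>) W r - normalized_variance M (kernel_image L \<Phi>) W r\<bar>
    \<le> enn2real (boundary_mass (?W r) / emeasure lborel (?W r))" for r
  proof -
    have B: "?W r \<in> sets borel" "bounded (?W r)"
      using scaleR_image_borel[OF True] bounded_scaling[OF W'(2)] by auto
    have fin: "second_moment L (?W r) < \<infinity>"
      using sq B by (simp add: locally_square_integrable_def second_moment_def)
    let ?v = "\<lambda>J. variance (\<lambda>\<omega>. measure (kernel_image J \<Phi> \<omega>) (?W r))"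
    have l: "measure lebesgue (?W r) = measure lborel (?W r)" using B by simp
    have "normalized_variance M (kernel_image K \<Phi>) W r - normalized_variance M (kernel_image L \<Phi>) W r =
      inverse (measure lborel (?W r)) * (?v K - ?v L)"
      unfolding normalized_variance_def l by (simp add: right_diff_distrib)
    then have "\<bar>normalized_variance M (kernel_image K \<Phi>) W r - normalized_variance M (kernel_image L \<Phi>) W r\<bar> =
      inverse (measure lborel (?W r)) * \<bar>?v K - ?v L\<bar>"
      by (simp add: abs_mult)
    also have "\<dots> \<le> inverse (measure lborel (?W r)) * enn2real (boundary_mass (?W r))"
      by (intro mult_left_mono variance_difference B fin) simp
    also have "\<dots> \<le> enn2real (boundary_mass (?W r) / emeasure lborel (?W r))"
    \<comment> \<open>The bound is claimed for every \<open>r\<close>, including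
      \<open>r = 0\<close>. At zero volume the left side is 0 because
      \<open>inverse 0 = 0\<close>.\<close>
    proof (cases "measure lborel (?W r) = 0")
      case False
      then have p: "0 < measure lborel (?W r)" by (simp add: zero_less_measure_iff)
      then have e: "emeasure lborel (?W r) = ennreal (measure lborel (?W r))"
        by (intro emeasure_eq_ennreal_measure) (auto simp: measure_def)
      obtain b where b: "boundary_mass (?W r) = ennreal b" "0 \<le> b"
        using diag_moment_finite(3)[OF B] by (metis enn2real_nonneg ennreal_enn2real infinity_ennreal_def)
      show ?thesis unfolding e b using p b(2) by (simp add: divide_ennreal field_simps)
    qed simp
    finally show ?thesis .
  qed
  then show ?thesis
    by (intro Lim_null_comparison[OF _ lim] always_eventually) simp
next
  case False
  have "normalized_variance M (kernel_image J \<Phi>) W r = 0" if J: "random_kernel M J" and r: "0 < r" for J r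
  proof -
    have nb: "(*\<^sub>R) r ` W \<notin> sets borel"
    proof
      assume "(*\<^sub>R) r ` W \<in> sets borel"
      from scaleR_image_borel[OF this, of "1 / r"] have "W \<in> sets borel" using r by (simp add: image_image)
      with False show False by simp
    qed
    have z: "measure (kernel_image J \<Phi> \<omega>) ((*\<^sub>R) r ` W) = 0" if "\<omega> \<in> space M" for \<omega>
      using kernel_image_emeasure(1)[where \<Phi>=\<Phi>, OF J that sets_\<Phi>[OF that]] nb
      by (intro measure_notin_sets) simp
    have "expectation (\<lambda>\<omega>. measure (kernel_image J \<Phi> \<omega>) ((*\<^sub>R) r ` W)) = expectation (\<lambda>_. 0)"
      by (rule Bochner_Integration.integral_cong) (simp_all add: z)
    then have "variance (\<lambda>\<omega>. measure (kernel_image J \<Phi> \<omega>) ((*\<^sub>R) r ` W)) = expectation (\<lambda>_. 0)"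
      by (intro Bochner_Integration.integral_cong) (simp_all add: z)
    then show ?thesis by (simp add: normalized_variance_def)
  qed
  then show ?thesis
    by (intro tendsto_eventually eventually_mono[OF eventually_gt_at_top[of 0]]) (simp add: K L)
qed

lemma limits_transfer:
  assumes sq: "locally_square_integrable M (kernel_image L \<Phi>)" and W: "W \<in> convex_averaging_sets"
  shows "((\<lambda>r. ereal (normalized_variance M (kernel_image K \<Phi>) W r)) \<longlongrightarrow> l) at_top \<longleftrightarrow>
    ((\<lambda>r. ereal (normalized_variance M (kernel_image L \<Phi>) W r)) \<longlongrightarrow> l) at_top"
proof -
  note d = normalized_variance_difference_tendsto_0[OF sq W]
  have "((\<lambda>r. normalized_variance M (kernel_image L \<Phi>) W r - normalized_variance M (kernel_image K \<Phi>) W r) \<longlongrightarrow> 0) at_top"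
    using tendsto_minus[OF d] by simp
  then show ?thesis using d ereal_tendsto_of_diff_tendsto_0 by blast
qed

end

theorem theorem4p3:
  fixes M :: "'w measure"
    and T :: "'w \<Rightarrow> ('a::euclidean_space \<times> 'a) measure"
    and \<Phi> :: "'w \<Rightarrow> 'a measure"
    and L K :: "'w \<Rightarrow> 'a \<Rightarrow> 'a measure"
    and F :: "'a measure \<Rightarrow> 'a measure measure"
    and N :: "'w \<Rightarrow> enat"
    and X :: "nat \<Rightarrow> 'w \<Rightarrow> 'a"
  assumes "prob_space M"
    and "random_transport M T"
    and "stationary_transport M T"
    and "\<Phi> = source T"
    and "purely_discrete M \<Phi>"
    and "0 < intensity M \<Phi>" and "intensity M \<Phi> < \<infinity>"
    and "random_kernel M L"
    and "disintegrates M T \<Phi> L"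
    and "F \<in> measurable (prob_algebra borel) (prob_algebra (prob_algebra borel))"
    and "\<And>\<pi> B. \<pi> \<in> space (prob_algebra borel) \<Longrightarrow> B \<in> sets borel \<Longrightarrow>
           (\<integral>\<^sup>+\<pi>'. emeasure \<pi>' B \<partial>F \<pi>) = emeasure \<pi> B"
    and "\<And>x \<pi>. \<pi> \<in> space (prob_algebra borel) \<Longrightarrow>
           F (translate x \<pi>) = distr (F \<pi>) (prob_algebra borel) (translate x)"
    and "random_kernel M K"
    and "enumerates_atoms M (generated_by M T) \<Phi> N X"
    and "cond_indep_given M (generated_by M T) (prob_algebra borel) N (\<lambda>n \<omega>. K \<omega> (X n \<omega>))"
    and "cond_law_given M (generated_by M T) (prob_algebra borel) N
           (\<lambda>n \<omega>. K \<omega> (X n \<omega>)) (\<lambda>n \<omega>. F (L \<omega> (X n \<omega>)))"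
    and "palm_expectation M \<Phi> (\<lambda>\<mu>. emeasure \<mu> {0}) < \<infinity>"
  shows "(locally_square_integrable M (kernel_image K \<Phi>) \<longleftrightarrow>
          locally_square_integrable M (kernel_image L \<Phi>)) \<and>
         (locally_square_integrable M (kernel_image L \<Phi>) \<longrightarrow>
          (\<forall>W\<in>convex_averaging_sets.
            (\<exists>l::ereal. ((\<lambda>r. ereal (normalized_variance M (kernel_image K \<Phi>) W r)) \<longlongrightarrow> l) at_top) \<or>
            (\<exists>l::ereal. ((\<lambda>r. ereal (normalized_variance M (kernel_image L \<Phi>) W r)) \<longlongrightarrow> l) at_top)
            \<longrightarrow>
            (\<exists>l::ereal. ((\<lambda>r. ereal (normalized_variance M (kernel_image K \<Phi>) W r)) \<longlongrightarrow> l) at_top \<and>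
                        ((\<lambda>r. ereal (normalized_variance M (kernel_image L \<Phi>) W r)) \<longlongrightarrow> l) at_top)))"
  proof -
  interpret randomized_transport M T \<Phi> L K F N X
    by (intro randomized_transport.intro randomized_transport_axioms.intro) (fact assms)+
  show ?thesis
    using locally_square_integrable_iff limits_transfer by blast
qed

end
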